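(* Let $A$ be a $\mathbb{Z}/2$-graded separable $C^*$-algebra, $J\lhd A$ a graded ideal, and let $(\mathcal{J}\lhd\mathcal{A},\mathcal{H},\mathcal{D},n)$ be an even relative spectral triple with Clifford normal for $J\lhd A$. Denote by $\gamma$ the grading operator on $\mathcal{H}$. Let $\widetilde{\mathcal{A}}=\{(a,b)\in\mathcal{A}\oplus\mathcal{A}: a-b\in\mathcal{J}\}$, let $\widetilde{\mathcal{H}}=\mathcal{H}\oplus\mathcal{H}$ with grading $\widetilde{\mathcal{H}}^{\pm}=\mathcal{H}^\pm\oplus\mathcal{H}^\mp$, on which $(a,b)$ acts by $(a,b)\cdot(\xi,\eta)=(a\xi,b\eta)$, and let $\widetilde{\mathcal{D}}$ be the operator on $\widetilde{\mathcal{H}}$ with $$\mathrm{Dom}(\widetilde{\mathcal{D}})=\{(\xi,\eta)\in\mathrm{Dom}(n)\oplus\mathrm{Dom}(n):\ \eta-n\gamma\xi\in\mathrm{Dom}(\mathcal{D})\},\qquad \widetilde{\mathcal{D}}(\xi,\eta)=(\mathcal{D}^*\xi,\mathcal{D}^*\eta).$$ Then $(\widetilde{\mathcal{A}},\widetilde{\mathcal{H}},\widetilde{\mathcal{D}})$ is a spectral triple for the pullback algebra $\widetilde{A}=\{(a,b)\in A\oplus A:\ a-b\in J\}$.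
   Context: Graded commutator: $[a,b]_\pm=ab-(-1)^{|a||b|}ba$. Inner products are linear in the second variable. Relative spectral triple. An even relative spectral triple $(\mathcal{J}\lhd\mathcal{A},\mathcal{H},\mathcal{D})$ for $J\lhd A$ consists of an even representation of $A$ on a $\mathbb{Z}/2$-graded separable Hilbert space $\mathcal{H}$, an odd closed symmetric (densely defined) operator $\mathcal{D}$ on $\mathcal{H}$, and dense $*$-subalgebras $\mathcal{J}\subseteq J$, $\mathcal{A}\subseteq A$ with $\mathcal{J}$ an ideal in $\mathcal{A}$, such that: (1) $a\,\mathrm{Dom}(\mathcal{D})\subset\mathrm{Dom}(\mathcal{D})$ and $[\mathcal{D},a]_\pm$ is bounded for all $a\in\mathcal{A}$; (2) $j\,\mathrm{Dom}(\mathcal{D}^* )\subset\mathrm{Dom}(\mathcal{D})$ for all $j\in\mathcal{J}$; (3) $a(1+\mathcal{D}^*\mathcal{D})^{-1/2}$ is compact for all $a\in\mathcal{A}$; (4) $a(1-P_{\ker(\mathcal{D}^* )})(1+\mathcal{D}\mathcal{D}^* )^{-1/2}$ is compact for all $a\in\mathcal{A}$. Clifford normal. A Clifford normal for an even $(\mathcal{J}\lhd\mathcal{A},\mathcal{H},\mathcal{D})$ is an odd operator $n\in\mathbb{B}(\mathcal{H})$ such that: 1) $n\,\mathrm{Dom}(\mathcal{D})\subset\mathrm{Dom}(\mathcal{D})$ and $\mathrm{Dom}(n):=\mathrm{Dom}(\mathcal{D}^* )\cap n\,\mathrm{Dom}(\mathcal{D}^* )$ is a core for $\mathcal{D}^*$;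 2) $n^*=-n$; 3) $[\mathcal{D}^*,n]$ is a densely defined symmetric operator on $\mathcal{H}$; 4) $[n,a]_\pm\mathrm{Dom}(n)\subset\mathrm{Dom}(\mathcal{D})$ for all $a\in\mathcal{A}$; 5) $(n^2+1)\mathrm{Dom}(n)\subset\mathrm{Dom}(\mathcal{D})$; 6) $\langle\xi,\mathcal{D}^*n\xi\rangle-\langle\mathcal{D}^*\xi,n\xi\rangle\ge0$ for all $\xi\in\mathrm{Dom}(n)$; 7) for $w,z\in\mathrm{Dom}(\mathcal{D}^* )$, if $\langle w,\mathcal{D}^*n\xi\rangle-\langle\mathcal{D}^*w,n\xi\rangle=-\langle z,\mathcal{D}^*\xi\rangle+\langle\mathcal{D}^*z,\xi\rangle$ for all $\xi\in\mathrm{Dom}(n)$, then $w+nz\in\mathrm{Dom}(\mathcal{D})$. A spectral triple for a (graded) $C^*$-algebra $\widetilde A$ consists of a dense $*$-subalgebra, an even representation of $\widetilde A$ on a graded Hilbert space and an odd self-adjoint operator $\widetilde{\mathcal D}$ such that elements of the subalgebra preserve $\mathrm{Dom}(\widetilde{\mathcal D})$, have bounded graded commutators with $\widetilde{\mathcal D}$, and $\tilde a(1+\widetilde{\mathcal D}^2)^{-1/2}$ is compact for all $\tilde a$ in the subalgebra.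
   Formalization: Dom(n) is taken as {ξ in Dom(D* ) : nξ in Dom(D* )} instead of Dom(D* ) ∩ n Dom(D* ) with n Dom(D* ) the image; with the image, Dom(n) can fail to contain Dom(D), and then the operator on H⊕H is not self-adjoint. *)

theory Defs
  imports "HOL-Analysis.Analysis"
begin

section \<open>Complex vector spaces, Hilbert spaces and C*-algebras\<close>

class complex_vector = real_vector +
  fixes scaleC :: "complex \<Rightarrow> 'a \<Rightarrow> 'a"  (infixr \<open>*\<^sub>C\<close> 75)
  assumes scaleC_add_right: "c *\<^sub>C (x + y) = c *\<^sub>C x + c *\<^sub>C y"
    and scaleC_add_left: "(c + d) *\<^sub>C x = c *\<^sub>C x + d *\<^sub>C x"
    and scaleC_scaleC: "c *\<^sub>C (d *\<^sub>C x) = (c * d) *\<^sub>C x"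
    and scaleC_one: "1 *\<^sub>C x = x"
    and scaleR_scaleC: "r *\<^sub>R x = complex_of_real r *\<^sub>C x"

class complex_normed_vector = complex_vector + real_normed_vector +
  assumes norm_scaleC: "norm (c *\<^sub>C x) = cmod c * norm x"

text \<open>Inner products are linear in the second variable; the underlying real inner product
  of the library is the real part.\<close>

class chilbert = complex_normed_vector + real_inner + complete_space +
  fixes cinner :: "'a \<Rightarrow> 'a \<Rightarrow> complex"
  assumes cinner_commute: "cinner x y = cnj (cinner y x)"
    and cinner_add_right: "cinner x (y + z) = cinner x y + cinner x z"
    and cinner_scaleC_right: "cinner x (c *\<^sub>C y) = c * cinner x y"
    and inner_eq_Re_cinner: "inner x y = Re (cinner x y)"

class cstar_algebra = complex_normed_vector + real_normed_algebra + banach +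
  fixes star :: "'a \<Rightarrow> 'a"
  assumes scaleC_mult_left: "(c *\<^sub>C x) * y = c *\<^sub>C (x * y)"
    and scaleC_mult_right: "x * (c *\<^sub>C y) = c *\<^sub>C (x * y)"
    and star_add: "star (x + y) = star x + star y"
    and star_scaleC: "star (c *\<^sub>C x) = cnj c *\<^sub>C star x"
    and star_mult: "star (x * y) = star y * star x"
    and star_star: "star (star x) = x"
    and cstar_identity: "norm (star x * x) = (norm x)\<^sup>2"


subsection \<open>Direct sums\<close>

instantiation prod :: (complex_vector, complex_vector) complex_vector
begin

definition scaleC_prod_def: "c *\<^sub>C p = (c *\<^sub>C fst p, c *\<^sub>C snd p)"

instance
  by standard
    (auto simp: scaleC_prod_def scaleC_add_right scaleC_add_left scaleC_scaleC scaleC_one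
      scaleR_scaleC prod_eq_iff)

end

instance prod :: (complex_normed_vector, complex_normed_vector) complex_normed_vector
proof
  fix c :: complex and x :: "'a \<times> 'b"
  have "norm (c *\<^sub>C x) = sqrt ((cmod c)\<^sup>2 * ((norm (fst x))\<^sup>2 + (norm (snd x))\<^sup>2))"
    by (simp add: norm_prod_def scaleC_prod_def norm_scaleC power_mult_distrib distrib_left)
  then show "norm (c *\<^sub>C x) = cmod c * norm x"
    by (simp add: norm_prod_def real_sqrt_mult)
qed

instantiation prod :: (chilbert, chilbert) chilbert
begin

definition cinner_prod_def:
  "cinner p q = cinner (fst p) (fst q) + cinner (snd p) (snd q)"

instance
proof
  fix x y z :: "'a \<times> 'b" and c :: complex
  show "cinner x y = cnj (cinner y x)"
    using cinner_commute[of "fst x" "fst y"] cinner_commute[of "snd x" "snd y"]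
    by (simp add: cinner_prod_def)
qed (simp_all add: cinner_prod_def cinner_add_right cinner_scaleC_right scaleC_prod_def
      inner_prod_def inner_eq_Re_cinner distrib_left)

end

text \<open>The C*-algebraic direct sum carries the maximum norm, whereas the library equips
  the product type with the Euclidean norm; hence the separate type.\<close>

datatype ('a, 'b) cstar_sum = Cstar_Sum (cfst: 'a) (csnd: 'b)

instantiation cstar_sum :: (real_vector, real_vector) real_vector
begin

definition zero_cstar_sum_def: "0 = Cstar_Sum 0 0"
definition plus_cstar_sum_def: "x + y = Cstar_Sum (cfst x + cfst y) (csnd x + csnd y)"
definition minus_cstar_sum_def: "x - y = Cstar_Sum (cfst x - cfst y) (csnd x - csnd y)"
definition uminus_cstar_sum_def: "- x = Cstar_Sum (- cfst x) (- csnd x)"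
definition scaleR_cstar_sum_def: "scaleR r x = Cstar_Sum (r *\<^sub>R cfst x) (r *\<^sub>R csnd x)"

instance
  by standard
    (simp_all add: zero_cstar_sum_def plus_cstar_sum_def minus_cstar_sum_def
      uminus_cstar_sum_def scaleR_cstar_sum_def algebra_simps)

end

instantiation cstar_sum :: (complex_vector, complex_vector) complex_vector
begin

definition scaleC_cstar_sum_def: "scaleC c x = Cstar_Sum (c *\<^sub>C cfst x) (c *\<^sub>C csnd x)"

instance
  by standard
    (simp_all add: plus_cstar_sum_def scaleR_cstar_sum_def scaleC_cstar_sum_def
      scaleC_add_right scaleC_add_left scaleC_scaleC scaleC_one scaleR_scaleC)

end

instantiation cstar_sum :: (real_normed_vector, real_normed_vector) real_normed_vector
begin

definition norm_cstar_sum_def: "norm x = max (norm (cfst x)) (norm (csnd x))"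
definition dist_cstar_sum_def: "dist x y = norm (x - (y :: ('a, 'b) cstar_sum))"
definition sgn_cstar_sum_def: "sgn x = x /\<^sub>R norm (x :: ('a, 'b) cstar_sum)"
definition uniformity_cstar_sum_def:
  "uniformity = (INF e\<in>{0<..}. principal {(x, y). dist x (y :: ('a, 'b) cstar_sum) < e})"
definition open_cstar_sum_def:
  "open U \<longleftrightarrow> (\<forall>x\<in>U. \<forall>\<^sub>F (x', y) in uniformity. x' = x \<longrightarrow> (y :: ('a, 'b) cstar_sum) \<in> U)"

instance
proof
  fix x y :: "('a, 'b) cstar_sum" and r :: real
  show "norm x = 0 \<longleftrightarrow> x = 0"
    by (cases x) (auto simp: norm_cstar_sum_def zero_cstar_sum_def max_def)
  show "norm (x + y) \<le> norm x + norm y"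
    unfolding norm_cstar_sum_def plus_cstar_sum_def cstar_sum.sel
    using norm_triangle_ineq[of "cfst x" "cfst y"] norm_triangle_ineq[of "csnd x" "csnd y"]
    by linarith
  show "norm (r *\<^sub>R x) = \<bar>r\<bar> * norm x"
    by (simp add: norm_cstar_sum_def scaleR_cstar_sum_def max_mult_distrib_left)
qed (rule dist_cstar_sum_def sgn_cstar_sum_def uniformity_cstar_sum_def open_cstar_sum_def)+

end

instance cstar_sum :: (complex_normed_vector, complex_normed_vector) complex_normed_vector
  by standard
    (simp add: norm_cstar_sum_def scaleC_cstar_sum_def norm_scaleC max_mult_distrib_left)

instance cstar_sum :: (banach, banach) banach
proof
  fix X :: "nat \<Rightarrow> ('a, 'b) cstar_sum"
  assume X: "Cauchy X"
  have dist_eq: "dist x y = max (dist (cfst x) (cfst y)) (dist (csnd x) (csnd y))"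
    for x y :: "('a, 'b) cstar_sum"
    by (simp add: dist_cstar_sum_def norm_cstar_sum_def minus_cstar_sum_def dist_norm)
  have "Cauchy (\<lambda>k. cfst (X k))" "Cauchy (\<lambda>k. csnd (X k))"
    using X unfolding Cauchy_def dist_eq max_less_iff_conj by meson+
  then obtain a b where a: "(\<lambda>k. cfst (X k)) \<longlonglongrightarrow> a" and b: "(\<lambda>k. csnd (X k)) \<longlonglongrightarrow> b"
    by (auto dest!: Cauchy_convergent simp: convergent_def)
  have "X \<longlonglongrightarrow> Cstar_Sum a b"
  proof (rule tendstoI)
    fix e :: real assume "e > 0"
    from tendstoD[OF a this] tendstoD[OF b this]
    show "\<forall>\<^sub>F k in sequentially. dist (X k) (Cstar_Sum a b) < e"
      by eventually_elim (simp add: dist_eq)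
  qed
  then show "convergent X"
    by (auto simp: convergent_def)
qed

instantiation cstar_sum :: (cstar_algebra, cstar_algebra) cstar_algebra
begin

definition times_cstar_sum_def: "x * y = Cstar_Sum (cfst x * cfst y) (csnd x * csnd y)"
definition star_cstar_sum_def: "star x = Cstar_Sum (star (cfst x)) (star (csnd x))"

instance
proof
  fix x y z :: "('a, 'b) cstar_sum" and r :: real and c :: complex
  show "x * y * z = x * (y * z)" "(x + y) * z = x * z + y * z" "x * (y + z) = x * y + x * z"
    "r *\<^sub>R x * y = r *\<^sub>R (x * y)" "x * r *\<^sub>R y = r *\<^sub>R (x * y)"
    by (simp_all add: times_cstar_sum_def plus_cstar_sum_def scaleR_cstar_sum_def algebra_simps)
  show "c *\<^sub>C x * y = c *\<^sub>C (x * y)" "x * c *\<^sub>C y = c *\<^sub>C (x * y)"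
    "star (x + y) = star x + star y" "star (c *\<^sub>C x) = cnj c *\<^sub>C star x"
    "star (x * y) = star y * star x" "star (star x) = x"
    by (simp_all add: times_cstar_sum_def plus_cstar_sum_def scaleC_cstar_sum_def
        star_cstar_sum_def scaleC_mult_left scaleC_mult_right star_add star_scaleC
        star_mult star_star)
  show "norm (x * y) \<le> norm x * norm y"
    unfolding norm_cstar_sum_def times_cstar_sum_def cstar_sum.sel
    by (intro max.boundedI order_trans[OF norm_mult_ineq] mult_mono) (auto simp: le_max_iff_disj)
  show "norm (star x * x) = (norm x)\<^sup>2"
    by (auto simp: norm_cstar_sum_def times_cstar_sum_def star_cstar_sum_def cstar_identity
        max_def power_mono power_mono_iff)
qed

end


subsection \<open>Graded C*-algebras and ideals\<close>

definition csubspace :: "'a::complex_vector set \<Rightarrow> bool" where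
  "csubspace S \<longleftrightarrow> subspace S \<and> (\<forall>c. \<forall>x\<in>S. c *\<^sub>C x \<in> S)"

definition star_subalgebra :: "'a::cstar_algebra set \<Rightarrow> bool" where
  "star_subalgebra S \<longleftrightarrow>
     csubspace S \<and> (\<forall>x\<in>S. \<forall>y\<in>S. x * y \<in> S) \<and> (\<forall>x\<in>S. star x \<in> S)"

definition dense_star_subalgebra :: "'a::cstar_algebra set \<Rightarrow> 'a set \<Rightarrow> bool" where
  "dense_star_subalgebra S B \<longleftrightarrow> star_subalgebra S \<and> S \<subseteq> B \<and> B \<subseteq> closure S"

text \<open>C*-algebras are closed star-subalgebras of a type of class \<open>cstar_algebra\<close>; this
  includes the full type.  A grading is encoded by the involutive star-automorphism
  \<open>\<alpha>\<close> that acts as the identity on even and as minus the identity on odd elements.\<close>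

definition graded_cstar_algebra :: "'a::cstar_algebra set \<Rightarrow> ('a \<Rightarrow> 'a) \<Rightarrow> bool" where
  "graded_cstar_algebra A \<alpha> \<longleftrightarrow>
     star_subalgebra A \<and> closed A \<and>
     (\<forall>x\<in>A. \<alpha> x \<in> A \<and> \<alpha> (\<alpha> x) = x \<and> \<alpha> (star x) = star (\<alpha> x)) \<and>
     (\<forall>x\<in>A. \<forall>y\<in>A. \<alpha> (x + y) = \<alpha> x + \<alpha> y \<and> \<alpha> (x * y) = \<alpha> x * \<alpha> y) \<and>
     (\<forall>c. \<forall>x\<in>A. \<alpha> (c *\<^sub>C x) = c *\<^sub>C \<alpha> x)"

definition two_sided_ideal :: "'a::cstar_algebra set \<Rightarrow> 'a set \<Rightarrow> bool" where
  "two_sided_ideal J A \<longleftrightarrow>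
     csubspace J \<and> J \<subseteq> A \<and> (\<forall>a\<in>A. \<forall>j\<in>J. a * j \<in> J \<and> j * a \<in> J)"

definition graded_ideal :: "'a::cstar_algebra set \<Rightarrow> 'a set \<Rightarrow> ('a \<Rightarrow> 'a) \<Rightarrow> bool" where
  "graded_ideal J A \<alpha> \<longleftrightarrow> two_sided_ideal J A \<and> closed J \<and> \<alpha> ` J \<subseteq> J"


section \<open>Operators on Hilbert spaces\<close>

subsection \<open>Bounded operators\<close>

definition bounded_clinear :: "('a::complex_normed_vector \<Rightarrow> 'b::complex_normed_vector) \<Rightarrow> bool"
  where "bounded_clinear f \<longleftrightarrow> bounded_linear f \<and> (\<forall>c x. f (c *\<^sub>C x) = c *\<^sub>C f x)"

definition is_adjoint :: "('h::chilbert \<Rightarrow> 'h) \<Rightarrow> ('h \<Rightarrow> 'h) \<Rightarrow> bool" where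
  "is_adjoint S T \<longleftrightarrow> (\<forall>x y. cinner (S x) y = cinner x (T y))"

definition compact_op :: "('h::chilbert \<Rightarrow> 'h) \<Rightarrow> bool" where
  "compact_op T \<longleftrightarrow> bounded_clinear T \<and> (\<forall>S. bounded S \<longrightarrow> compact (closure (T ` S)))"

definition positive_op :: "('h::chilbert \<Rightarrow> 'h) \<Rightarrow> bool" where
  "positive_op T \<longleftrightarrow> bounded_clinear T \<and> (\<forall>x. cinner x (T x) \<in> \<real>\<^sub>\<ge>\<^sub>0)"

definition orth_proj :: "'h::chilbert set \<Rightarrow> 'h \<Rightarrow> 'h" where
  "orth_proj M x = (THE p. p \<in> M \<and> (\<forall>m\<in>M. cinner m (x - p) = 0))"

text \<open>The grading operator: \<open>\<plusminus>1\<close> on the even and odd subspaces.\<close>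

definition grading_op :: "('h::chilbert \<Rightarrow> 'h) \<Rightarrow> bool" where
  "grading_op \<gamma> \<longleftrightarrow> bounded_clinear \<gamma> \<and> is_adjoint \<gamma> \<gamma> \<and> (\<forall>x. \<gamma> (\<gamma> x) = x)"

text \<open>Evenness: \<open>\<pi>\<close> maps even and odd elements to even and odd operators.\<close>

definition even_representation ::
    "'a::cstar_algebra set \<Rightarrow> ('a \<Rightarrow> 'a) \<Rightarrow> ('a \<Rightarrow> 'h::chilbert \<Rightarrow> 'h) \<Rightarrow> ('h \<Rightarrow> 'h) \<Rightarrow> bool" where
  "even_representation A \<alpha> \<pi> \<gamma> \<longleftrightarrow>
     (\<forall>a\<in>A. bounded_clinear (\<pi> a) \<and> is_adjoint (\<pi> (star a)) (\<pi> a)) \<and>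
     (\<forall>a\<in>A. \<forall>b\<in>A. \<forall>x. \<pi> (a + b) x = \<pi> a x + \<pi> b x \<and> \<pi> (a * b) x = \<pi> a (\<pi> b x)) \<and>
     (\<forall>c. \<forall>a\<in>A. \<forall>x. \<pi> (c *\<^sub>C a) x = c *\<^sub>C \<pi> a x) \<and>
     (\<forall>a\<in>A. \<pi> (\<alpha> a) = \<gamma> \<circ> \<pi> a \<circ> \<gamma>)"


subsection \<open>Unbounded operators\<close>

text \<open>Unbounded operators are partial functions, with domain \<open>dom T\<close>.  Products are
  \<open>map_comp\<close> and differences are \<open>op_diff\<close>, each with the maximal natural domain.\<close>

abbreviation op_app :: "('h \<rightharpoonup> 'h) \<Rightarrow> 'h \<Rightarrow> 'h"  (infixl \<open>\<cdot>\<close> 90) where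
  "T \<cdot> x \<equiv> the (T x)"

abbreviation total_op :: "('h \<Rightarrow> 'h) \<Rightarrow> ('h \<rightharpoonup> 'h)" where
  "total_op f \<equiv> Some \<circ> f"

definition op_diff :: "('h::chilbert \<rightharpoonup> 'h) \<Rightarrow> ('h \<rightharpoonup> 'h) \<Rightarrow> ('h \<rightharpoonup> 'h)" where
  "op_diff S T = (\<lambda>x. if x \<in> dom S \<inter> dom T then Some (S \<cdot> x - T \<cdot> x) else None)"

definition linear_op :: "('h::chilbert \<rightharpoonup> 'h) \<Rightarrow> bool" where
  "linear_op T \<longleftrightarrow> csubspace (Map.graph T)"

definition densely_defined :: "('h::chilbert \<rightharpoonup> 'h) \<Rightarrow> bool" where
  "densely_defined T \<longleftrightarrow> closure (dom T) = UNIV"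

definition closed_op :: "('h::chilbert \<rightharpoonup> 'h) \<Rightarrow> bool" where
  "closed_op T \<longleftrightarrow> closed (Map.graph T)"

definition symmetric_op :: "('h::chilbert \<rightharpoonup> 'h) \<Rightarrow> bool" where
  "symmetric_op T \<longleftrightarrow> (\<forall>x\<in>dom T. \<forall>y\<in>dom T. cinner x (T \<cdot> y) = cinner (T \<cdot> x) y)"

definition bounded_op :: "('h::chilbert \<rightharpoonup> 'h) \<Rightarrow> bool" where
  "bounded_op T \<longleftrightarrow> (\<exists>K. \<forall>x\<in>dom T. norm (T \<cdot> x) \<le> K * norm x)"

definition odd_op :: "('h::chilbert \<Rightarrow> 'h) \<Rightarrow> ('h \<rightharpoonup> 'h) \<Rightarrow> bool" where
  "odd_op \<gamma> T \<longleftrightarrow> (\<forall>x\<in>dom T. \<gamma> x \<in> dom T \<and> T \<cdot> (\<gamma> x) = - \<gamma> (T \<cdot> x))"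

definition adj_op :: "('h::chilbert \<rightharpoonup> 'h) \<Rightarrow> ('h \<rightharpoonup> 'h)" where
  "adj_op T = (\<lambda>y.
     if \<exists>z. \<forall>x\<in>dom T. cinner y (T \<cdot> x) = cinner z x
     then Some (THE z. \<forall>x\<in>dom T. cinner y (T \<cdot> x) = cinner z x) else None)"

definition self_adjoint_op :: "('h::chilbert \<rightharpoonup> 'h) \<Rightarrow> bool" where
  "self_adjoint_op T \<longleftrightarrow> linear_op T \<and> densely_defined T \<and> adj_op T = T"

definition is_core :: "'h::chilbert set \<Rightarrow> ('h \<rightharpoonup> 'h) \<Rightarrow> bool" where
  "is_core W T \<longleftrightarrow> W \<subseteq> dom T \<and> Map.graph T \<subseteq> closure (Map.graph (T |` W))"

definition op_kernel :: "('h::chilbert \<rightharpoonup> 'h) \<Rightarrow> 'h set" where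
  "op_kernel T = {x \<in> dom T. T \<cdot> x = 0}"

text \<open>\<open>(1 + T)\<^sup>-\<^sup>1\<^sup>/\<^sup>2\<close>, for positive self-adjoint \<open>T\<close>, is the positive bounded operator \<open>R\<close>
  such that \<open>R\<^sup>2\<close> is the everywhere defined inverse of \<open>1 + T\<close>; the equation
  \<open>T x = Some (y - x)\<close> says that \<open>x \<in> dom T\<close> and \<open>(1 + T) x = y\<close>.\<close>

definition inv_sqrt_one_plus :: "('h::chilbert \<rightharpoonup> 'h) \<Rightarrow> 'h \<Rightarrow> 'h" where
  "inv_sqrt_one_plus T =
     (THE R. positive_op R \<and> (\<forall>x y. R (R y) = x \<longleftrightarrow> T x = Some (y - x)))"

definition commutator :: "('h::chilbert \<rightharpoonup> 'h) \<Rightarrow> ('h \<Rightarrow> 'h) \<Rightarrow> ('h \<rightharpoonup> 'h)" where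
  "commutator T S = op_diff (T \<circ>\<^sub>m total_op S) (total_op S \<circ>\<^sub>m T)"

text \<open>The graded commutator of an odd operator \<open>T\<close> with a bounded operator \<open>S\<close>.  For
  homogeneous \<open>S\<close> one has \<open>\<gamma>S\<gamma> = (-1)\<^sup>|\<^sup>S\<^sup>| S\<close>, so this is \<open>TS - (-1)\<^sup>|\<^sup>T\<^sup>|\<^sup>|\<^sup>S\<^sup>| ST\<close>; in general
  it is the linear extension to \<open>S = S\<^sub>0 + S\<^sub>1\<close> with \<open>S\<^sub>0\<close> even and \<open>S\<^sub>1\<close> odd.\<close>

definition graded_commutator ::
    "('h::chilbert \<Rightarrow> 'h) \<Rightarrow> ('h \<rightharpoonup> 'h) \<Rightarrow> ('h \<Rightarrow> 'h) \<Rightarrow> ('h \<rightharpoonup> 'h)" where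
  "graded_commutator \<gamma> T S = op_diff (T \<circ>\<^sub>m total_op S) (total_op (\<gamma> \<circ> S \<circ> \<gamma>) \<circ>\<^sub>m T)"


section \<open>Spectral triples, relative spectral triples and Clifford normals\<close>

definition spectral_triple ::
    "'a::cstar_algebra set \<Rightarrow> ('a \<Rightarrow> 'a) \<Rightarrow> 'a set \<Rightarrow>
     ('a \<Rightarrow> 'h::chilbert \<Rightarrow> 'h) \<Rightarrow> ('h \<Rightarrow> 'h) \<Rightarrow> ('h \<rightharpoonup> 'h) \<Rightarrow> bool" where
  "spectral_triple A \<alpha> \<A> \<pi> \<gamma> D \<longleftrightarrow>
     graded_cstar_algebra A \<alpha> \<and> dense_star_subalgebra \<A> A \<and>
     grading_op \<gamma> \<and> even_representation A \<alpha> \<pi> \<gamma> \<and>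
     self_adjoint_op D \<and> odd_op \<gamma> D \<and>
     (\<forall>a\<in>\<A>. \<pi> a ` dom D \<subseteq> dom D \<and> bounded_op (graded_commutator \<gamma> D (\<pi> a))) \<and>
     (\<forall>a\<in>\<A>. compact_op (\<pi> a \<circ> inv_sqrt_one_plus (D \<circ>\<^sub>m D)))"

definition relative_spectral_triple ::
    "'a::cstar_algebra set \<Rightarrow> 'a set \<Rightarrow> ('a \<Rightarrow> 'a) \<Rightarrow> 'a set \<Rightarrow> 'a set \<Rightarrow>
     ('a \<Rightarrow> 'h::chilbert \<Rightarrow> 'h) \<Rightarrow> ('h \<Rightarrow> 'h) \<Rightarrow> ('h \<rightharpoonup> 'h) \<Rightarrow> bool" where
  "relative_spectral_triple J A \<alpha> \<J> \<A> \<pi> \<gamma> D \<longleftrightarrow>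
     separable_space (euclidean :: 'h topology) \<and>
     grading_op \<gamma> \<and> even_representation A \<alpha> \<pi> \<gamma> \<and>
     linear_op D \<and> densely_defined D \<and> closed_op D \<and> symmetric_op D \<and> odd_op \<gamma> D \<and>
     dense_star_subalgebra \<J> J \<and> dense_star_subalgebra \<A> A \<and> two_sided_ideal \<J> \<A> \<and>
     (\<forall>a\<in>\<A>. \<pi> a ` dom D \<subseteq> dom D \<and> bounded_op (graded_commutator \<gamma> D (\<pi> a))) \<and>
     (\<forall>j\<in>\<J>. \<pi> j ` dom (adj_op D) \<subseteq> dom D) \<and>
     (\<forall>a\<in>\<A>. compact_op (\<pi> a \<circ> inv_sqrt_one_plus (adj_op D \<circ>\<^sub>m D))) \<and>
     (\<forall>a\<in>\<A>. compact_op
        (\<pi> a \<circ> (\<lambda>x. x - orth_proj (op_kernel (adj_op D)) x)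
             \<circ> inv_sqrt_one_plus (D \<circ>\<^sub>m adj_op D)))"

text \<open>\<open>Dom(n)\<close> is the natural domain of \<open>[D\<^sup>*, n]\<close>: the vectors \<open>\<xi>\<close> for which both
  \<open>D\<^sup>* \<xi>\<close> and \<open>D\<^sup>* n \<xi>\<close> are defined, as the conditions on a Clifford normal require.  Thus
  \<open>n Dom(D\<^sup>*)\<close> in \<open>Dom(n) = Dom(D\<^sup>*) \<inter> n Dom(D\<^sup>*)\<close> is read as a preimage: since \<open>n\<close> need
  not be invertible (only \<open>n\<^sup>2 + 1\<close> maps \<open>Dom(n)\<close> to \<open>Dom(D)\<close>), the image could fail to
  contain \<open>Dom(D)\<close>.\<close>

definition normal_dom :: "('h::chilbert \<rightharpoonup> 'h) \<Rightarrow> ('h \<Rightarrow> 'h) \<Rightarrow> 'h set" where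
  "normal_dom D n = {\<xi> \<in> dom (adj_op D). n \<xi> \<in> dom (adj_op D)}"

definition clifford_normal ::
    "'a::cstar_algebra set \<Rightarrow> ('a \<Rightarrow> 'h::chilbert \<Rightarrow> 'h) \<Rightarrow> ('h \<Rightarrow> 'h) \<Rightarrow> ('h \<rightharpoonup> 'h) \<Rightarrow>
     ('h \<Rightarrow> 'h) \<Rightarrow> bool" where
  "clifford_normal \<A> \<pi> \<gamma> D n \<longleftrightarrow>
     bounded_clinear n \<and> odd_op \<gamma> (total_op n) \<and>
     n ` dom D \<subseteq> dom D \<and> is_core (normal_dom D n) (adj_op D) \<and>
     is_adjoint (\<lambda>x. - n x) n \<and>
     densely_defined (commutator (adj_op D) n) \<and> symmetric_op (commutator (adj_op D) n) \<and>
     (\<forall>a\<in>\<A>. \<forall>\<xi>\<in>normal_dom D n. graded_commutator \<gamma> (total_op n) (\<pi> a) \<cdot> \<xi> \<in> dom D) \<and>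
     (\<forall>\<xi>\<in>normal_dom D n. n (n \<xi>) + \<xi> \<in> dom D) \<and>
     (\<forall>\<xi>\<in>normal_dom D n.
        cinner \<xi> (adj_op D \<cdot> (n \<xi>)) - cinner (adj_op D \<cdot> \<xi>) (n \<xi>) \<in> \<real>\<^sub>\<ge>\<^sub>0) \<and>
     (\<forall>w\<in>dom (adj_op D). \<forall>z\<in>dom (adj_op D).
        (\<forall>\<xi>\<in>normal_dom D n.
           cinner w (adj_op D \<cdot> (n \<xi>)) - cinner (adj_op D \<cdot> w) (n \<xi>)
             = - cinner z (adj_op D \<cdot> \<xi>) + cinner (adj_op D \<cdot> z) \<xi>)
        \<longrightarrow> w + n z \<in> dom D)"


section \<open>The double\<close>

definition pullback :: "'a::cstar_algebra set \<Rightarrow> 'a set \<Rightarrow> ('a, 'a) cstar_sum set" where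
  "pullback A J = {Cstar_Sum a b | a b. a \<in> A \<and> b \<in> A \<and> a - b \<in> J}"

definition double_automorphism ::
    "('a \<Rightarrow> 'a) \<Rightarrow> ('a, 'a) cstar_sum \<Rightarrow> ('a, 'a) cstar_sum" where
  "double_automorphism \<alpha> x = Cstar_Sum (\<alpha> (cfst x)) (\<alpha> (csnd x))"

definition double_rep ::
    "('a \<Rightarrow> 'h \<Rightarrow> 'h) \<Rightarrow> ('a, 'a) cstar_sum \<Rightarrow> 'h \<times> 'h \<Rightarrow> 'h \<times> 'h" where
  "double_rep \<pi> x = (\<lambda>(\<xi>, \<eta>). (\<pi> (cfst x) \<xi>, \<pi> (csnd x) \<eta>))"

text \<open>The sign encodes that the grading of the second summand is reversed.\<close>

definition double_grading :: "('h::chilbert \<Rightarrow> 'h) \<Rightarrow> 'h \<times> 'h \<Rightarrow> 'h \<times> 'h" where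
  "double_grading \<gamma> = (\<lambda>(\<xi>, \<eta>). (\<gamma> \<xi>, - \<gamma> \<eta>))"

definition double_op ::
    "('h::chilbert \<Rightarrow> 'h) \<Rightarrow> ('h \<rightharpoonup> 'h) \<Rightarrow> ('h \<Rightarrow> 'h) \<Rightarrow> ('h \<times> 'h \<rightharpoonup> 'h \<times> 'h)" where
  "double_op \<gamma> D n = (\<lambda>(\<xi>, \<eta>).
     if \<xi> \<in> normal_dom D n \<and> \<eta> \<in> normal_dom D n \<and> \<eta> - n (\<gamma> \<xi>) \<in> dom D
     then Some (adj_op D \<cdot> \<xi>, adj_op D \<cdot> \<eta>) else None)"

end

theory Submission
  imports Defs "HOL-Computational_Algebra.Formal_Power_Series"
begin

text \<open>Write \<open>Ds\<close> for the adjoint of \<open>D\<close>, \<open>W\<close> for the domain of the normal, \<open>Dt\<close> for the double and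
  \<open>q x y\<close> for the real part of \<open>\<langle>Ds x, y\<rangle> - \<langle>x, Ds y\<rangle>\<close>.  The form \<open>q\<close> vanishes as soon as one argument
  lies in the domain of \<open>D\<close>, so it is a symplectic form on boundary values.  A Clifford normal
  preserves \<open>q\<close>, squares to \<open>- 1\<close> on boundary values, and the form \<open>- q x (n y)\<close> is symmetric and
  positive; the grading \<open>\<gamma>\<close> reverses \<open>q\<close>.

  \<^emph>\<open>Self-adjointness.\<close>  The domain of the double consists of the pairs whose boundary values
  satisfy \<open>\<eta> = n (\<gamma> \<xi>)\<close>.  As \<open>n \<circ> \<gamma>\<close> reverses \<open>q\<close>, the boundary terms of the two copies cancel and
  \<open>Dt\<close> is symmetric.  The maximality condition on the normal says precisely that a pair which
  pairs to zero with all such boundary values satisfies the same relation.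

  \<^emph>\<open>Bounded commutators.\<close>  Elements of \<open>\<A>\<close> preserve the domain of \<open>Ds\<close> by duality, they commute
  with the normal, in the graded sense, modulo the domain of \<open>D\<close>, and \<open>\<J>\<close> kills boundary values,
  so the pullback algebra preserves the gluing condition.

  \<^emph>\<open>Compactness.\<close>  For \<open>(\<xi>, \<eta>)\<close> in the domain of the double the vector \<open>\<xi> - n (\<gamma> \<eta>)\<close> lies in the
  domain of \<open>D\<close>, boundedly so by the closed graph theorem.  With \<open>Rt = (1 + Dt\<^sup>2)\<^sup>-\<^sup>1\<^sup>/\<^sup>2\<close> the operator
  \<open>K\<close> that sends \<open>f\<close>, with \<open>Rt f = (\<xi>, \<eta>)\<close>, to \<open>\<pi> a (\<xi> - n (\<gamma> \<eta>))\<close> is therefore compact.  Its adjoint is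
  \<open>K\<^sup>* h = Rt (h', - n (\<gamma> h'))\<close>, where \<open>h' = \<pi> (star a) h\<close>, and its norm is controlled by that of
  \<open>K (K\<^sup>* h)\<close>.  If \<open>K\<^sup>* h\<close> is small, then so are the components of
  \<open>(\<rho>, \<sigma>) = Dt (1 + Dt\<^sup>2)\<^sup>-\<^sup>1 (h', - n (\<gamma> h'))\<close>, whereas \<open>Ds \<rho>\<close> and \<open>Ds \<sigma>\<close> stay bounded and \<open>Ds \<rho>\<close> differs
  from \<open>h'\<close> by a small vector.

  For \<open>h = \<pi> a \<xi>\<close> the square of the norm of \<open>\<pi> a \<xi>\<close> is \<open>\<langle>\<xi>, h'\<rangle>\<close>, which is close to
  \<open>\<langle>Ds \<xi>, \<rho>\<rangle> - q \<xi> \<rho>\<close>.  The first term is small, and the Cauchy-Schwarz inequality for the positive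
  form bounds the second by the boundary energies \<open>- q \<xi> (n \<xi>)\<close> and \<open>- q \<rho> (n \<rho>)\<close>.  By the gluing
  condition these equal \<open>- q (\<gamma> \<xi>) \<eta>\<close> and \<open>- q (\<gamma> \<rho>) \<sigma>\<close>; the former is bounded, the latter small.
  So \<open>\<pi> a \<xi>\<close> is dominated by the compact operator \<open>K\<close>
  applied to \<open>K\<^sup>* (\<pi> a \<xi>)\<close>, hence depends compactly on \<open>f\<close>,
  and exchanging the two copies treats \<open>\<eta>\<close>.  The estimate is
  \<open>first_component_estimate\<close>, and \<open>first_component_compact\<close> draws the conclusion.

  The operator-theoretic background is developed on the way: representation of bounded
  functionals on subspaces, existence and uniqueness of \<open>(1 + T\<^sup>* T)\<^sup>-\<^sup>1\<^sup>/\<^sup>2\<close> through the binomial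
  series, and its identification as an isometry onto the domain of \<open>T\<close> with the graph norm.\<close>

section \<open>Inner products and bounded functionals\<close>

lemma Re_cinner [simp]: "Re (cinner x y) = inner x y"
  by (simp add: inner_eq_Re_cinner)

lemma cinner_add_left: "cinner (x + y) z = cinner x z + cinner y z"
  by (subst (1 2 3) cinner_commute) (simp add: cinner_add_right)

lemma cinner_scaleC_left: "cinner (c *\<^sub>C x) y = cnj c * cinner x y"
  by (subst (1 2) cinner_commute) (simp add: cinner_scaleC_right)

lemma Im_cinner: "Im (cinner x y) = inner (\<i> *\<^sub>C x) y"
  by (simp add: inner_eq_Re_cinner cinner_scaleC_left del: Re_cinner)

lemma cinner_eqI:
  assumes "inner x y = inner x' y'" "inner (\<i> *\<^sub>C x) y = inner (\<i> *\<^sub>C x') y'"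
  shows "cinner x y = cinner x' y'"
  using assms by (simp add: complex_eq_iff Im_cinner)

lemma cinner_minus_left: "cinner (- x) y = - cinner x y"
  using cinner_add_left[of x "- x" y] cinner_add_left[of 0 0 y] by (simp add: eq_neg_iff_add_eq_0 add.commute)

lemma cinner_minus_right: "cinner x (- y) = - cinner x y"
  using cinner_add_right[of x y "- y"] cinner_add_right[of x 0 0] by (simp add: eq_neg_iff_add_eq_0 add.commute)

lemma scaleC_minus1: "(- 1) *\<^sub>C x = - x"
  using scaleR_scaleC[of "-1" x] by simp

lemma scaleC_minus_right: "c *\<^sub>C (- x) = - (c *\<^sub>C x)"
  using scaleC_add_right[of c x "- x"] scaleC_add_right[of c 0 0]
  by (metis add.right_inverse add_cancel_right_right minus_unique)

lemma scaleC_diff_right: "c *\<^sub>C (x - y) = c *\<^sub>C x - c *\<^sub>C y"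
  using scaleC_add_right[of c x "- y"] by (simp add: scaleC_minus_right)

lemma scaleC_i_i [simp]: "\<i> *\<^sub>C (\<i> *\<^sub>C x) = - x"
  by (simp add: scaleC_scaleC scaleC_minus1)

lemma inner_scaleC_i_left: "inner (\<i> *\<^sub>C x) y = - inner (x::'h::chilbert) (\<i> *\<^sub>C y)"
proof -
  have "inner x (\<i> *\<^sub>C y) = Re (\<i> * cinner x y)"
    by (simp add: inner_eq_Re_cinner cinner_scaleC_right del: Re_cinner)
  then show ?thesis by (simp add: Im_cinner)
qed

lemma csubspaceD:
  assumes "csubspace S"
  shows "subspace S" "0 \<in> S" "x \<in> S \<Longrightarrow> y \<in> S \<Longrightarrow> x + y \<in> S" "x \<in> S \<Longrightarrow> y \<in> S \<Longrightarrow> x - y \<in> S"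
    "x \<in> S \<Longrightarrow> - x \<in> S" "x \<in> S \<Longrightarrow> c *\<^sub>C x \<in> S"
  using assms unfolding csubspace_def
  by (auto intro: subspace_0 subspace_add subspace_diff subspace_neg)

text \<open>The minimiser of \<open>norm x ^ 2 - 2 * \<phi> x\<close> over \<open>X\<close> represents \<open>\<phi>\<close>: minimising sequences are
  Cauchy by the parallelogram law, and at the limit the first variation vanishes in every
  direction of \<open>X\<close>.  On a closed subspace this
  gives orthogonal projections; on the domain of an unbounded operator it gives the values of
  the adjoint.\<close>
lemma riesz_on_subspace:
  fixes \<phi> :: "'a::{real_inner,complete_space} \<Rightarrow> real"
  assumes X: "subspace X"
    and add: "\<And>x y. x \<in> X \<Longrightarrow> y \<in> X \<Longrightarrow> \<phi> (x + y) = \<phi> x + \<phi> y"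
    and scale: "\<And>c x. x \<in> X \<Longrightarrow> \<phi> (c *\<^sub>R x) = c * \<phi> x"
    and bound: "\<And>x. x \<in> X \<Longrightarrow> \<bar>\<phi> x\<bar> \<le> K * norm x"
  obtains z where "z \<in> closure X" "\<And>x. x \<in> X \<Longrightarrow> \<phi> x = inner z x" "norm z \<le> \<bar>K\<bar>"
proof -
  define F where "F x = (norm x)\<^sup>2 - 2 * \<phi> x" for x
  have F_ge: "F x \<ge> - (K\<^sup>2)" if "x \<in> X" for x
  proof -
    have "0 \<le> (norm x - K)\<^sup>2" by simp
    then show ?thesis using bound[OF that] by (simp add: F_def power2_eq_square algebra_simps)
  qed
  define m where "m = Inf (F ` X)"
  have bdd: "bdd_below (F ` X)" using F_ge by (auto intro!: bdd_belowI)
  have ne: "F ` X \<noteq> {}" using subspace_0[OF X] by auto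
  have m_le: "m \<le> F x" if "x \<in> X" for x
    unfolding m_def using bdd that by (intro cInf_lower) auto
  have "\<exists>x\<in>X. F x < m + inverse (real (Suc k))" for k
  proof -
    have "m < m + inverse (real (Suc k))" by simp
    from cInf_lessD[OF ne this[unfolded m_def]] show ?thesis unfolding m_def by auto
  qed
  then obtain u where uX: "\<And>k. u k \<in> X" and uF: "\<And>k. F (u k) < m + inverse (real (Suc k))"
    by metis
  have para: "(norm (x - y))\<^sup>2 = 2 * F x + 2 * F y - 4 * F ((1/2) *\<^sub>R (x + y))"
    if "x \<in> X" "y \<in> X" for x y
  proof -
    have "(norm (x - y))\<^sup>2 = 2 * (norm x)\<^sup>2 + 2 * (norm y)\<^sup>2 - (norm (x + y))\<^sup>2"
      by (simp add: power2_norm_eq_inner inner_simps inner_commute)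
    moreover have "(norm ((1/2) *\<^sub>R (x + y)))\<^sup>2 = (norm (x + y))\<^sup>2 / 4"
      by (simp only: norm_scaleR power_mult_distrib) (simp add: power2_eq_square)
    moreover have "\<phi> ((1/2) *\<^sub>R (x + y)) = (\<phi> x + \<phi> y) / 2"
      using that using scale[of "x + y" "1/2"] add[of x y] subspace_add[OF X, of x y] by simp
    ultimately show ?thesis unfolding F_def by simp
  qed
  have uu: "(norm (u k - u l))\<^sup>2 \<le> 2 * inverse (real (Suc k)) + 2 * inverse (real (Suc l))" for k l
  proof -
    have "m \<le> F ((1/2) *\<^sub>R (u k + u l))"
      by (intro m_le subspace_scale[OF X] subspace_add[OF X] uX)
    then show ?thesis using uF[of k] uF[of l] para[OF uX uX, of k l] by simp
  qed
  have "Cauchy u"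
  proof (rule metric_CauchyI)
    fix e :: real assume e: "e > 0"
    then obtain M where M: "inverse (real (Suc M)) < e\<^sup>2 / 4" using reals_Archimedean[of "e\<^sup>2/4"] by auto
    have "dist (u k) (u l) < e" if "k \<ge> M" "l \<ge> M" for k l
    proof -
      have "inverse (real (Suc k)) \<le> inverse (real (Suc M))" "inverse (real (Suc l)) \<le> inverse (real (Suc M))"
        using that by (auto intro!: le_imp_inverse_le)
      then have "(norm (u k - u l))\<^sup>2 < e\<^sup>2" using uu[of k l] M by linarith
      then show ?thesis using e by (simp add: dist_norm power_less_imp_less_base)
    qed
    then show "\<exists>M. \<forall>k\<ge>M. \<forall>l\<ge>M. dist (u k) (u l) < e" by blast
  qed
  then obtain z where uz: "u \<longlonglongrightarrow> z" using Cauchy_convergent_iff convergent_def by blast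
  have zX: "z \<in> closure X" using closure_sequential uX uz by blast
  have ineq: "0 \<le> 2 * t * (inner z v - \<phi> v) + t\<^sup>2 * (norm v)\<^sup>2" if v: "v \<in> X" for v t
  proof -
    have step: "- inverse (real (Suc k)) \<le> 2 * t * (inner (u k) v - \<phi> v) + t\<^sup>2 * (norm v)\<^sup>2" for k
    proof -
      have "F (u k + t *\<^sub>R v) = F (u k) + 2 * t * (inner (u k) v - \<phi> v) + t\<^sup>2 * (norm v)\<^sup>2"
      proof -
        have "(norm (u k + t *\<^sub>R v))\<^sup>2 = (norm (u k))\<^sup>2 + 2 * t * inner (u k) v + t\<^sup>2 * (norm v)\<^sup>2"
          by (simp add: power2_norm_eq_inner inner_simps inner_commute) (simp add: power2_eq_square algebra_simps)
        then show ?thesis using uX v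
          by (simp add: F_def add scale subspace_scale[OF X] algebra_simps)
      qed
      moreover have "m \<le> F (u k + t *\<^sub>R v)" by (intro m_le subspace_add[OF X] subspace_scale[OF X] uX v)
      ultimately show ?thesis using uF[of k] by simp
    qed
    have l1: "(\<lambda>k. - inverse (real (Suc k))) \<longlonglongrightarrow> - 0"
      by (intro tendsto_minus LIMSEQ_inverse_real_of_nat)
    have l2: "(\<lambda>k. 2 * t * (inner (u k) v - \<phi> v) + t\<^sup>2 * (norm v)\<^sup>2)
        \<longlonglongrightarrow> 2 * t * (inner z v - \<phi> v) + t\<^sup>2 * (norm v)\<^sup>2"
      by (intro tendsto_intros uz)
    show ?thesis using LIMSEQ_le[OF l1 l2] step by auto
  qed
  have eq: "\<phi> v = inner z v" if v: "v \<in> X" for v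
  proof (rule ccontr)
    define d where "d = inner z v - \<phi> v"
    define N where "N = (norm v)\<^sup>2 + 1"
    assume "\<phi> v \<noteq> inner z v"
    \<comment> \<open>The parameter \<open>- d / N\<close> nearly minimises the quadratic; adding 1 to the leading coefficient
      keeps \<open>N\<close> positive also when \<open>v = 0\<close>.\<close>
    then have d: "d \<noteq> 0" by (simp add: d_def)
    have N: "N > 0" unfolding N_def by (simp add: add_nonneg_pos)
    have "0 \<le> 2 * (- d / N) * d + (- d / N)\<^sup>2 * (N - 1)"
      using ineq[OF v, of "- d / N"] by (simp add: d_def N_def)
    also have "\<dots> = - (d\<^sup>2 / N) * (1 + 1 / N)"
      using N by (simp add: field_simps power2_eq_square)
    also have "\<dots> < 0" using d N by (intro mult_neg_pos) (auto intro: add_pos_pos)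
    finally show False by simp
  qed
  have "norm z \<le> \<bar>K\<bar>"
  proof -
    have "inner z (u k) \<le> \<bar>K\<bar> * norm (u k)" for k
    proof -
      have "inner z (u k) \<le> K * norm (u k)" using bound[OF uX[of k]] eq[OF uX[of k]] by linarith
      also have "\<dots> \<le> \<bar>K\<bar> * norm (u k)" by (intro mult_right_mono) auto
      finally show ?thesis .
    qed
    moreover have "(\<lambda>k. inner z (u k)) \<longlonglongrightarrow> inner z z" "(\<lambda>k. \<bar>K\<bar> * norm (u k)) \<longlonglongrightarrow> \<bar>K\<bar> * norm z"
      by (intro tendsto_intros uz)+
    ultimately have "inner z z \<le> \<bar>K\<bar> * norm z" by (meson LIMSEQ_le)
    then have "norm z * norm z \<le> \<bar>K\<bar> * norm z" by (simp add: power2_norm_eq_inner[symmetric] power2_eq_square)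
    then show ?thesis by (cases "norm z = 0") auto
  qed
  with zX eq show thesis using that by blast
qed

lemma orthogonal_decomposition:
  fixes M :: "'a::{real_inner,complete_space} set"
  assumes "subspace M" "closed M"
  obtains p where "p \<in> M" "\<And>m. m \<in> M \<Longrightarrow> inner (x - p) m = 0"
proof -
  obtain z where "z \<in> closure M" "\<And>m. m \<in> M \<Longrightarrow> inner x m = inner z m"
  proof (rule riesz_on_subspace[OF assms(1), of "inner x" "norm x"])
    show "\<bar>inner x y\<bar> \<le> norm x * norm y" for y by (rule Cauchy_Schwarz_ineq2)
  qed (auto simp: inner_add_right)
  then show thesis using that[of z] assms(2) by (simp add: inner_diff_left)
qed

lemma subspace_closure:
  fixes X :: "'a::real_normed_vector set"
  assumes X: "subspace X"
  shows "subspace (closure X)"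
proof (rule subspaceI)
  show "0 \<in> closure X" using subspace_0[OF X] closure_subset by blast
next
  fix x y assume "x \<in> closure X" "y \<in> closure X"
  then obtain u v where "\<And>k. u k \<in> X" "u \<longlonglongrightarrow> x" "\<And>k. v k \<in> X" "v \<longlonglongrightarrow> y"
    unfolding closure_sequential by metis
  then have "\<forall>k. u k + v k \<in> X" "(\<lambda>k. u k + v k) \<longlonglongrightarrow> x + y"
    by (auto intro: subspace_add[OF X] tendsto_add)
  then show "x + y \<in> closure X"
    unfolding closure_sequential by (intro exI[of _ "\<lambda>k. u k + v k"]) simp
next
  fix c x assume "x \<in> closure X"
  then obtain u where "\<And>k. u k \<in> X" "u \<longlonglongrightarrow> x" unfolding closure_sequential by metis
  then have "\<forall>k. c *\<^sub>R u k \<in> X" "(\<lambda>k. c *\<^sub>R u k) \<longlonglongrightarrow> c *\<^sub>R x"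
    by (auto intro: subspace_scale[OF X] tendsto_scaleR)
  then show "c *\<^sub>R x \<in> closure X"
    unfolding closure_sequential by (intro exI[of _ "\<lambda>k. c *\<^sub>R u k"]) simp
qed

lemma dense_subspaceI:
  fixes X :: "'a::{real_inner,complete_space} set"
  assumes X: "subspace X" and orth: "\<And>x. (\<And>y. y \<in> X \<Longrightarrow> inner x y = 0) \<Longrightarrow> x = 0"
  shows "closure X = UNIV"
proof (intro equalityI subsetI UNIV_I)
  fix x
  obtain p where p: "p \<in> closure X" "\<And>m. m \<in> closure X \<Longrightarrow> inner (x - p) m = 0"
    using orthogonal_decomposition[of "closure X"] subspace_closure[OF X] closed_closure by metis
  have "x - p = 0"
  proof (rule orth)
    fix y assume "y \<in> X"
    then show "inner (x - p) y = 0" using p(2) closure_subset by blast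
  qed
  then show "x \<in> closure X" using p by simp
qed

lemma dense_orthogonal_0:
  fixes x :: "'a::real_inner"
  assumes "closure X = UNIV" "\<And>y. y \<in> X \<Longrightarrow> inner x y = 0"
  shows "x = 0"
proof -
  have "x \<in> closure X" using assms(1) by simp
  then obtain u where u: "\<And>k. u k \<in> X" "u \<longlonglongrightarrow> x" unfolding closure_sequential by blast
  have "(\<lambda>k. inner x (u k)) \<longlonglongrightarrow> inner x x" by (intro tendsto_intros u)
  then have "inner x x = 0" using assms(2) u(1) by (simp add: LIMSEQ_const_iff)
  then show ?thesis by simp
qed

section \<open>The binomial series for the square root\<close>

text \<open>The Taylor coefficients of \<open>sqrt (1 - t)\<close> at \<open>t = 0\<close>.\<close>
definition sqrt_coeff :: "nat \<Rightarrow> real" where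
  "sqrt_coeff k = pochhammer (- 1 / 2) k / fact k"

lemma sqrt_coeff_gbinomial: "sqrt_coeff k = (- 1) ^ k * ((1 / 2) gchoose k)"
  by (simp add: sqrt_coeff_def gbinomial_pochhammer power_mult_distrib[symmetric] flip: mult.assoc)

lemma sqrt_coeff_0 [simp]: "sqrt_coeff 0 = 1"
  by (simp add: sqrt_coeff_def)

lemma sqrt_coeff_Suc_nonpos: "sqrt_coeff (Suc k) \<le> 0"
proof -
  have "pochhammer (1 / 2 :: real) k \<ge> 0" by (rule pochhammer_nonneg) simp
  then show ?thesis by (simp add: sqrt_coeff_def pochhammer_rec divide_nonpos_pos)
qed

text \<open>The partial sums at \<open>t = 1\<close> have the closed form \<open>pochhammer (1 / 2) m / fact m\<close>.  As all
  coefficients after the first are nonpositive, this bounds the sum of their absolute values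
  by 1, so that the series still converges absolutely for operators of norm 1.\<close>
lemma sum_sqrt_coeff_nonneg: "0 \<le> (\<Sum>k\<le>m. sqrt_coeff k)"
proof -
  have "(\<Sum>k\<le>m. sqrt_coeff k) = (- 1) ^ m * ((1 / 2 - 1) gchoose m)"
    using gbinomial_sum_lower_neg[of "1 / 2 :: real" m] by (simp add: sqrt_coeff_gbinomial mult.commute)
  also have "\<dots> = pochhammer (1 / 2) m / fact m"
    by (simp add: gbinomial_pochhammer power_mult_distrib[symmetric] flip: mult.assoc)
  also have "\<dots> \<ge> 0"
    by (intro divide_nonneg_pos pochhammer_nonneg) auto
  finally show ?thesis .
qed

lemma sum_abs_sqrt_coeff_le: "(\<Sum>k<m. \<bar>sqrt_coeff (Suc k)\<bar>) \<le> 1"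
proof -
  have "(\<Sum>k<m. \<bar>sqrt_coeff (Suc k)\<bar>) = - (\<Sum>k<m. sqrt_coeff (Suc k))"
    by (simp add: sum_negf[symmetric] sqrt_coeff_Suc_nonpos)
  also have "\<dots> = 1 - (\<Sum>k\<le>m. sqrt_coeff k)"
    by (simp add: sum.atMost_shift)
  finally show ?thesis using sum_sqrt_coeff_nonneg[of m] by simp
qed

lemma summable_abs_sqrt_coeff_Suc: "summable (\<lambda>k. \<bar>sqrt_coeff (Suc k)\<bar>)"
  by (rule summableI_nonneg_bounded[of _ 1]) (simp_all add: sum_abs_sqrt_coeff_le)

lemma summable_abs_sqrt_coeff: "summable (\<lambda>k. \<bar>sqrt_coeff k\<bar>)"
  using summable_abs_sqrt_coeff_Suc by (subst (asm) summable_Suc_iff)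

lemma suminf_abs_sqrt_coeff_Suc_le: "(\<Sum>k. \<bar>sqrt_coeff (Suc k)\<bar>) \<le> 1"
  by (rule suminf_le_const[OF summable_abs_sqrt_coeff_Suc sum_abs_sqrt_coeff_le])

text \<open>The coefficients of \<open>sqrt (1 - t) * sqrt (1 - t) = 1 - t\<close>.\<close>
lemma sqrt_coeff_convolution:
  "(\<Sum>i\<le>k. sqrt_coeff i * sqrt_coeff (k - i)) = (if k = 0 then 1 else if k = 1 then - 1 else 0)"
proof -
  have "(\<Sum>i\<le>k. sqrt_coeff i * sqrt_coeff (k - i))
      = (\<Sum>i\<le>k. (- 1) ^ k * (((1 / 2) gchoose i) * ((1 / 2) gchoose (k - i))))"
  proof (rule sum.cong)
    fix i assume "i \<in> {..k}"
    then have "(- 1 :: real) ^ k = (- 1) ^ i * (- 1) ^ (k - i)" by (simp flip: power_add)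
    then show "sqrt_coeff i * sqrt_coeff (k - i) = (- 1) ^ k * (((1 / 2) gchoose i) * ((1 / 2) gchoose (k - i)))"
      by (simp add: sqrt_coeff_gbinomial)
  qed simp
  also have "\<dots> = (- 1) ^ k * ((1 :: real) gchoose k)"
    using gbinomial_Vandermonde[of "1/2 :: real" "1/2" k] by (simp add: sum_distrib_left[symmetric] atMost_atLeast0)
  also have "(1 :: real) gchoose k = of_nat (1 choose k)"
    by (metis binomial_gbinomial of_nat_1)
  also have "(- 1) ^ k * of_nat (1 choose k) = (if k = 0 then 1 else if k = 1 then - 1 else (0::real))"
    by (cases k) (auto simp: binomial_eq_0)
  finally show ?thesis .
qed

definition sqrt_series :: "('a::real_normed_vector \<Rightarrow> 'a) \<Rightarrow> 'a \<Rightarrow> 'a" where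
  "sqrt_series A x = (\<Sum>k. sqrt_coeff k *\<^sub>R (A ^^ k) x)"

context
  fixes A :: "'a::banach \<Rightarrow> 'a"
  assumes A: "bounded_linear A" and contr: "\<And>x. norm (A x) \<le> norm x"
begin

lemma funpow_bounded_linear: "bounded_linear (A ^^ k)"
  by (induction k) (auto simp: id_def intro: bounded_linear_ident bounded_linear_compose[OF A] simp: o_def)

lemma norm_funpow_le: "norm ((A ^^ k) x) \<le> norm x"
  by (induction k) (auto intro: order_trans[OF contr])

lemma sqrt_series_summable_norm: "summable (\<lambda>k. norm (sqrt_coeff k *\<^sub>R (A ^^ k) x))"
proof (rule summable_comparison_test')
  show "summable (\<lambda>k. \<bar>sqrt_coeff k\<bar> * norm x)"
    by (rule summable_mult2[OF summable_abs_sqrt_coeff])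
  show "norm (norm (sqrt_coeff k *\<^sub>R (A ^^ k) x)) \<le> \<bar>sqrt_coeff k\<bar> * norm x" if "k \<ge> 0" for k
    by (simp add: mult_left_mono norm_funpow_le)
qed

lemma sqrt_series_summable: "summable (\<lambda>k. sqrt_coeff k *\<^sub>R (A ^^ k) x)"
  by (rule summable_norm_cancel[OF sqrt_series_summable_norm])

lemma sqrt_series_bounded_linear: "bounded_linear (sqrt_series A)"
proof (rule bounded_linear_intro)
  interpret pow: bounded_linear "A ^^ k" for k by (rule funpow_bounded_linear)
  show "sqrt_series A (x + y) = sqrt_series A x + sqrt_series A y" for x y
    unfolding sqrt_series_def
    by (simp add: suminf_add[OF sqrt_series_summable sqrt_series_summable] pow.add scaleR_add_right)
  show "sqrt_series A (r *\<^sub>R x) = r *\<^sub>R sqrt_series A x" for r x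
    unfolding sqrt_series_def
    using suminf_scaleR_right[OF sqrt_series_summable, of r x]
    by (simp add: pow.scaleR mult.commute)
  show "norm (sqrt_series A x) \<le> norm x * (\<Sum>k. \<bar>sqrt_coeff k\<bar>)" for x
  proof -
    have "norm (sqrt_series A x) \<le> (\<Sum>k. norm (sqrt_coeff k *\<^sub>R (A ^^ k) x))"
      unfolding sqrt_series_def by (rule summable_norm[OF sqrt_series_summable_norm])
    also have "\<dots> \<le> (\<Sum>k. \<bar>sqrt_coeff k\<bar> * norm x)"
      by (intro suminf_le sqrt_series_summable_norm summable_mult2[OF summable_abs_sqrt_coeff])
        (simp add: mult_left_mono norm_funpow_le)
    also have "\<dots> = norm x * (\<Sum>k. \<bar>sqrt_coeff k\<bar>)"
      by (subst suminf_mult2[OF summable_abs_sqrt_coeff, symmetric]) (simp add: mult.commute)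
    finally show ?thesis .
  qed
qed

lemma sqrt_series_commute:
  assumes B: "bounded_linear B" and comm: "\<And>x. B (A x) = A (B x)"
  shows "B (sqrt_series A x) = sqrt_series A (B x)"
proof -
  have pow: "B ((A ^^ k) x) = (A ^^ k) (B x)" for k by (induction k) (auto simp: comm)
  show ?thesis unfolding sqrt_series_def
    by (subst bounded_linear.suminf[OF B sqrt_series_summable])
      (simp add: pow linear_scale[OF bounded_linear.linear[OF B]])
qed

text \<open>The Cauchy product of the series with itself: the double series converges absolutely, so it
  may be summed along the antidiagonals, where the convolution identity leaves \<open>1 - A\<close>.\<close>
lemma sqrt_series_sqrt_series: "sqrt_series A (sqrt_series A x) = x - A x"
proof -
  interpret pow: bounded_linear "A ^^ k" for k by (rule funpow_bounded_linear)
  define f where "f i j = (sqrt_coeff i * sqrt_coeff j) *\<^sub>R (A ^^ (i + j)) x" for i j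
  have sc: "(\<lambda>k. \<bar>sqrt_coeff k\<bar>) summable_on UNIV"
    using summable_abs_sqrt_coeff by (intro norm_summable_imp_summable_on) simp
  have f_sum: "(\<lambda>(i, j). f i j) summable_on UNIV \<times> UNIV"
  proof (rule Infinite_Sum.abs_summable_summable, rule Infinite_Sum.abs_summable_on_comparison_test')
    let ?g = "\<lambda>(i, j). \<bar>sqrt_coeff i\<bar> * (\<bar>sqrt_coeff j\<bar> * norm x)"
    have "(\<lambda>p. norm (?g p)) summable_on (UNIV \<times> UNIV)"
    proof (rule Infinite_Sum.abs_summable_on_Sigma_iff[THEN iffD2], intro conjI ballI)
      show "(\<lambda>j. norm (?g (i, j))) summable_on UNIV" for i
        using sc by (auto simp: abs_mult intro!: summable_on_cmult_right summable_on_cmult_left)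
      have "(\<lambda>i. norm (\<Sum>\<^sub>\<infinity>j. norm (?g (i, j)))) = (\<lambda>i. \<bar>sqrt_coeff i\<bar> * norm (\<Sum>\<^sub>\<infinity>j. \<bar>sqrt_coeff j\<bar> * norm x))"
        by (simp add: abs_mult infsum_cmult_right')
      then show "(\<lambda>i. norm (\<Sum>\<^sub>\<infinity>j. norm (?g (i, j)))) summable_on UNIV"
        using sc by (auto intro!: summable_on_cmult_left)
    qed
    then show "?g summable_on UNIV \<times> UNIV" by (rule Infinite_Sum.abs_summable_summable)
    show "norm (case p of (i, j) \<Rightarrow> f i j) \<le> (case p of (i, j) \<Rightarrow> \<bar>sqrt_coeff i\<bar> * (\<bar>sqrt_coeff j\<bar> * norm x))"
      if "p \<in> UNIV \<times> UNIV" for p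
      by (cases p) (simp add: f_def abs_mult mult.assoc mult_left_mono norm_funpow_le)
  qed
  have inner_sum: "(\<Sum>\<^sub>\<infinity>j. f i j) = sqrt_coeff i *\<^sub>R (A ^^ i) (sqrt_series A x)" for i
  proof -
    have "(\<lambda>j. f i j) = (\<lambda>j. (sqrt_coeff i *\<^sub>R (A ^^ i) (sqrt_coeff j *\<^sub>R (A ^^ j) x)))"
      by (simp add: f_def pow.scaleR funpow_add)
    moreover have "((\<lambda>j. sqrt_coeff j *\<^sub>R (A ^^ j) x) has_sum sqrt_series A x) UNIV"
      unfolding sqrt_series_def
      by (rule norm_summable_imp_has_sum[OF sqrt_series_summable_norm summable_sums[OF sqrt_series_summable]])
    then have "((\<lambda>j. sqrt_coeff i *\<^sub>R (A ^^ i) (sqrt_coeff j *\<^sub>R (A ^^ j) x)) has_sum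
        sqrt_coeff i *\<^sub>R (A ^^ i) (sqrt_series A x)) UNIV"
      by (intro has_sum_scaleR has_sum_bounded_linear[OF funpow_bounded_linear])
    ultimately show ?thesis by (simp add: infsumI)
  qed
  have "((\<lambda>i. sqrt_coeff i *\<^sub>R (A ^^ i) (sqrt_series A x)) has_sum sqrt_series A (sqrt_series A x)) UNIV"
    unfolding sqrt_series_def[of A "sqrt_series A x"]
    by (rule norm_summable_imp_has_sum[OF sqrt_series_summable_norm summable_sums[OF sqrt_series_summable]])
  then have "sqrt_series A (sqrt_series A x) = (\<Sum>\<^sub>\<infinity>i. \<Sum>\<^sub>\<infinity>j. f i j)"
    by (simp add: inner_sum infsumI)
  also have "\<dots> = infsum (\<lambda>(i, j). f i j) (UNIV \<times> UNIV)"
    by (rule infsum_Sigma'_banach[OF f_sum])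
  also have "\<dots> = infsum (\<lambda>(k, i). f i (k - i)) (SIGMA k:UNIV. {..k})"
  proof -
    have bij: "bij_betw (\<lambda>(k, i). (i, k - i)) (SIGMA k:UNIV. {..k}) (UNIV \<times> (UNIV :: nat set))"
      by (rule bij_betw_byWitness[where f' = "\<lambda>(i, j). (i + j, i)"]) auto
    show ?thesis by (subst infsum_reindex_bij_betw[OF bij, symmetric]) (simp add: case_prod_unfold)
  qed
  also have "\<dots> = (\<Sum>\<^sub>\<infinity>k. \<Sum>\<^sub>\<infinity>i\<in>{..k}. f i (k - i))"
  proof (rule infsum_Sigma'_banach[symmetric])
    have bij: "bij_betw (\<lambda>(k, i). (i, k - i)) (SIGMA k:UNIV. {..k}) (UNIV \<times> (UNIV :: nat set))"
      by (rule bij_betw_byWitness[where f' = "\<lambda>(i, j). (i + j, i)"]) auto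
    from f_sum show "(\<lambda>(k, i). f i (k - i)) summable_on (SIGMA k:UNIV. {..k})"
      by (subst (asm) summable_on_reindex_bij_betw[OF bij, symmetric]) (simp add: case_prod_unfold)
  qed
  also have "(\<lambda>k. \<Sum>\<^sub>\<infinity>i\<in>{..k}. f i (k - i)) = (\<lambda>k. (if k = 0 then 1 else if k = 1 then - 1 else 0) *\<^sub>R (A ^^ k) x)"
  proof
    fix k
    have "(\<Sum>\<^sub>\<infinity>i\<in>{..k}. f i (k - i)) = (\<Sum>i\<le>k. (sqrt_coeff i * sqrt_coeff (k - i)) *\<^sub>R (A ^^ k) x)"
      by (simp add: f_def)
    then show "(\<Sum>\<^sub>\<infinity>i\<in>{..k}. f i (k - i)) = (if k = 0 then 1 else if k = 1 then - 1 else 0) *\<^sub>R (A ^^ k) x"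
      by (simp add: scaleR_left.sum[symmetric] sqrt_coeff_convolution)
  qed
  also have "(\<Sum>\<^sub>\<infinity>k. (if k = 0 then 1 else if k = 1 then - 1 else 0) *\<^sub>R (A ^^ k) x)
      = (\<Sum>\<^sub>\<infinity>k\<in>{0, 1}. (if k = 0 then 1 else if k = 1 then - 1 else 0) *\<^sub>R (A ^^ k) x)"
    by (rule infsum_cong_neutral) auto
  also have "\<dots> = x - A x" by simp
  finally show ?thesis .
qed

end

section \<open>Positive operators\<close>

instance chilbert \<subseteq> banach ..

text \<open>The common core of the Cauchy-Schwarz inequalities for positive semidefinite forms, here
  for positive operators and for the boundary form.\<close>
lemma quadratic_nonneg_discriminant:
  fixes a b c :: real
  assumes pos: "\<And>t. 0 \<le> a + 2 * t * b + t\<^sup>2 * c" and c: "0 \<le> c"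
  shows "b\<^sup>2 \<le> a * c"
proof (cases "c = 0")
  case True
  have "b = 0"
  proof (rule ccontr)
    assume "b \<noteq> 0"
    then show False using pos[of "- (a + 1) / (2 * b)"] True by (simp add: field_simps)
  qed
  then show ?thesis using True by simp
next
  case False
  then have "c > 0" using c by simp
  have "0 \<le> c * (a + 2 * (- b / c) * b + (- b / c)\<^sup>2 * c)"
    by (rule mult_nonneg_nonneg[OF c pos])
  also have "\<dots> = a * c - b\<^sup>2" using \<open>c > 0\<close> by (simp add: field_simps power2_eq_square)
  finally show ?thesis by simp
qed

lemma bounded_clinear_bounded_linear: "bounded_clinear f \<Longrightarrow> bounded_linear f"
  by (simp add: bounded_clinear_def)

lemma bounded_clinear_scaleC: "bounded_clinear f \<Longrightarrow> f (c *\<^sub>C x) = c *\<^sub>C f x"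
  by (simp add: bounded_clinear_def)

lemma bounded_clinear_add: "bounded_clinear f \<Longrightarrow> f (x + y) = f x + f y"
  by (simp add: bounded_clinear_def bounded_linear.linear linear_add)

lemma bounded_clinear_diff: "bounded_clinear f \<Longrightarrow> f (x - y) = f x - f y"
  by (simp add: bounded_clinear_def bounded_linear.linear linear_diff)

lemma bounded_clinear_minus: "bounded_clinear f \<Longrightarrow> f (- x) = - f x"
  by (simp add: bounded_clinear_def bounded_linear.linear linear_neg)

lemma bounded_linear_scaleC: "bounded_linear (\<lambda>x :: 'a::complex_normed_vector. c *\<^sub>C x)"
  by (rule bounded_linear_intro[where K = "cmod c"])
    (simp_all add: scaleC_add_right scaleR_scaleC scaleC_scaleC norm_scaleC mult.commute)

lemma is_adjoint_inner: "is_adjoint S T \<Longrightarrow> inner (S x) y = inner x (T y)"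
  unfolding is_adjoint_def by (metis Re_cinner)

text \<open>Reality of the quadratic form forces symmetry, by polarisation over the complex numbers.\<close>
lemma positive_op_inner:
  assumes "positive_op T"
  shows "inner (T x) y = inner x (T y)" "0 \<le> inner x (T x)"
proof -
  have T: "bounded_clinear T" and pos: "cinner x (T x) \<in> \<real>\<^sub>\<ge>\<^sub>0" for x
    using assms by (auto simp: positive_op_def)
  show "0 \<le> inner x (T x)" using pos[of x] by (simp add: complex_nonneg_Reals_iff)
  have im: "inner (\<i> *\<^sub>C u) (T u) = 0" for u
    using pos[of u] by (simp add: complex_nonneg_Reals_iff Im_cinner)
  have polar: "inner (\<i> *\<^sub>C u) (T v) + inner (\<i> *\<^sub>C v) (T u) = 0" for u v
    using im[of "u + v"] im[of u] im[of v]
    by (simp add: bounded_clinear_add[OF T] scaleC_add_right inner_add_left inner_add_right)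
  show "inner (T x) y = inner x (T y)"
    using polar[of "\<i> *\<^sub>C x" y]
    by (simp add: bounded_clinear_scaleC[OF T] inner_scaleC_i_left inner_commute)
qed

lemma positive_opI:
  assumes T: "bounded_clinear T" and sym: "\<And>x y. inner (T x) y = inner x (T y)"
    and pos: "\<And>x. 0 \<le> inner x (T x)"
  shows "positive_op T"
proof -
  have "inner (\<i> *\<^sub>C x) (T x) = 0" for x
  proof -
    have "inner (\<i> *\<^sub>C x) (T x) = inner (\<i> *\<^sub>C T x) x"
      by (simp add: sym[symmetric] bounded_clinear_scaleC[OF T])
    also have "\<dots> = - inner (\<i> *\<^sub>C x) (T x)" by (metis inner_scaleC_i_left inner_commute)
    finally show ?thesis by simp
  qed
  then show ?thesis using T pos by (simp add: positive_op_def complex_nonneg_Reals_iff Im_cinner)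
qed

text \<open>The Cauchy-Schwarz inequality of the form \<open>inner x (T y)\<close>, applied to \<open>T y\<close> and \<open>y\<close>.\<close>
lemma positive_op_eq_0:
  assumes T: "positive_op T" and 0: "inner y (T y) = 0"
  shows "T y = 0"
proof -
  have lin: "bounded_clinear T" using T by (simp add: positive_op_def)
  have "(inner (T y) (T y))\<^sup>2 \<le> inner (T y) (T (T y)) * inner y (T y)"
  proof (rule quadratic_nonneg_discriminant)
    fix t
    have "0 \<le> inner (T y + t *\<^sub>R y) (T (T y + t *\<^sub>R y))" by (rule positive_op_inner(2)[OF T])
    also have "\<dots> = inner (T y) (T (T y)) + 2 * t * inner (T y) (T y) + t\<^sup>2 * inner y (T y)"
      by (simp add: bounded_clinear_add[OF lin] bounded_clinear_scaleC[OF lin] scaleR_scaleC[symmetric]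
          linear_scale[OF bounded_linear.linear[OF bounded_clinear_bounded_linear[OF lin]]]
          inner_simps positive_op_inner(1)[OF T, symmetric] power2_eq_square algebra_simps)
    finally show "0 \<le> inner (T y) (T (T y)) + 2 * t * inner (T y) (T y) + t\<^sup>2 * inner y (T y)" .
  qed (rule positive_op_inner(2)[OF T])
  then show ?thesis using 0 by simp
qed

text \<open>Positivity: in the quadratic form of the series the constant term is \<open>norm x ^ 2\<close>, and the
  remaining ones subtract at most that much because the absolute values of their coefficients
  add up to at most 1.\<close>
lemma sqrt_series_positive:
  fixes A :: "'h::chilbert \<Rightarrow> 'h"
  assumes A: "bounded_clinear A" and contr: "\<And>x. norm (A x) \<le> norm x"
    and sym: "\<And>x y. inner (A x) y = inner x (A y)"
  shows "positive_op (sqrt_series A)"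
proof (rule positive_opI)
  note blA = bounded_clinear_bounded_linear[OF A]
  note sm = sqrt_series_summable[OF blA contr]
  show "bounded_clinear (sqrt_series A)"
    unfolding bounded_clinear_def
    using sqrt_series_bounded_linear[OF blA contr]
      sqrt_series_commute[OF blA contr bounded_linear_scaleC] bounded_clinear_scaleC[OF A] by metis
  have pow_sym: "inner ((A ^^ k) x) y = inner x ((A ^^ k) y)" for k x y
    by (induction k arbitrary: x y) (auto simp: sym funpow_swap1)
  show "inner (sqrt_series A x) y = inner x (sqrt_series A y)" for x y
    unfolding sqrt_series_def
    by (simp add: bounded_linear.suminf[OF bounded_linear_inner_left sm]
        bounded_linear.suminf[OF bounded_linear_inner_right sm] pow_sym)
  show "0 \<le> inner x (sqrt_series A x)" for x
  proof -
    define g where "g k = sqrt_coeff k * inner x ((A ^^ k) x)" for k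
    have g_sum: "summable g"
      using bounded_linear.summable[OF bounded_linear_inner_right sm, of x x] by (simp add: g_def[abs_def])
    have "- \<bar>sqrt_coeff (Suc k)\<bar> * (norm x)\<^sup>2 \<le> g (Suc k)" for k
    proof -
      have "\<bar>inner x ((A ^^ Suc k) x)\<bar> \<le> norm x * norm ((A ^^ Suc k) x)"
        by (rule Cauchy_Schwarz_ineq2)
      also have "\<dots> \<le> (norm x)\<^sup>2"
        using norm_funpow_le[OF blA contr, of "Suc k" x] by (simp add: power2_eq_square mult_left_mono)
      finally have "\<bar>g (Suc k)\<bar> \<le> \<bar>sqrt_coeff (Suc k)\<bar> * (norm x)\<^sup>2"
        by (simp add: g_def abs_mult mult_left_mono del: funpow.simps)
      then show ?thesis by linarith
    qed
    then have "(\<Sum>k. - \<bar>sqrt_coeff (Suc k)\<bar> * (norm x)\<^sup>2) \<le> (\<Sum>k. g (Suc k))"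
      by (intro suminf_le summable_mult2 summable_minus summable_abs_sqrt_coeff_Suc)
        (use g_sum in \<open>simp_all add: summable_Suc_iff\<close>)
    also have "(\<Sum>k. - \<bar>sqrt_coeff (Suc k)\<bar> * (norm x)\<^sup>2) = - ((\<Sum>k. \<bar>sqrt_coeff (Suc k)\<bar>) * (norm x)\<^sup>2)"
      using suminf_mult2[OF summable_abs_sqrt_coeff_Suc, of "(norm x)\<^sup>2"]
        suminf_minus[OF summable_mult2[OF summable_abs_sqrt_coeff_Suc, of "(norm x)\<^sup>2"]] by simp
    also have "\<dots> \<ge> - (norm x)\<^sup>2"
      using mult_right_mono[OF suminf_abs_sqrt_coeff_Suc_le, of "(norm x)\<^sup>2"] by simp
    finally have "- (norm x)\<^sup>2 \<le> (\<Sum>k. g (Suc k))" .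
    moreover have "suminf g = g 0 + (\<Sum>k. g (Suc k))" using suminf_split_head[OF g_sum] by simp
    moreover have "g 0 = (norm x)\<^sup>2" by (simp add: g_def power2_norm_eq_inner)
    moreover have "inner x (sqrt_series A x) = suminf g"
      unfolding sqrt_series_def g_def
      by (simp add: bounded_linear.suminf[OF bounded_linear_inner_right sm])
    ultimately show ?thesis by linarith
  qed
qed

text \<open>Existence is the binomial series in \<open>A = 1 - S\<close>.  Any other positive root \<open>R'\<close> commutes with
  \<open>S\<close>, hence with the series \<open>R\<close>, and then \<open>y = R x - R' x\<close> satisfies \<open>R y + R' y = 0\<close>; positivity
  of both roots gives \<open>R y = 0\<close>, and injectivity of \<open>S\<close> gives \<open>y = 0\<close>.\<close>
lemma positive_sqrt_unique:
  fixes S :: "'h::chilbert \<Rightarrow> 'h"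
  assumes S: "bounded_clinear S" and contr: "\<And>x. norm (x - S x) \<le> norm x"
    and sym: "\<And>x y. inner (S x) y = inner x (S y)" and inj: "\<And>x. S x = 0 \<Longrightarrow> x = 0"
  shows "\<exists>!R. positive_op R \<and> (\<forall>x. R (R x) = S x)"
proof (rule ex1I)
  define A where "A = (\<lambda>x. x - S x)"
  have A: "bounded_clinear A"
    unfolding bounded_clinear_def A_def
    by (auto intro: bounded_linear_sub bounded_linear_ident bounded_clinear_bounded_linear[OF S]
        simp: bounded_clinear_scaleC[OF S] scaleC_diff_right)
  note blA = bounded_clinear_bounded_linear[OF A]
  have contrA: "norm (A x) \<le> norm x" for x by (simp add: A_def contr)
  define R where "R = sqrt_series A"
  have R: "positive_op R" unfolding R_def
    by (rule sqrt_series_positive[OF A contrA]) (simp add: A_def inner_simps sym)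
  have RR: "R (R x) = S x" for x
    using sqrt_series_sqrt_series[OF blA contrA, of x] by (simp add: R_def A_def)
  show "positive_op (sqrt_series A) \<and> (\<forall>x. sqrt_series A (sqrt_series A x) = S x)"
    using R RR by (simp add: R_def)
  fix R' assume "positive_op R' \<and> (\<forall>x. R' (R' x) = S x)"
  then have R': "positive_op R'" and RR': "\<And>x. R' (R' x) = S x" by auto
  have lin: "bounded_clinear R" "bounded_clinear R'" using R R' by (auto simp: positive_op_def)
  have "R' (A x) = A (R' x)" for x
    by (simp add: A_def bounded_clinear_diff[OF lin(2)] RR'[symmetric])
  then have comm: "R' (R x) = R (R' x)" for x
    unfolding R_def by (rule sqrt_series_commute[OF blA contrA bounded_clinear_bounded_linear[OF lin(2)]])
  show "R' = sqrt_series A"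
  proof
    fix x
    define y where "y = R x - R' x"
    have "R y + R' y = 0"
      by (simp add: y_def bounded_clinear_diff[OF lin(1)] bounded_clinear_diff[OF lin(2)] RR RR' comm)
    then have "inner y (R y) + inner y (R' y) = 0" by (metis inner_add_right inner_zero_right)
    then have "inner y (R y) = 0"
      using positive_op_inner(2)[OF R, of y] positive_op_inner(2)[OF R', of y] by linarith
    then have "R y = 0" by (rule positive_op_eq_0[OF R])
    then have "S y = 0" using RR[of y] bounded_clinear_diff[OF lin(1), of 0 0] by simp
    then show "R' x = sqrt_series A x" using inj[of y] by (simp add: y_def R_def)
  qed
qed

section \<open>Adjoints of unbounded operators\<close>

lemma linear_opD:
  assumes "linear_op T"
  shows "T x = Some u \<Longrightarrow> T y = Some v \<Longrightarrow> T (x + y) = Some (u + v)"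
    and "T x = Some u \<Longrightarrow> T y = Some v \<Longrightarrow> T (x - y) = Some (u - v)"
    and "T x = Some u \<Longrightarrow> T (c *\<^sub>C x) = Some (c *\<^sub>C u)"
    and "T x = Some u \<Longrightarrow> T (r *\<^sub>R x) = Some (r *\<^sub>R u)"
    and "T x = Some u \<Longrightarrow> T (- x) = Some (- u)"
    and "T 0 = Some 0"
  using csubspaceD(3,4)[OF assms[unfolded linear_op_def], of "(x, u)" "(y, v)"]
    csubspaceD(6)[OF assms[unfolded linear_op_def], of "(x, u)" c]
    csubspaceD(6)[OF assms[unfolded linear_op_def], of "(x, u)" "complex_of_real r"]
    csubspaceD(5)[OF assms[unfolded linear_op_def], of "(x, u)"]
    csubspaceD(2)[OF assms[unfolded linear_op_def]]
  by (auto simp: Map.graph_def scaleC_prod_def scaleR_scaleC zero_prod_def)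

lemma linear_op_dom_csubspace:
  assumes "linear_op T" shows "csubspace (dom T)"
  unfolding csubspace_def subspace_def
  using linear_opD(1,3,4,6)[OF assms] by (fastforce simp: dom_def)

lemma linear_opI:
  assumes "T 0 = Some 0"
    and "\<And>x u y v. T x = Some u \<Longrightarrow> T y = Some v \<Longrightarrow> T (x + y) = Some (u + v)"
    and "\<And>x u c. T x = Some u \<Longrightarrow> T (c *\<^sub>C x) = Some (c *\<^sub>C u)"
  shows "linear_op T"
  unfolding linear_op_def csubspace_def subspace_def Map.graph_def
  using assms by (auto simp: zero_prod_def scaleC_prod_def scaleR_scaleC)

text \<open>On a complex-linear domain the real and the complex inner product define the same adjoint,
  since the imaginary part of \<open>cinner y (T x)\<close> is, up to sign, the real part at \<open>\<i> *\<^sub>C x\<close>.  This is why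
  all later computations can use the real inner product.\<close>
lemma adj_op_iff:
  assumes T: "linear_op T" and dense: "densely_defined T"
  shows "adj_op T y = Some z \<longleftrightarrow> (\<forall>x\<in>dom T. inner y (T \<cdot> x) = inner z x)"
proof -
  have real: "(\<forall>x\<in>dom T. cinner y (T \<cdot> x) = cinner z x) \<longleftrightarrow> (\<forall>x\<in>dom T. inner y (T \<cdot> x) = inner z x)"
    (is "?c z = ?r z") for z
  proof
    assume "?c z" then show "?r z" by (metis Re_cinner)
  next
    assume r: "?r z"
    show "?c z"
    proof
      fix x assume x: "x \<in> dom T"
      then have Tx: "T x = Some (T \<cdot> x)" by auto
      note ix = linear_opD(3)[OF T Tx, of \<i>]
      have "inner y (\<i> *\<^sub>C (T \<cdot> x)) = inner z (\<i> *\<^sub>C x)"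
        using r ix by (metis domI option.sel)
      then show "cinner y (T \<cdot> x) = cinner z x"
        using r x by (intro cinner_eqI) (auto simp: inner_scaleC_i_left)
    qed
  qed
  have uniq: "z = z'" if "?r z" "?r z'" for z z'
  proof -
    have "z - z' = 0"
      by (rule dense_orthogonal_0[OF dense[unfolded densely_defined_def]])
        (use that in \<open>auto simp: inner_diff_left\<close>)
    then show ?thesis by simp
  qed
  show ?thesis
  proof
    assume "adj_op T y = Some z"
    then have ex: "\<exists>z. ?r z" and z: "z = (THE z. ?r z)" by (auto simp: adj_op_def real split: if_splits)
    show "?r z" unfolding z by (rule theI') (use ex uniq in blast)
  next
    assume r: "?r z"
    have "(THE z. ?r z) = z" using r uniq[OF _ r] by (rule the_equality)
    then show "adj_op T y = Some z" using r by (auto simp: adj_op_def real)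
  qed
qed

lemma adj_op_inner:
  assumes "linear_op T" "densely_defined T" "adj_op T y = Some z" "T x = Some w"
  shows "inner y w = inner z x"
  using assms(3,4) adj_op_iff[OF assms(1,2)] by (metis domI option.sel)

lemma linear_op_adj_op:
  assumes T: "linear_op T" and dense: "densely_defined T"
  shows "linear_op (adj_op T)"
proof (rule linear_opI)
  note iff = adj_op_iff[OF T dense]
  show "adj_op T 0 = Some 0" by (simp add: iff)
  show "adj_op T (x + y) = Some (u + v)" if "adj_op T x = Some u" "adj_op T y = Some v" for x u y v
    using that by (simp add: iff inner_add_left)
  show "adj_op T (c *\<^sub>C y) = Some (c *\<^sub>C u)" if u: "adj_op T y = Some u" for y u c
    unfolding iff
  proof
    fix x assume "x \<in> dom T"
    then have Tx: "T x = Some (T \<cdot> x)" by auto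
    have move: "inner (c *\<^sub>C p) q = inner p (cnj c *\<^sub>C q)" for p q :: 'a
      by (metis Re_cinner cinner_scaleC_left cinner_scaleC_right)
    show "inner (c *\<^sub>C y) (T \<cdot> x) = inner (c *\<^sub>C u) x"
      using adj_op_inner[OF T dense u linear_opD(3)[OF T Tx]] by (simp add: move)
  qed
qed

lemma closed_op_adj_op:
  assumes T: "linear_op T" and dense: "densely_defined T"
  shows "closed_op (adj_op T)"
  unfolding closed_op_def
proof -
  have "Map.graph (adj_op T) = (\<Inter>x\<in>dom T. {p. inner (fst p) (T \<cdot> x) = inner (snd p) x})"
    unfolding Map.graph_def adj_op_iff[OF T dense] by (intro equalityI subsetI) (auto simp: case_prod_unfold)
  moreover have "closed {p :: 'a \<times> 'a. inner (fst p) (T \<cdot> x) = inner (snd p) x}" for x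
    by (intro closed_Collect_eq continuous_intros)
  ultimately show "closed (Map.graph (adj_op T))" by auto
qed

lemma closed_opD:
  assumes "closed_op T" "\<And>k. T (u k) = Some (v k)" "u \<longlonglongrightarrow> x" "v \<longlonglongrightarrow> y"
  shows "T x = Some y"
proof -
  have "(x, y) \<in> Map.graph T"
    using assms(1)[unfolded closed_op_def closed_sequential_limits, rule_format, of "\<lambda>k. (u k, v k)" "(x, y)"]
      tendsto_Pair[OF assms(3,4)] assms(2) by (simp add: Map.graph_def)
  then show ?thesis by (simp add: Map.graph_def)
qed

section \<open>Inverse square roots of 1 + T*T\<close>

text \<open>Von Neumann's argument: the projection of \<open>(y, 0)\<close> to the closed graph of \<open>T\<close> is \<open>(x, T x)\<close>, and
  orthogonality of the remainder to the graph says that \<open>T x\<close> lies in the domain of the adjoint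
  with \<open>adj_op T (T x) = y - x\<close>.\<close>
lemma one_plus_adj_surj:
  assumes T: "linear_op T" "densely_defined T" "closed_op T"
  shows "\<exists>x w. T x = Some w \<and> adj_op T w = Some (y - x)"
proof -
  obtain p where p: "p \<in> Map.graph T" and orth: "\<And>m. m \<in> Map.graph T \<Longrightarrow> inner ((y, 0) - p) m = 0"
    using orthogonal_decomposition[of "Map.graph T" "(y, 0)"] T csubspaceD(1)
    by (metis linear_op_def closed_op_def)
  obtain x w where xw: "p = (x, w)" by (cases p)
  have "adj_op T w = Some (y - x)"
    unfolding adj_op_iff[OF T(1,2)]
  proof
    fix z assume "z \<in> dom T"
    then show "inner w (T \<cdot> z) = inner (y - x) z"
      using orth[of "(z, T \<cdot> z)"] by (auto simp: Map.graph_def xw inner_simps)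
  qed
  then show ?thesis using p by (auto simp: xw Map.graph_def)
qed

abbreviation resolvent_root :: "('h::chilbert \<rightharpoonup> 'h) \<Rightarrow> 'h \<Rightarrow> 'h" where
  "resolvent_root T \<equiv> inv_sqrt_one_plus (adj_op T \<circ>\<^sub>m T)"

context
  fixes T :: "'h::chilbert \<rightharpoonup> 'h"
  assumes T: "linear_op T" "densely_defined T" "closed_op T"
begin

text \<open>With \<open>S = (1 + T\<^sup>* T)\<^sup>-\<^sup>1\<close> one has \<open>inner y (S y) = norm (S y) ^ 2 + norm (T (S y)) ^ 2\<close>, which makes
  \<open>S\<close> positive and \<open>1 - S\<close> a contraction, so the square root of \<open>S\<close> exists and is unique.\<close>
lemma ex1_inv_sqrt:
  "\<exists>!R. positive_op R \<and> (\<forall>x y. R (R y) = x \<longleftrightarrow> (adj_op T \<circ>\<^sub>m T) x = Some (y - x))"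
proof -
  note adj = adj_op_inner[OF T(1,2)]
  note Tlin = linear_opD[OF T(1)] and adjlin = linear_opD[OF linear_op_adj_op[OF T(1,2)]]
  obtain S W where SW: "\<And>y. T (S y) = Some (W y)" "\<And>y. adj_op T (W y) = Some (y - S y)"
    using one_plus_adj_surj[OF T] by metis
  have uniq: "x = S y" if "T x = Some w" "adj_op T w = Some (y - x)" for x y w
  proof -
    let ?d = "x - S y" and ?e = "w - W y"
    have d: "T ?d = Some ?e" using Tlin(2)[OF that(1) SW(1)] .
    have e: "adj_op T ?e = Some (- ?d)" using adjlin(2)[OF that(2) SW(2)] by simp
    have "inner ?e ?e = inner (- ?d) ?d" by (rule adj[OF e d])
    then have "inner ?e ?e + inner ?d ?d = 0" by (simp only: inner_minus_left)
    then have "inner ?d ?d = 0" by (metis add_nonneg_eq_0_iff inner_ge_zero)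
    then show ?thesis by simp
  qed
  have S_iff: "S y = x \<longleftrightarrow> (adj_op T \<circ>\<^sub>m T) x = Some (y - x)" for x y
    using SW uniq by (auto simp: map_comp_Some_iff)
  have Sadd: "S (x + y) = S x + S y" for x y
    by (rule uniq[symmetric, OF Tlin(1)[OF SW(1) SW(1)]]) (use adjlin(1)[OF SW(2) SW(2), of x y] in \<open>simp add: algebra_simps\<close>)
  have SscaleC: "S (c *\<^sub>C x) = c *\<^sub>C S x" for c x
    by (rule uniq[symmetric, OF Tlin(3)[OF SW(1)]]) (use adjlin(3)[OF SW(2), of c x] in \<open>simp add: scaleC_diff_right\<close>)
  have en: "inner y (S y) = (norm (S y))\<^sup>2 + (norm (W y))\<^sup>2" for y
    using adj[OF SW(2) SW(1), of y y] by (simp add: power2_norm_eq_inner inner_simps)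
  have contr: "norm (y - S y) \<le> norm y" for y
  proof (rule power2_le_imp_le)
    have "(norm (y - S y))\<^sup>2 = (norm y)\<^sup>2 - 2 * inner y (S y) + (norm (S y))\<^sup>2"
      by (simp add: power2_norm_eq_inner inner_simps inner_commute)
    then show "(norm (y - S y))\<^sup>2 \<le> (norm y)\<^sup>2"
      using en[of y] zero_le_power2[of "norm (W y)"] zero_le_power2[of "norm (S y)"] by linarith
  qed simp
  have Snorm: "norm (S y) \<le> norm y * 2" for y
    using norm_triangle_ineq4[of y "y - S y"] contr[of y] by simp
  have S: "bounded_clinear S"
    unfolding bounded_clinear_def
    by (auto simp: SscaleC Sadd scaleR_scaleC intro!: bounded_linear_intro[where K = 2] Snorm)
  have sym: "inner (S x) y = inner x (S y)" for x y
  proof -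
    have "inner (W y) (W x) = inner (y - S y) (S x)" "inner (W x) (W y) = inner (x - S x) (S y)"
      by (rule adj[OF SW(2) SW(1)])+
    then show ?thesis by (simp add: inner_simps inner_commute)
  qed
  have inj: "y = 0" if "S y = 0" for y
    using SW[of y] that Tlin(6) adjlin(6) by simp
  show ?thesis
  proof (rule ex_ex1I)
    show "\<exists>R. positive_op R \<and> (\<forall>x y. R (R y) = x \<longleftrightarrow> (adj_op T \<circ>\<^sub>m T) x = Some (y - x))"
      using positive_sqrt_unique[OF S contr sym inj] S_iff by metis
  next
    fix R R'
    assume "positive_op R \<and> (\<forall>x y. R (R y) = x \<longleftrightarrow> (adj_op T \<circ>\<^sub>m T) x = Some (y - x))"
      "positive_op R' \<and> (\<forall>x y. R' (R' y) = x \<longleftrightarrow> (adj_op T \<circ>\<^sub>m T) x = Some (y - x))"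
    then have "positive_op R \<and> (\<forall>y. R (R y) = S y)" "positive_op R' \<and> (\<forall>y. R' (R' y) = S y)"
      using S_iff by metis+
    then show "R = R'" using positive_sqrt_unique[OF S contr sym inj] by blast
  qed
qed

lemma resolvent_root_positive: "positive_op (resolvent_root T)"
  and resolvent_root_iff:
    "resolvent_root T (resolvent_root T y) = x \<longleftrightarrow> (adj_op T \<circ>\<^sub>m T) x = Some (y - x)"
  using theI'[OF ex1_inv_sqrt] unfolding inv_sqrt_one_plus_def by auto

lemma resolvent_root_square:
  obtains w where "T (resolvent_root T (resolvent_root T y)) = Some w"
    "adj_op T w = Some (y - resolvent_root T (resolvent_root T y))"
    "(norm (resolvent_root T (resolvent_root T y)))\<^sup>2 + (norm w)\<^sup>2 = (norm (resolvent_root T y))\<^sup>2"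
proof -
  let ?R = "resolvent_root T"
  obtain w where w: "T (?R (?R y)) = Some w" "adj_op T w = Some (y - ?R (?R y))"
    using resolvent_root_iff[of y "?R (?R y)"] by (auto simp: map_comp_Some_iff)
  have "inner w w = inner (y - ?R (?R y)) (?R (?R y))"
    by (rule adj_op_inner[OF T(1,2) w(2,1)])
  moreover have "inner y (?R (?R y)) = inner (?R y) (?R y)"
    by (rule positive_op_inner(1)[OF resolvent_root_positive, symmetric])
  ultimately have "(norm (?R (?R y)))\<^sup>2 + (norm w)\<^sup>2 = (norm (?R y))\<^sup>2"
    by (simp add: power2_norm_eq_inner inner_simps)
  then show thesis using w that by blast
qed

lemma resolvent_root_inj:
  assumes "resolvent_root T y = 0"
  shows "y = 0"
proof -
  have "bounded_clinear (resolvent_root T)"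
    using resolvent_root_positive by (simp add: positive_op_def)
  then have "resolvent_root T 0 = 0" using bounded_clinear_diff[of "resolvent_root T" 0 0] by simp
  then have "(adj_op T \<circ>\<^sub>m T) 0 = Some y" using resolvent_root_iff[of y 0] assms by simp
  then show "y = 0"
    using linear_opD(6)[OF T(1)] linear_opD(6)[OF linear_op_adj_op[OF T(1,2)]] by simp
qed

lemma resolvent_root_range_dense: "closure (range (resolvent_root T)) = UNIV"
proof (rule dense_subspaceI)
  let ?R = "resolvent_root T"
  have lin: "bounded_clinear ?R" using resolvent_root_positive by (simp add: positive_op_def)
  show "subspace (range ?R)"
    using bounded_linear.linear[OF bounded_clinear_bounded_linear[OF lin]] subspace_UNIV
    by (rule linear_subspace_image)
  fix x assume "\<And>y. y \<in> range ?R \<Longrightarrow> inner x y = 0"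
  then have "inner x (?R (?R x)) = 0" by blast
  then have "inner (?R x) (?R x) = 0" by (simp add: positive_op_inner(1)[OF resolvent_root_positive])
  then have "?R x = 0" by simp
  then show "x = 0" by (rule resolvent_root_inj)
qed

text \<open>The root maps the Hilbert space isometrically into the domain of \<open>T\<close> with its graph norm.  On
  the dense range of the root this is the energy identity for \<open>(1 + T\<^sup>* T)\<^sup>-\<^sup>1\<close>; the identity makes
  the values of \<open>T\<close> converge along with the arguments, and closedness of \<open>T\<close> does the rest.\<close>
lemma resolvent_root_dom:
  obtains w where "T (resolvent_root T x) = Some w"
    "(norm (resolvent_root T x))\<^sup>2 + (norm w)\<^sup>2 = (norm x)\<^sup>2"
proof -
  let ?R = "resolvent_root T"
  have lin: "bounded_clinear ?R" using resolvent_root_positive by (simp add: positive_op_def)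
  note blR = bounded_clinear_bounded_linear[OF lin]
  have "x \<in> closure (range ?R)" using resolvent_root_range_dense by simp
  then obtain u where u: "\<And>k. u k \<in> range ?R" "u \<longlonglongrightarrow> x"
    unfolding closure_sequential by blast
  have "\<exists>y. u k = ?R y" for k using u(1)[of k] by auto
  then obtain y where y: "\<And>k. u k = ?R (y k)" by metis
  have "\<exists>w. T (?R (u k)) = Some w" for k using resolvent_root_square[of "y k"] y[of k] by auto
  then obtain w where w: "\<And>k. T (?R (u k)) = Some (w k)" by metis
  have diff: "norm (w k - w l) \<le> norm (u k - u l)" for k l
  proof -
    obtain v where v: "T (?R (?R (y k - y l))) = Some v"
      "(norm (?R (?R (y k - y l))))\<^sup>2 + (norm v)\<^sup>2 = (norm (?R (y k - y l)))\<^sup>2"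
      by (rule resolvent_root_square)
    have "v = w k - w l"
      using v(1) linear_opD(2)[OF T(1) w w, of k l] by (simp add: bounded_clinear_diff[OF lin] y)
    moreover have "(norm v)\<^sup>2 \<le> (norm (?R (y k - y l)))\<^sup>2" using v(2) zero_le_power2[of "norm (?R (?R (y k - y l)))"] by linarith
    ultimately have "(norm (w k - w l))\<^sup>2 \<le> (norm (u k - u l))\<^sup>2"
      by (simp add: bounded_clinear_diff[OF lin] y)
    then show ?thesis by (rule power2_le_imp_le) simp
  qed
  have "Cauchy w"
  proof (rule metric_CauchyI)
    fix e :: real assume "e > 0"
    then obtain M where M: "\<And>k l. k \<ge> M \<Longrightarrow> l \<ge> M \<Longrightarrow> norm (u k - u l) < e"
      using LIMSEQ_imp_Cauchy[OF u(2)] unfolding Cauchy_def dist_norm by blast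
    have "dist (w k) (w l) < e" if "k \<ge> M" "l \<ge> M" for k l
      using diff[of k l] M[OF that] by (simp add: dist_norm)
    then show "\<exists>M. \<forall>k\<ge>M. \<forall>l\<ge>M. dist (w k) (w l) < e" by blast
  qed
  then obtain w' where w': "w \<longlonglongrightarrow> w'" using Cauchy_convergent_iff convergent_def by blast
  have Ru: "(\<lambda>k. ?R (u k)) \<longlonglongrightarrow> ?R x" by (rule bounded_linear.tendsto[OF blR u(2)])
  have "T (?R x) = Some w'" by (rule closed_opD[OF T(3) w Ru w'])
  moreover have "(norm (?R x))\<^sup>2 + (norm w')\<^sup>2 = (norm x)\<^sup>2"
  proof (rule LIMSEQ_unique)
    show "(\<lambda>k. (norm (?R (u k)))\<^sup>2 + (norm (w k))\<^sup>2) \<longlonglongrightarrow> (norm (?R x))\<^sup>2 + (norm w')\<^sup>2"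
      by (intro tendsto_intros Ru w')
    have "(norm (?R (u k)))\<^sup>2 + (norm (w k))\<^sup>2 = (norm (u k))\<^sup>2" for k
    proof -
      obtain v where "T (?R (?R (y k))) = Some v"
        "(norm (?R (?R (y k))))\<^sup>2 + (norm v)\<^sup>2 = (norm (?R (y k)))\<^sup>2"
        by (rule resolvent_root_square)
      then show ?thesis using w[of k] by (simp add: y)
    qed
    then show "(\<lambda>k. (norm (?R (u k)))\<^sup>2 + (norm (w k))\<^sup>2) \<longlonglongrightarrow> (norm x)\<^sup>2"
      by (simp add: tendsto_intros u(2))
  qed
  ultimately show thesis using that by blast
qed

text \<open>Surjectivity onto the domain of \<open>T\<close>: a preimage of \<open>x\<close> must represent the functional
  \<open>R y \<mapsto> inner x y\<close> on the range of the root \<open>R\<close>, and this functional is bounded by the graph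
  norm of \<open>x\<close> because \<open>inner x y\<close> is the graph inner product of \<open>x\<close> with \<open>R (R y)\<close>.\<close>
lemma resolvent_root_range:
  assumes x: "T x = Some w"
  obtains z where "resolvent_root T z = x" "norm z \<le> norm (x, w)"
proof -
  let ?R = "resolvent_root T"
  have lin: "bounded_clinear ?R" using resolvent_root_positive by (simp add: positive_op_def)
  note linR = bounded_linear.linear[OF bounded_clinear_bounded_linear[OF lin]]
  have injR: "inj ?R" using resolvent_root_inj linear_inj_iff_eq_0[OF linR] by blast
  define \<phi> where "\<phi> u = inner x (inv ?R u)" for u
  have \<phi>: "\<phi> (?R y) = inner x y" for y by (simp add: \<phi>_def injR)
  obtain z where z: "\<And>u. u \<in> range ?R \<Longrightarrow> \<phi> u = inner z u" "norm z \<le> \<bar>norm (x, w)\<bar>"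
  proof (rule riesz_on_subspace[where X = "range ?R" and \<phi> = \<phi> and K = "norm (x, w)"])
    show "subspace (range ?R)" by (rule linear_subspace_image[OF linR subspace_UNIV])
    show "\<phi> (u + v) = \<phi> u + \<phi> v" if "u \<in> range ?R" "v \<in> range ?R" for u v
      using that by (auto simp: \<phi> linear_add[OF linR, symmetric] inner_add_right)
    show "\<phi> (c *\<^sub>R u) = c * \<phi> u" if "u \<in> range ?R" for c u
      using that by (auto simp: \<phi> linear_scale[OF linR, symmetric])
    show "\<bar>\<phi> u\<bar> \<le> norm (x, w) * norm u" if "u \<in> range ?R" for u
    proof -
      obtain y where y: "u = ?R y" using \<open>u \<in> range ?R\<close> by (rule rangeE)
      obtain v where v: "T (?R (?R y)) = Some v" "adj_op T v = Some (y - ?R (?R y))"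
        "(norm (?R (?R y)))\<^sup>2 + (norm v)\<^sup>2 = (norm (?R y))\<^sup>2"
        by (rule resolvent_root_square)
      have "inner v w = inner (y - ?R (?R y)) x" by (rule adj_op_inner[OF T(1,2) v(2) x])
      then have "\<phi> u = inner (x, w) (?R (?R y), v)" by (simp add: y \<phi> inner_simps inner_commute)
      also have "\<bar>\<dots>\<bar> \<le> norm (x, w) * norm (?R (?R y), v)" by (rule Cauchy_Schwarz_ineq2)
      also have "norm (?R (?R y), v) = norm u" using v(3) by (simp add: norm_Pair y)
      finally show ?thesis .
    qed
  qed blast
  have "?R z = x"
  proof -
    have "inner (?R z - x) y = 0" for y
      using z(1)[of "?R y"] by (simp add: \<phi> inner_diff_left positive_op_inner(1)[OF resolvent_root_positive])
    then show ?thesis using inner_eq_zero_iff[of "?R z - x"] by simp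
  qed
  then show thesis using z(2) that by simp
qed

end

section \<open>Precompact sets and uniform boundedness\<close>

lemma compact_closure_iff_subseq:
  fixes S :: "'a::metric_space set"
  shows "compact (closure S) \<longleftrightarrow>
    (\<forall>f :: nat \<Rightarrow> 'a. (\<forall>k. f k \<in> S) \<longrightarrow> (\<exists>l r. strict_mono r \<and> (f \<circ> r) \<longlonglongrightarrow> l))"
proof
  assume c: "compact (closure S)"
  show "\<forall>f :: nat \<Rightarrow> 'a. (\<forall>k. f k \<in> S) \<longrightarrow> (\<exists>l r. strict_mono r \<and> (f \<circ> r) \<longlonglongrightarrow> l)"
  proof (intro allI impI)
    fix f :: "nat \<Rightarrow> 'a" assume "\<forall>k. f k \<in> S"
    then have "\<forall>k. f k \<in> closure S" using closure_subset by blast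
    then show "\<exists>l r. strict_mono r \<and> (f \<circ> r) \<longlonglongrightarrow> l"
      using c unfolding compact_eq_seq_compact_metric seq_compact_def by metis
  qed
next
  assume sub: "\<forall>f :: nat \<Rightarrow> 'a. (\<forall>k. f k \<in> S) \<longrightarrow> (\<exists>l r. strict_mono r \<and> (f \<circ> r) \<longlonglongrightarrow> l)"
  show "compact (closure S)"
    unfolding compact_eq_seq_compact_metric seq_compact_def
  proof (intro allI impI)
    fix g :: "nat \<Rightarrow> 'a" assume g: "\<forall>k. g k \<in> closure S"
    have "\<exists>y\<in>S. dist y (g k) < inverse (real (Suc k))" for k
      using g by (auto simp: closure_approachable)
    then obtain f where f: "\<And>k. f k \<in> S" "\<And>k. dist (f k) (g k) < inverse (real (Suc k))"
      by metis
    then obtain l r where r: "strict_mono r" and l: "(f \<circ> r) \<longlonglongrightarrow> l" using sub by blast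
    have "(\<lambda>k. dist (f k) (g k)) \<longlonglongrightarrow> 0"
      by (rule tendsto_sandwich[OF _ _ tendsto_const LIMSEQ_inverse_real_of_nat])
        (use less_imp_le[OF f(2)] in \<open>auto intro!: always_eventually simp del: of_nat_Suc\<close>)
    then have fg: "(\<lambda>k. dist (f (r k)) (g (r k))) \<longlonglongrightarrow> 0"
      using LIMSEQ_subseq_LIMSEQ[OF _ r] by (fastforce simp: o_def)
    have fl: "(\<lambda>k. dist (f (r k)) l) \<longlonglongrightarrow> 0" using l unfolding o_def by (rule iffD1[OF tendsto_dist_iff])
    have "(\<lambda>k. dist (g (r k)) l) \<longlonglongrightarrow> 0"
    proof (rule tendsto_sandwich[OF _ _ tendsto_const])
      show "(\<lambda>k. dist (f (r k)) (g (r k)) + dist (f (r k)) l) \<longlonglongrightarrow> 0"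
        using tendsto_add[OF fg fl] by simp
    qed (auto intro!: always_eventually dist_triangle3)
    then have gl: "(g \<circ> r) \<longlonglongrightarrow> l" unfolding o_def by (rule iffD2[OF tendsto_dist_iff])
    have "l \<in> closure S"
      by (rule closed_sequentially[OF closed_closure _ gl]) (use g in auto)
    then show "\<exists>l\<in>closure S. \<exists>r. strict_mono r \<and> (g \<circ> r) \<longlonglongrightarrow> l" using r gl by blast
  qed
qed

lemma compact_closure_mono:
  fixes S :: "'a::metric_space set"
  assumes "S \<subseteq> S'" "compact (closure S')"
  shows "compact (closure S)"
proof -
  have "closure S' \<inter> closure S = closure S" using closure_mono[OF assms(1)] by blast
  then show ?thesis using compact_Int_closed[OF assms(2) closed_closure[of S]] by metis
qed

text \<open>If \<open>T\<close> is uniformly continuous with respect to the pseudometric pulled back along \<open>K\<close>, then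
  precompactness passes from \<open>K\<close> to \<open>T\<close>.  For linear maps this turns an estimate of \<open>norm (T f)\<close>
  by a function of \<open>norm (K f)\<close> into compactness, without any appeal to weak convergence.\<close>
lemma compact_closure_domination:
  fixes K :: "'a \<Rightarrow> 'b::metric_space" and T :: "'a \<Rightarrow> 'c::complete_space"
  assumes K: "compact (closure (K ` S))"
    and dom: "\<And>e. e > 0 \<Longrightarrow> \<exists>d>0. \<forall>x\<in>S. \<forall>y\<in>S. dist (K x) (K y) < d \<longrightarrow> dist (T x) (T y) < e"
  shows "compact (closure (T ` S))"
  unfolding compact_closure_iff_subseq
proof (intro allI impI)
  fix f assume "\<forall>k::nat. f k \<in> T ` S"
  then have "\<forall>k. \<exists>x. x \<in> S \<and> f k = T x" by auto
  then obtain s where s: "\<And>k. s k \<in> S" "\<And>k. f k = T (s k)" by metis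
  have "\<exists>l r. strict_mono r \<and> ((\<lambda>k. K (s k)) \<circ> r) \<longlonglongrightarrow> l"
    by (rule mp[OF spec[OF iffD1[OF compact_closure_iff_subseq K]]]) (use s(1) in blast)
  then obtain l r where r: "strict_mono r" "((\<lambda>k. K (s k)) \<circ> r) \<longlonglongrightarrow> l" by blast
  have KC: "Cauchy ((\<lambda>k. K (s k)) \<circ> r)" by (rule LIMSEQ_imp_Cauchy[OF r(2)])
  have "Cauchy (f \<circ> r)"
  proof (rule metric_CauchyI)
    fix e :: real assume "e > 0"
    then obtain d where d: "d > 0" "\<forall>x\<in>S. \<forall>y\<in>S. dist (K x) (K y) < d \<longrightarrow> dist (T x) (T y) < e"
      using dom by blast
    then obtain M where "\<forall>k\<ge>M. \<forall>l\<ge>M. dist (K (s (r k))) (K (s (r l))) < d"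
      using KC unfolding Cauchy_def by auto
    then show "\<exists>M. \<forall>k\<ge>M. \<forall>l\<ge>M. dist ((f \<circ> r) k) ((f \<circ> r) l) < e"
      using d(2) s by (metis o_apply)
  qed
  then show "\<exists>l r. strict_mono r \<and> (f \<circ> r) \<longlonglongrightarrow> l"
    using r(1) Cauchy_convergent_iff convergent_def by blast
qed

text \<open>Uniform boundedness, from Baire's theorem for the sets on which the functionals are
  bounded by \<open>k\<close>.\<close>
lemma weakly_bounded_imp_bounded:
  fixes Y :: "'a::{real_inner,complete_space} set"
  assumes weak: "\<And>x. \<exists>M. \<forall>y\<in>Y. \<bar>inner y x\<bar> \<le> M"
  obtains C where "\<And>y. y \<in> Y \<Longrightarrow> norm y \<le> C"
proof -
  define E where "E k = {x. \<forall>y\<in>Y. \<bar>inner y x\<bar> \<le> real k}" for k :: nat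
  have clE: "closed (E k)" for k
  proof -
    have "E k = (\<Inter>y\<in>Y. {x. \<bar>inner y x\<bar> \<le> real k})" by (auto simp: E_def)
    moreover have "closed {x. \<bar>inner y x\<bar> \<le> real k}" for y
      by (intro closed_Collect_le continuous_intros)
    ultimately show ?thesis by auto
  qed
  have "x \<in> (\<Union>k. E k)" for x
  proof -
    obtain M where "\<forall>y\<in>Y. \<bar>inner y x\<bar> \<le> M" using weak by blast
    moreover obtain k where "M \<le> real k" using real_arch_simple by blast
    ultimately have "x \<in> E k" by (auto simp: E_def intro: order_trans)
    then show ?thesis by blast
  qed
  then have cover: "\<Union> (range E) = UNIV" by blast
  have "\<exists>k. interior (E k) \<noteq> {}"
  proof (rule ccontr)
    assume "\<not> ?thesis"
    then have "(euclidean :: 'a topology) interior_of \<Union> (range E) = {}"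
      by (intro Baire_category_alt) (auto simp: clE completely_metrizable_space_euclidean)
    then show False by (simp add: cover)
  qed
  then obtain k x0 where "x0 \<in> interior (E k)" by blast
  then obtain r where r: "r > 0" "ball x0 r \<subseteq> E k"
    unfolding mem_interior by blast
  have "norm y \<le> 4 * real k / r" if y: "y \<in> Y" for y
  proof (cases "y = 0")
    case False
    define v where "v = (r / (2 * norm y)) *\<^sub>R y"
    have nv: "norm v = r / 2" using False r(1) by (simp add: v_def)
    have iv: "inner y v = (r / 2) * norm y"
      using False by (simp add: v_def power2_norm_eq_inner[symmetric] power2_eq_square)
    have "x0 \<in> E k" "x0 + v \<in> E k" using r nv by (auto simp: dist_norm subset_iff)
    then have "\<bar>inner y x0\<bar> \<le> real k" "\<bar>inner y x0 + inner y v\<bar> \<le> real k"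
      using y by (auto simp: E_def inner_add_right)
    then have "(r / 2) * norm y \<le> 2 * real k" unfolding iv by linarith
    then show ?thesis using r(1) by (simp add: field_simps)
  qed (use r in auto)
  then show thesis using that by blast
qed

text \<open>A closed graph theorem for \<open>N = T B\<close>: the vectors \<open>B' (T\<^sup>* y)\<close> with \<open>norm y \<le> 1\<close> represent the
  functionals \<open>x \<mapsto> inner y (N x)\<close>, so they are weakly bounded, hence bounded, and density of the
  domain of the adjoint turns this into a bound for \<open>N\<close>.\<close>
lemma unbounded_compose_bounded:
  fixes B :: "'k::{real_inner,complete_space} \<Rightarrow> 'h::chilbert"
  assumes T: "linear_op T" "densely_defined T" and adj_dense: "densely_defined (adj_op T)"
    and B: "\<And>x y. inner (B x) y = inner x (B' y)"
    and TB: "\<And>x. T (B x) = Some (N x)"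
  obtains C where "\<And>x. norm (N x) \<le> C * norm x"
proof -
  define Y where "Y = {B' z |y z. adj_op T y = Some z \<and> norm y \<le> 1}"
  have pair: "inner (B' z) x = inner y (N x)" if "adj_op T y = Some z" for y z x
    using adj_op_inner[OF T that TB] B[of x z] by (simp add: inner_commute)
  obtain C where C: "\<And>u. u \<in> Y \<Longrightarrow> norm u \<le> C"
  proof (rule weakly_bounded_imp_bounded)
    fix x
    have "\<bar>inner u x\<bar> \<le> norm (N x)" if u: "u \<in> Y" for u
    proof -
      obtain y z where yz: "u = B' z" "adj_op T y = Some z" "norm y \<le> 1" using u by (auto simp: Y_def)
      have "\<bar>inner u x\<bar> \<le> norm y * norm (N x)" unfolding yz(1) pair[OF yz(2)] by (rule Cauchy_Schwarz_ineq2)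
      also have "\<dots> \<le> 1 * norm (N x)" by (intro mult_right_mono yz(3)) simp
      finally show ?thesis by simp
    qed
    then show "\<exists>M. \<forall>u\<in>Y. \<bar>inner u x\<bar> \<le> M" by blast
  qed blast
  note adjlin = linear_op_adj_op[OF T]
  have key: "inner y (N x) \<le> norm y * (C * norm x)" if y: "y \<in> dom (adj_op T)" for x y
  proof (cases "y = 0")
    case False
    obtain z where z: "adj_op T y = Some z" using y by auto
    have "B' (inverse (norm y) *\<^sub>R z) \<in> Y"
      using linear_opD(4)[OF adjlin z, of "inverse (norm y)"] False unfolding Y_def by fastforce
    then have "norm (B' (inverse (norm y) *\<^sub>R z)) \<le> C" by (rule C)
    moreover have "inner (B' (inverse (norm y) *\<^sub>R z)) x = inverse (norm y) * inner y (N x)"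
      using pair[OF linear_opD(4)[OF adjlin z]] by simp
    ultimately have "inverse (norm y) * inner y (N x) \<le> C * norm x"
      using Cauchy_Schwarz_ineq2[of "B' (inverse (norm y) *\<^sub>R z)" x]
      by (metis abs_le_D1 mult_right_mono norm_ge_zero order_trans)
    then show ?thesis using False by (simp add: field_simps)
  qed simp
  have "norm (N x) \<le> C * norm x" for x
  proof -
    have "N x \<in> closure (dom (adj_op T))" using adj_dense by (simp add: densely_defined_def)
    then obtain u where u: "\<And>k. u k \<in> dom (adj_op T)" "u \<longlonglongrightarrow> N x" unfolding closure_sequential by blast
    have "inner (N x) (N x) \<le> norm (N x) * (C * norm x)"
    proof (rule LIMSEQ_le)
      show "(\<lambda>k. inner (u k) (N x)) \<longlonglongrightarrow> inner (N x) (N x)" by (intro tendsto_intros u)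
      show "(\<lambda>k. norm (u k) * (C * norm x)) \<longlonglongrightarrow> norm (N x) * (C * norm x)" by (intro tendsto_intros u)
    qed (use key u in blast)
    then have "norm (N x) * norm (N x) \<le> norm (N x) * (C * norm x)"
      by (simp add: power2_norm_eq_inner[symmetric] power2_eq_square)
    moreover have "0 \<le> C * norm x"
    proof -
      have "B' 0 \<in> Y" unfolding Y_def using linear_opD(6)[OF adjlin] by force
      then have "0 \<le> C" using C norm_ge_zero order_trans by blast
      then show ?thesis by simp
    qed
    ultimately show ?thesis by (cases "N x = 0") auto
  qed
  then show thesis using that by blast
qed

text \<open>Compactness of \<open>a (1 + T\<^sup>* T)\<^sup>-\<^sup>1\<^sup>/\<^sup>2\<close> means that \<open>a\<close> is compact on the domain of \<open>T\<close> with its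
  graph norm.\<close>
lemma compact_on_graph_bounded:
  assumes T: "linear_op T" "densely_defined T" "closed_op T"
    and cpt: "compact_op (a \<circ> resolvent_root T)"
  shows "compact (closure {a x |x w. T x = Some w \<and> norm (x, w) \<le> M})"
proof (rule compact_closure_mono)
  show "compact (closure ((a \<circ> resolvent_root T) ` cball 0 M))"
    using cpt by (simp add: compact_op_def)
  show "{a x |x w. T x = Some w \<and> norm (x, w) \<le> M} \<subseteq> (a \<circ> resolvent_root T) ` cball 0 M"
  proof clarify
    fix x w assume xw: "T x = Some w" "norm (x, w) \<le> M"
    obtain z where "resolvent_root T z = x" "norm z \<le> norm (x, w)"
      using resolvent_root_range[OF T xw(1)] .
    then show "a x \<in> (a \<circ> resolvent_root T) ` cball 0 M" using xw(2) by (auto intro!: image_eqI[where x = z])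
  qed
qed

section \<open>Relative spectral triples with a Clifford normal\<close>

lemma linear_op_app:
  assumes "linear_op T" "x \<in> dom T" "y \<in> dom T"
  shows "x + y \<in> dom T" "T \<cdot> (x + y) = T \<cdot> x + T \<cdot> y"
    and "x - y \<in> dom T" "T \<cdot> (x - y) = T \<cdot> x - T \<cdot> y"
proof -
  obtain u v where uv: "T x = Some u" "T y = Some v" using assms(2,3) by auto
  note lin = linear_opD[OF assms(1)]
  show "x + y \<in> dom T" "T \<cdot> (x + y) = T \<cdot> x + T \<cdot> y" using lin(1)[OF uv] uv by auto
  show "x - y \<in> dom T" "T \<cdot> (x - y) = T \<cdot> x - T \<cdot> y" using lin(2)[OF uv] uv by auto
qed

lemma linear_op_app_unary:
  assumes "linear_op T" "x \<in> dom T"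
  shows "c *\<^sub>C x \<in> dom T" "T \<cdot> (c *\<^sub>C x) = c *\<^sub>C (T \<cdot> x)"
    and "r *\<^sub>R x \<in> dom T" "T \<cdot> (r *\<^sub>R x) = r *\<^sub>R (T \<cdot> x)"
    and "- x \<in> dom T" "T \<cdot> (- x) = - (T \<cdot> x)"
proof -
  obtain u where u: "T x = Some u" using assms(2) by auto
  note lin = linear_opD[OF assms(1)]
  show "c *\<^sub>C x \<in> dom T" "T \<cdot> (c *\<^sub>C x) = c *\<^sub>C (T \<cdot> x)" using lin(3)[OF u] u by auto
  show "r *\<^sub>R x \<in> dom T" "T \<cdot> (r *\<^sub>R x) = r *\<^sub>R (T \<cdot> x)" using lin(4)[OF u] u by auto
  show "- x \<in> dom T" "T \<cdot> (- x) = - (T \<cdot> x)" using lin(5)[OF u] u by auto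
qed

lemma linear_op_dom_0: "linear_op T \<Longrightarrow> 0 \<in> dom T"
  using linear_opD(6) by blast

text \<open>The symplectic form of the boundary, \<open>\<langle>D\<^sup>* x, y\<rangle> - \<langle>x, D\<^sup>* y\<rangle>\<close>, which descends to the quotient of the
  domain of \<open>D\<^sup>*\<close> by that of \<open>D\<close>.  Only its real part is kept: multiplying an argument by \<open>\<i>\<close>
  recovers the imaginary part.\<close>
definition boundary_form :: "('h::chilbert \<rightharpoonup> 'h) \<Rightarrow> 'h \<Rightarrow> 'h \<Rightarrow> real" where
  "boundary_form D x y = inner (adj_op D \<cdot> x) y - inner x (adj_op D \<cdot> y)"

locale relative_triple_with_normal =
  fixes A J \<A> \<J> :: "'a::cstar_algebra set" and \<alpha> :: "'a \<Rightarrow> 'a"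
    and \<pi> :: "'a \<Rightarrow> 'h::chilbert \<Rightarrow> 'h" and \<gamma> n :: "'h \<Rightarrow> 'h" and D :: "'h \<rightharpoonup> 'h"
  assumes graded: "graded_cstar_algebra A \<alpha>"
    and ideal: "graded_ideal J A \<alpha>"
    and rel: "relative_spectral_triple J A \<alpha> \<J> \<A> \<pi> \<gamma> D"
    and normal: "clifford_normal \<A> \<pi> \<gamma> D n"
begin

abbreviation "Ds \<equiv> adj_op D"
abbreviation "W \<equiv> normal_dom D n"
abbreviation "q \<equiv> boundary_form D"
abbreviation "Dt \<equiv> double_op \<gamma> D n"

lemma shows D_lin: "linear_op D" and D_dense: "densely_defined D" and D_closed: "closed_op D"
    and D_sym: "symmetric_op D" and D_odd: "odd_op \<gamma> D"
  using rel by (auto simp: relative_spectral_triple_def)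

lemma grading: "grading_op \<gamma>"
  using rel by (auto simp: relative_spectral_triple_def)

lemma grading_clinear: "bounded_clinear \<gamma>"
  and grading_inner: "inner (\<gamma> x) y = inner x (\<gamma> y)"
  and grading_grading [simp]: "\<gamma> (\<gamma> x) = x"
  using grading is_adjoint_inner by (auto simp: grading_op_def)

lemmas grading_simps = bounded_clinear_add[OF grading_clinear] bounded_clinear_diff[OF grading_clinear]
  bounded_clinear_minus[OF grading_clinear] bounded_clinear_scaleC[OF grading_clinear]

lemma norm_grading [simp]: "norm (\<gamma> x) = norm x"
  by (simp add: norm_eq_sqrt_inner grading_inner)

lemma grading_dom: "x \<in> dom D \<Longrightarrow> \<gamma> x \<in> dom D"
  and D_grading: "x \<in> dom D \<Longrightarrow> D \<cdot> (\<gamma> x) = - \<gamma> (D \<cdot> x)"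
  using D_odd by (auto simp: odd_op_def)

lemma Ds_lin: "linear_op Ds"
  by (rule linear_op_adj_op[OF D_lin D_dense])

lemma Ds_iff: "Ds y = Some z \<longleftrightarrow> (\<forall>x\<in>dom D. inner y (D \<cdot> x) = inner z x)"
  by (rule adj_op_iff[OF D_lin D_dense])

lemma Ds_extends: "x \<in> dom D \<Longrightarrow> Ds x = Some (D \<cdot> x)"
  using D_sym unfolding Ds_iff symmetric_op_def by (metis Re_cinner)

lemma dom_D_Ds: "x \<in> dom D \<Longrightarrow> x \<in> dom Ds"
  using Ds_extends by blast

lemma Ds_grading_Some: "Ds x = Some u \<Longrightarrow> Ds (\<gamma> x) = Some (- \<gamma> u)"
  unfolding Ds_iff
proof
  fix y assume u: "\<forall>x'\<in>dom D. inner x (D \<cdot> x') = inner u x'" and y: "y \<in> dom D"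
  have "inner (\<gamma> x) (D \<cdot> y) = - inner x (D \<cdot> (\<gamma> y))"
    by (simp add: D_grading[OF y] grading_inner)
  also have "\<dots> = inner (- \<gamma> u) y" using u grading_dom[OF y] by (simp add: grading_inner)
  finally show "inner (\<gamma> x) (D \<cdot> y) = inner (- \<gamma> u) y" .
qed

lemma grading_dom_Ds: "x \<in> dom Ds \<Longrightarrow> \<gamma> x \<in> dom Ds"
  and Ds_grading: "x \<in> dom Ds \<Longrightarrow> Ds \<cdot> (\<gamma> x) = - \<gamma> (Ds \<cdot> x)"
  using Ds_grading_Some by fastforce+

section \<open>The boundary form\<close>

lemma q_commute: "q x y = - q y x"
  by (simp add: boundary_form_def inner_commute)

lemma q_add_left: "x \<in> dom Ds \<Longrightarrow> x' \<in> dom Ds \<Longrightarrow> q (x + x') y = q x y + q x' y"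
  by (simp add: boundary_form_def linear_op_app[OF Ds_lin] inner_simps)

lemma q_scaleR_left: "x \<in> dom Ds \<Longrightarrow> q (r *\<^sub>R x) y = r * q x y"
  by (simp add: boundary_form_def linear_op_app_unary[OF Ds_lin] inner_simps algebra_simps)

lemma q_minus_left: "x \<in> dom Ds \<Longrightarrow> q (- x) y = - q x y"
  by (simp add: boundary_form_def linear_op_app_unary[OF Ds_lin])

lemma q_minus_right: "y \<in> dom Ds \<Longrightarrow> q x (- y) = - q x y"
  by (simp add: boundary_form_def linear_op_app_unary[OF Ds_lin])

lemma q_dom_D: "x \<in> dom D \<Longrightarrow> y \<in> dom Ds \<Longrightarrow> q x y = 0"
  using adj_op_inner[OF D_lin D_dense, of y "Ds \<cdot> y" x "D \<cdot> x"] Ds_extends[of x]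
  by (auto simp: boundary_form_def inner_commute)

lemma q_cong_left:
  assumes "x \<in> dom Ds" "x' \<in> dom Ds" "y \<in> dom Ds" "x - x' \<in> dom D"
  shows "q x y = q x' y"
  using q_add_left[of "x - x'" x' y] q_dom_D[OF assms(4,3)] dom_D_Ds[OF assms(4)] assms by simp

lemma q_cong_right:
  assumes "x \<in> dom Ds" "x' \<in> dom Ds" "y \<in> dom Ds" "x - x' \<in> dom D"
  shows "q y x = q y x'"
  using q_cong_left[OF assms] q_commute by metis

lemma q_grading: "x \<in> dom Ds \<Longrightarrow> y \<in> dom Ds \<Longrightarrow> q (\<gamma> x) (\<gamma> y) = - q x y"
  by (simp add: boundary_form_def Ds_grading grading_inner)

lemma abs_q_le: "\<bar>q x y\<bar> \<le> norm (Ds \<cdot> x) * norm y + norm x * norm (Ds \<cdot> y)"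
  unfolding boundary_form_def
  using Cauchy_Schwarz_ineq2[of "Ds \<cdot> x" y] Cauchy_Schwarz_ineq2[of x "Ds \<cdot> y"] by linarith

section \<open>Clifford normals and the boundary form\<close>

lemma n_clinear: "bounded_clinear n"
  using normal by (simp add: clifford_normal_def)

lemmas n_simps = bounded_clinear_add[OF n_clinear] bounded_clinear_diff[OF n_clinear]
  bounded_clinear_minus[OF n_clinear] bounded_clinear_scaleC[OF n_clinear]

lemma n_grading: "n (\<gamma> x) = - \<gamma> (n x)"
proof -
  have "odd_op \<gamma> (total_op n)" using normal by (simp add: clifford_normal_def)
  then show ?thesis by (simp add: odd_op_def dom_def)
qed

lemma n_inner: "inner (n x) y = - inner x (n y)"
proof -
  have "is_adjoint (\<lambda>x. - n x) n" using normal by (simp add: clifford_normal_def)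
  then have "inner (- n x) y = inner x (n y)" by (rule is_adjoint_inner)
  then show ?thesis by simp
qed

lemma n_dom: "x \<in> dom D \<Longrightarrow> n x \<in> dom D"
  using normal by (auto simp: clifford_normal_def)

lemma n_square: "x \<in> W \<Longrightarrow> n (n x) + x \<in> dom D"
  using normal by (simp add: clifford_normal_def)

lemma W_iff: "x \<in> W \<longleftrightarrow> x \<in> dom Ds \<and> n x \<in> dom Ds"
  by (simp add: normal_dom_def)

lemma W_dom: "x \<in> W \<Longrightarrow> x \<in> dom Ds" "x \<in> W \<Longrightarrow> n x \<in> dom Ds"
  by (simp_all add: W_iff)

lemma dom_D_W: "x \<in> dom D \<Longrightarrow> x \<in> W"
  by (simp add: W_iff dom_D_Ds n_dom)

lemma W_add: "x \<in> W \<Longrightarrow> y \<in> W \<Longrightarrow> x + y \<in> W"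
  and W_minus: "x \<in> W \<Longrightarrow> - x \<in> W"
  and W_scaleC: "x \<in> W \<Longrightarrow> c *\<^sub>C x \<in> W"
  and W_scaleR: "x \<in> W \<Longrightarrow> r *\<^sub>R x \<in> W"
  unfolding W_iff
  by (simp_all add: n_simps linear_op_app[OF Ds_lin] linear_op_app_unary[OF Ds_lin] scaleR_scaleC)

lemma W_grading: "x \<in> W \<Longrightarrow> \<gamma> x \<in> W"
  unfolding W_iff by (simp add: n_grading grading_dom_Ds linear_op_app_unary(5)[OF Ds_lin])

lemma W_n: "x \<in> W \<Longrightarrow> n x \<in> W"
proof -
  assume x: "x \<in> W"
  have "n (n x) + x - x \<in> dom Ds"
    by (rule linear_op_app(3)[OF Ds_lin dom_D_Ds[OF n_square[OF x]] W_dom(1)[OF x]])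
  then show "n x \<in> W" using W_dom(2)[OF x] by (simp add: W_iff)
qed

lemma W_cong: "x \<in> W \<Longrightarrow> y - x \<in> dom D \<Longrightarrow> y \<in> W"
  using W_add[of x "y - x"] dom_D_W[of "y - x"] by simp

lemma q_n_right: "x \<in> W \<Longrightarrow> y \<in> W \<Longrightarrow> q x (n y) = - q (n x) y"
proof -
  assume x: "x \<in> W" and y: "y \<in> W"
  have comm: "commutator Ds n z = Some (Ds \<cdot> (n z) - n (Ds \<cdot> z))" if "z \<in> W" for z
    using that by (auto simp: W_iff commutator_def op_diff_def map_comp_def dom_def)
  have "symmetric_op (commutator Ds n)" using normal by (simp add: clifford_normal_def)
  then have "cinner x (commutator Ds n \<cdot> y) = cinner (commutator Ds n \<cdot> x) y"
    using comm[OF x] comm[OF y] unfolding symmetric_op_def by blast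
  then have "cinner x (Ds \<cdot> (n y) - n (Ds \<cdot> y)) = cinner (Ds \<cdot> (n x) - n (Ds \<cdot> x)) y"
    by (simp add: comm[OF x] comm[OF y])
  then have "inner x (Ds \<cdot> (n y) - n (Ds \<cdot> y)) = inner (Ds \<cdot> (n x) - n (Ds \<cdot> x)) y"
    by (metis Re_cinner)
  then show "q x (n y) = - q (n x) y"
    by (simp add: boundary_form_def inner_simps n_inner n_inner[of y "Ds \<cdot> x"] inner_commute)
qed

text \<open>The normal acts on boundary values as a symplectic complex structure, because \<open>n \<circ> n = - 1\<close>
  modulo the domain of \<open>D\<close>, where the form vanishes.\<close>
lemma q_n_n: "x \<in> W \<Longrightarrow> y \<in> W \<Longrightarrow> q (n x) (n y) = q x y"
proof -
  assume x: "x \<in> W" and y: "y \<in> W"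
  have "q (n x) (n y) = - q (n (n x)) y" by (rule q_n_right[OF W_n[OF x] y])
  also have "q (n (n x)) y = q (- x) y"
    by (rule q_cong_left) (use x y W_n n_square[OF x] in \<open>auto simp: W_iff linear_op_app_unary(5)[OF Ds_lin]\<close>)
  finally show "q (n x) (n y) = q x y" by (simp add: q_minus_left W_dom[OF x])
qed

lemma q_n_nonneg: "x \<in> W \<Longrightarrow> 0 \<le> - q x (n x)"
proof -
  assume "x \<in> W"
  then have "cinner x (Ds \<cdot> (n x)) - cinner (Ds \<cdot> x) (n x) \<in> \<real>\<^sub>\<ge>\<^sub>0"
    using normal by (simp add: clifford_normal_def)
  then have "0 \<le> Re (cinner x (Ds \<cdot> (n x)) - cinner (Ds \<cdot> x) (n x))"
    by (simp only: complex_nonneg_Reals_iff)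
  then show ?thesis by (simp add: boundary_form_def)
qed

text \<open>The Cauchy-Schwarz inequality of the positive form \<open>- q x (n y)\<close>, evaluated at \<open>n x\<close> and \<open>y\<close>; the
  symplectic invariance removes \<open>n\<close> from the left hand side and from the energy of \<open>n x\<close>.\<close>
lemma q_Cauchy_Schwarz:
  assumes x: "x \<in> W" and y: "y \<in> W"
  shows "(q x y)\<^sup>2 \<le> (- q x (n x)) * (- q y (n y))"
proof -
  have n_form: "(q z (n y))\<^sup>2 \<le> (- q z (n z)) * (- q y (n y))" if z: "z \<in> W" for z
  proof -
    have "(- q z (n y))\<^sup>2 \<le> (- q z (n z)) * (- q y (n y))"
    proof (rule quadratic_nonneg_discriminant)
      fix t
      have sym: "q y (n z) = q z (n y)" using q_n_right[OF y z] q_commute[of "n y" z] by simp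
      have "0 \<le> - q (z + t *\<^sub>R y) (n (z + t *\<^sub>R y))"
        by (intro q_n_nonneg W_add W_scaleR z y)
      also have "n (z + t *\<^sub>R y) = n z + t *\<^sub>R n y" by (simp add: n_simps scaleR_scaleC)
      also have "q (z + t *\<^sub>R y) (n z + t *\<^sub>R n y)
          = q z (n z) + t * q z (n y) + t * (q y (n z) + t * q y (n y))"
      proof -
        have right: "q v (n z + t *\<^sub>R n y) = q v (n z) + t * q v (n y)" for v
          using q_add_left[of "n z" "t *\<^sub>R n y" v] q_scaleR_left[of "n y" t v]
            linear_op_app_unary(3)[OF Ds_lin W_dom(2)[OF y]] W_dom(2)[OF z] W_dom(2)[OF y]
          by (simp add: q_commute[of v])
        show ?thesis
          using linear_op_app_unary(3)[OF Ds_lin W_dom(1)[OF y], of t] W_dom(1)[OF z] W_dom(1)[OF y]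
          by (simp add: q_add_left q_scaleR_left right algebra_simps)
      qed
      finally show "0 \<le> - q z (n z) + 2 * t * - q z (n y) + t\<^sup>2 * - q y (n y)"
        by (simp add: sym power2_eq_square algebra_simps)
    qed (rule q_n_nonneg[OF y])
    then show ?thesis by simp
  qed
  have "q x y = q (n x) (n y)" by (rule q_n_n[OF x y, symmetric])
  moreover have "q (n x) (n (n x)) = q x (n x)" by (rule q_n_n[OF x W_n[OF x]])
  ultimately show ?thesis using n_form[OF W_n[OF x]] by simp
qed

text \<open>The maximality condition on the normal in terms of real parts: the hypothesis for \<open>\<i> *\<^sub>C \<xi>\<close>
  supplies the imaginary part of the complex identity.\<close>
lemma boundary_maximal:
  assumes w: "w \<in> dom Ds" and z: "z \<in> dom Ds"
    and eq: "\<And>\<xi>. \<xi> \<in> W \<Longrightarrow> q w (n \<xi>) + q z \<xi> = 0"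
  shows "w + n z \<in> dom D"
proof -
  have "cinner w (Ds \<cdot> (n \<xi>)) - cinner (Ds \<cdot> w) (n \<xi>) = - cinner z (Ds \<cdot> \<xi>) + cinner (Ds \<cdot> z) \<xi>"
    if \<xi>: "\<xi> \<in> W" for \<xi>
  proof -
    have "q w (n (\<i> *\<^sub>C \<xi>)) + q z (\<i> *\<^sub>C \<xi>) = 0" by (rule eq[OF W_scaleC[OF \<xi>]])
    then show ?thesis
      using eq[OF \<xi>] W_dom[OF \<xi>]
      by (simp add: complex_eq_iff Im_cinner boundary_form_def linear_op_app_unary(2)[OF Ds_lin] n_simps
          inner_scaleC_i_left)
  qed
  then show ?thesis using normal w z by (simp add: clifford_normal_def)
qed

section \<open>Self-adjointness of the double\<close>

lemma Dt_Some_iff: "Dt (\<xi>, \<eta>) = Some p \<longleftrightarrow>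
    \<xi> \<in> W \<and> \<eta> \<in> W \<and> \<eta> - n (\<gamma> \<xi>) \<in> dom D \<and> p = (Ds \<cdot> \<xi>, Ds \<cdot> \<eta>)"
  by (auto simp: double_op_def)

lemma Dt_dom_iff: "(\<xi>, \<eta>) \<in> dom Dt \<longleftrightarrow> \<xi> \<in> W \<and> \<eta> \<in> W \<and> \<eta> - n (\<gamma> \<xi>) \<in> dom D"
  using Dt_Some_iff[of \<xi> \<eta>] by (simp add: dom_def)

lemma Dt_app: "(\<xi>, \<eta>) \<in> dom Dt \<Longrightarrow> Dt (\<xi>, \<eta>) = Some (Ds \<cdot> \<xi>, Ds \<cdot> \<eta>)"
  by (simp add: Dt_Some_iff Dt_dom_iff)

lemma Dt_dom_D: "\<xi> \<in> dom D \<Longrightarrow> \<eta> \<in> dom D \<Longrightarrow> (\<xi>, \<eta>) \<in> dom Dt"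
  unfolding Dt_dom_iff
  by (simp add: dom_D_W linear_op_app(3)[OF D_lin] n_dom grading_dom)

lemma Dt_lin: "linear_op Dt"
proof (rule linear_opI)
  have "0 \<in> dom D" by (rule linear_op_dom_0[OF D_lin])
  then have "(0, 0) \<in> dom Dt" by (intro Dt_dom_D)
  then show "Dt 0 = Some 0"
    using linear_opD(6)[OF Ds_lin] by (auto simp: zero_prod_def Dt_Some_iff Dt_dom_iff)
  fix x y u v assume xy: "Dt x = Some u" "Dt y = Some v"
  obtain x1 x2 y1 y2 where [simp]: "x = (x1, x2)" "y = (y1, y2)" by fastforce
  have "x2 - n (\<gamma> x1) + (y2 - n (\<gamma> y1)) \<in> dom D"
    using xy by (intro linear_op_app(1)[OF D_lin]) (auto simp: Dt_Some_iff)
  then show "Dt (x + y) = Some (u + v)"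
    using xy W_dom(1)
    by (auto simp: Dt_Some_iff W_add linear_op_app(2)[OF Ds_lin] n_simps grading_simps algebra_simps)
next
  fix x u c assume x: "Dt x = Some u"
  obtain x1 x2 where [simp]: "x = (x1, x2)" by fastforce
  have "c *\<^sub>C (x2 - n (\<gamma> x1)) \<in> dom D"
    using x by (intro linear_op_app_unary(1)[OF D_lin]) (auto simp: Dt_Some_iff)
  then show "Dt (c *\<^sub>C x) = Some (c *\<^sub>C u)"
    using x W_dom(1)
    by (auto simp: Dt_Some_iff W_scaleC linear_op_app_unary(2)[OF Ds_lin] n_simps grading_simps
        scaleC_prod_def scaleC_diff_right)
qed

lemma Dt_dense: "densely_defined Dt"
proof -
  have "dom D \<times> dom D \<subseteq> dom Dt" using Dt_dom_D by auto
  then have "closure (dom D \<times> dom D) \<subseteq> closure (dom Dt)" by (rule closure_mono)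
  then show ?thesis using D_dense by (auto simp: densely_defined_def closure_Times)
qed

text \<open>The gluing condition identifies the boundary value of \<open>\<eta>\<close> with that of \<open>n (\<gamma> \<xi>)\<close>.  Since \<open>n\<close>
  preserves the boundary form and \<open>\<gamma>\<close> reverses it, the two contributions cancel.\<close>
lemma q_double:
  assumes "(\<xi>, \<eta>) \<in> dom Dt" "(\<xi>', \<eta>') \<in> dom Dt"
  shows "q \<xi> \<xi>' + q \<eta> \<eta>' = 0"
proof -
  have W: "\<xi> \<in> W" "\<eta> \<in> W" "\<xi>' \<in> W" "\<eta>' \<in> W" using assms by (auto simp: Dt_dom_iff)
  have nW: "n (\<gamma> \<xi>) \<in> W" "n (\<gamma> \<xi>') \<in> W" by (simp_all add: W_n W_grading W)
  have "q \<eta> \<eta>' = q (n (\<gamma> \<xi>)) \<eta>'"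
    by (rule q_cong_left) (use assms W nW in \<open>auto simp: Dt_dom_iff W_dom\<close>)
  also have "\<dots> = q (n (\<gamma> \<xi>)) (n (\<gamma> \<xi>'))"
    by (rule q_cong_right) (use assms W nW in \<open>auto simp: Dt_dom_iff W_dom\<close>)
  also have "\<dots> = - q \<xi> \<xi>'" by (simp add: q_n_n W_grading W q_grading W_dom)
  finally show ?thesis by simp
qed

text \<open>The gluing condition is symmetric in the two copies: apply \<open>- n \<circ> \<gamma>\<close> and use \<open>n \<circ> n = - 1\<close>
  modulo the domain of \<open>D\<close>.\<close>
lemma Dt_swap: "Dt (\<xi>, \<eta>) = Some (u, v) \<Longrightarrow> Dt (\<eta>, \<xi>) = Some (v, u)"
proof -
  assume a: "Dt (\<xi>, \<eta>) = Some (u, v)"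
  then have W: "\<xi> \<in> W" "\<eta> \<in> W" and d: "\<eta> - n (\<gamma> \<xi>) \<in> dom D" by (auto simp: Dt_Some_iff)
  have "n (n \<xi>) + \<xi> - n (\<gamma> (\<eta> - n (\<gamma> \<xi>))) \<in> dom D"
    by (intro linear_op_app(3)[OF D_lin] n_square[OF W(1)] n_dom grading_dom d)
  moreover have "n (n \<xi>) + \<xi> - n (\<gamma> (\<eta> - n (\<gamma> \<xi>))) = \<xi> - n (\<gamma> \<eta>)"
    by (simp add: n_simps grading_simps n_grading)
  ultimately show "Dt (\<eta>, \<xi>) = Some (v, u)" using a by (simp add: Dt_Some_iff)
qed

text \<open>Testing an element \<open>(w, z)\<close> of the adjoint domain against pairs with one entry in the domain of
  \<open>D\<close> and the other zero shows that
  \<open>w\<close> and \<open>z\<close> lie in the domain of \<open>D\<^sup>*\<close>.  Testing against \<open>(\<gamma> \<xi>, n \<xi>)\<close> gives exactly the hypothesis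
  of \<open>boundary_maximal\<close> for \<open>z\<close> and \<open>- \<gamma> w\<close>, whose conclusion is the gluing condition.\<close>
lemma Dt_adj: "adj_op Dt = Dt"
proof -
  have "adj_op Dt p = Some r \<longleftrightarrow> Dt p = Some r" for p r
  proof (cases p, cases r)
    fix w z u v assume p: "p = (w, z)" and r: "r = (u, v)"
    show ?thesis
    proof
      assume "Dt p = Some r"
      then have dom: "(w, z) \<in> dom Dt" and uv: "u = Ds \<cdot> w" "v = Ds \<cdot> z"
        by (auto simp: p r Dt_Some_iff Dt_dom_iff)
      show "adj_op Dt p = Some r"
        unfolding adj_op_iff[OF Dt_lin Dt_dense]
      proof
        fix x assume x: "x \<in> dom Dt"
        obtain \<xi> \<eta> where [simp]: "x = (\<xi>, \<eta>)" by (cases x)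
        have "Dt \<cdot> x = (Ds \<cdot> \<xi>, Ds \<cdot> \<eta>)" using Dt_app x by simp
        then show "inner p (Dt \<cdot> x) = inner r x"
          using q_double[OF dom] x by (force simp: p r uv boundary_form_def)
      qed
    next
      assume "adj_op Dt p = Some r"
      then have adj: "inner w (Ds \<cdot> \<xi>) + inner z (Ds \<cdot> \<eta>) = inner u \<xi> + inner v \<eta>"
        if "(\<xi>, \<eta>) \<in> dom Dt" for \<xi> \<eta>
        using adj_op_inner[OF Dt_lin Dt_dense _ Dt_app[OF that], of p r] by (simp add: p r)
      have D0: "0 \<in> dom D" and Ds0: "Ds \<cdot> 0 = 0"
        using linear_op_dom_0[OF D_lin] linear_opD(6)[OF Ds_lin] by auto
      have w: "Ds w = Some u" unfolding Ds_iff
        using adj[OF Dt_dom_D[OF _ D0]] by (auto simp: Ds0 Ds_extends)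
      have z: "Ds z = Some v" unfolding Ds_iff
        using adj[OF Dt_dom_D[OF D0]] by (auto simp: Ds0 Ds_extends)
      have wz: "w \<in> dom Ds" "z \<in> dom Ds" "\<gamma> w \<in> dom Ds" using w z grading_dom_Ds by auto
      have "z + n (- \<gamma> w) \<in> dom D"
      proof (rule boundary_maximal[OF wz(2) linear_op_app_unary(5)[OF Ds_lin wz(3)]])
        fix \<xi> assume \<xi>: "\<xi> \<in> W"
        have "(\<gamma> \<xi>, n \<xi>) \<in> dom Dt"
          using \<xi> D0 by (simp add: Dt_dom_iff W_grading W_n)
        then have "q w (\<gamma> \<xi>) + q z (n \<xi>) = 0"
          using adj[of "\<gamma> \<xi>" "n \<xi>"] by (simp add: boundary_form_def w z)
        moreover have "q w (\<gamma> \<xi>) = - q (\<gamma> w) \<xi>"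
          using q_grading[OF wz(3) W_dom(1)[OF \<xi>]] by simp
        ultimately show "q z (n \<xi>) + q (- \<gamma> w) \<xi> = 0" by (simp add: q_minus_left wz)
      qed
      then have d: "z - n (\<gamma> w) \<in> dom D" by (simp add: n_simps)
      have "n (\<gamma> w) \<in> dom Ds"
        using linear_op_app(3)[OF Ds_lin wz(2) dom_D_Ds[OF d]] by simp
      then have "\<gamma> w \<in> W" using wz by (simp add: W_iff)
      then have "w \<in> W" "z \<in> W" using W_grading[of "\<gamma> w"] W_cong[OF W_n d] by auto
      then show "Dt p = Some r" using d w z by (simp add: p r Dt_Some_iff)
    qed
  qed
  then show ?thesis by (intro ext) (metis not_Some_eq)
qed

lemma Dt_self_adjoint: "self_adjoint_op Dt"
  by (simp add: self_adjoint_op_def Dt_lin Dt_dense Dt_adj)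

lemma Dt_closed: "closed_op Dt"
  using closed_op_adj_op[OF Dt_lin Dt_dense] by (simp add: Dt_adj)

lemma Dt_odd: "odd_op (double_grading \<gamma>) Dt"
  unfolding odd_op_def
proof
  fix p assume p: "p \<in> dom Dt"
  obtain \<xi> \<eta> where [simp]: "p = (\<xi>, \<eta>)" by (cases p)
  have W: "\<xi> \<in> W" "\<eta> \<in> W" and d: "\<eta> - n (\<gamma> \<xi>) \<in> dom D" using p by (auto simp: Dt_dom_iff)
  have "- \<gamma> (\<eta> - n (\<gamma> \<xi>)) \<in> dom D"
    by (rule linear_op_app_unary(5)[OF D_lin grading_dom[OF d]])
  then have "Dt (\<gamma> \<xi>, - \<gamma> \<eta>) = Some (Ds \<cdot> (\<gamma> \<xi>), Ds \<cdot> (- \<gamma> \<eta>))"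
    using W by (simp add: Dt_Some_iff W_grading W_minus grading_simps n_grading)
  moreover have "Ds \<cdot> (- \<gamma> \<eta>) = \<gamma> (Ds \<cdot> \<eta>)"
    using linear_op_app_unary(6)[OF Ds_lin] grading_dom_Ds Ds_grading W_dom(1)[OF W(2)] by simp
  moreover have "Dt p = Some (Ds \<cdot> \<xi>, Ds \<cdot> \<eta>)" using W d by (simp add: Dt_Some_iff)
  ultimately show "double_grading \<gamma> p \<in> dom Dt \<and>
      Dt \<cdot> (double_grading \<gamma> p) = - double_grading \<gamma> (Dt \<cdot> p)"
    using W_dom(1)[OF W(1)] by (auto simp: double_grading_def Ds_grading)
qed

end

section \<open>The action of the algebra on the domains\<close>

context relative_triple_with_normal
begin

lemma
  assumes "a \<in> \<A>"
  shows \<A>_in_A: "a \<in> A" and \<A>_star: "star a \<in> \<A>"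
  using rel assms by (auto simp: relative_spectral_triple_def dense_star_subalgebra_def star_subalgebra_def)

lemma rep_clinear: "a \<in> A \<Longrightarrow> bounded_clinear (\<pi> a)"
  using rel by (simp add: relative_spectral_triple_def even_representation_def)

lemma rep_inner: "a \<in> A \<Longrightarrow> inner (\<pi> a x) y = inner x (\<pi> (star a) y)"
proof -
  assume "a \<in> A"
  then have "is_adjoint (\<pi> (star a)) (\<pi> a)"
    using rel by (simp add: relative_spectral_triple_def even_representation_def)
  from is_adjoint_inner[OF this, of y x] show ?thesis by (simp add: inner_commute)
qed

lemma rep_add: "a \<in> A \<Longrightarrow> b \<in> A \<Longrightarrow> \<pi> (a + b) x = \<pi> a x + \<pi> b x"
  using rel by (simp add: relative_spectral_triple_def even_representation_def)

lemma rep_dom_D: "a \<in> \<A> \<Longrightarrow> x \<in> dom D \<Longrightarrow> \<pi> a x \<in> dom D"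
  using rel unfolding relative_spectral_triple_def by blast

lemma rep_ideal: "j \<in> \<J> \<Longrightarrow> x \<in> dom Ds \<Longrightarrow> \<pi> j x \<in> dom D"
  using rel unfolding relative_spectral_triple_def by blast

lemma rep_commutator_bound:
  assumes a: "a \<in> \<A>"
  obtains K where "\<And>x. x \<in> dom D \<Longrightarrow> norm (D \<cdot> (\<pi> a x) - \<gamma> (\<pi> a (\<gamma> (D \<cdot> x)))) \<le> K * norm x"
proof -
  have "bounded_op (graded_commutator \<gamma> D (\<pi> a))"
    using rel a unfolding relative_spectral_triple_def by blast
  then obtain K where K: "\<And>x. x \<in> dom (graded_commutator \<gamma> D (\<pi> a)) \<Longrightarrow>
      norm (graded_commutator \<gamma> D (\<pi> a) \<cdot> x) \<le> K * norm x"
    unfolding bounded_op_def by blast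
  have "norm (D \<cdot> (\<pi> a x) - \<gamma> (\<pi> a (\<gamma> (D \<cdot> x)))) \<le> K * norm x" if x: "x \<in> dom D" for x
  proof -
    have "graded_commutator \<gamma> D (\<pi> a) x = Some (D \<cdot> (\<pi> a x) - \<gamma> (\<pi> a (\<gamma> (D \<cdot> x))))"
      using x rep_dom_D[OF a x] by (auto simp: graded_commutator_def op_diff_def map_comp_def dom_def)
    then show ?thesis using K[of x] by auto
  qed
  then show thesis using that by blast
qed

lemma rep_normal_commutator:
  assumes "a \<in> \<A>" "\<xi> \<in> W"
  shows "n (\<pi> a \<xi>) - \<gamma> (\<pi> a (\<gamma> (n \<xi>))) \<in> dom D"
proof -
  have "graded_commutator \<gamma> (total_op n) (\<pi> a) \<cdot> \<xi> \<in> dom D"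
    using normal assms by (simp add: clifford_normal_def)
  moreover have "graded_commutator \<gamma> (total_op n) (\<pi> a) \<xi> = Some (n (\<pi> a \<xi>) - \<gamma> (\<pi> a (\<gamma> (n \<xi>))))"
    by (simp add: graded_commutator_def op_diff_def map_comp_def dom_def)
  ultimately show ?thesis by simp
qed

text \<open>The graded commutator of \<open>D\<close> with \<open>\<gamma> \<circ> \<pi> (star a) \<circ> \<gamma>\<close> is bounded too, being minus the conjugate
  under \<open>\<gamma>\<close> of the one with \<open>\<pi> (star a)\<close>; this matters because \<open>\<A>\<close> need not be invariant under the
  grading.  Moving \<open>\<pi> a\<close> to the other side of \<open>inner (\<pi> a x) (D y)\<close> therefore produces
  \<open>\<gamma> (\<pi> a (\<gamma> (Ds x)))\<close> up to a functional of \<open>y\<close> bounded by \<open>norm x\<close>.\<close>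
lemma rep_adjoint_commutator_bound:
  assumes a: "a \<in> \<A>"
  obtains K where "\<And>x u. Ds x = Some u \<Longrightarrow>
    \<exists>v. Ds (\<pi> a x) = Some v \<and> norm (v - \<gamma> (\<pi> a (\<gamma> u))) \<le> K * norm x"
proof -
  let ?b = "star a"
  have b: "?b \<in> \<A>" using \<A>_star[OF a] .
  note clb = rep_clinear[OF \<A>_in_A[OF b]]
  note b_simps = bounded_clinear_add[OF clb] bounded_clinear_minus[OF clb] bounded_clinear_scaleC[OF clb]
  obtain K where K: "\<And>y. y \<in> dom D \<Longrightarrow> norm (D \<cdot> (\<pi> ?b y) - \<gamma> (\<pi> ?b (\<gamma> (D \<cdot> y)))) \<le> K * norm y"
    using rep_commutator_bound[OF b] by blast
  define E where "E y = \<pi> ?b (D \<cdot> y) + \<gamma> (D \<cdot> (\<pi> ?b (\<gamma> y)))" for y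
  have E_bound: "norm (E y) \<le> K * norm y" if y: "y \<in> dom D" for y
  proof -
    have "E y = \<gamma> (D \<cdot> (\<pi> ?b (\<gamma> y)) - \<gamma> (\<pi> ?b (\<gamma> (D \<cdot> (\<gamma> y)))))"
      by (simp add: E_def D_grading[OF y] grading_simps b_simps)
    then show ?thesis using K[OF grading_dom[OF y]] by (simp only: norm_grading)
  qed
  have sub: "subspace (dom D)" using linear_op_dom_csubspace[OF D_lin] csubspaceD(1) by blast
  have "\<exists>v. Ds (\<pi> a x) = Some v \<and> norm (v - \<gamma> (\<pi> a (\<gamma> u))) \<le> \<bar>K\<bar> * norm x" if x: "Ds x = Some u" for x u
  proof -
    obtain z where z: "\<And>y. y \<in> dom D \<Longrightarrow> inner x (E y) = inner z y" "norm z \<le> \<bar>norm x * K\<bar>"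
    proof (rule riesz_on_subspace[where X = "dom D" and \<phi> = "\<lambda>y. inner x (E y)" and K = "norm x * K"])
      show "inner x (E (y + y')) = inner x (E y) + inner x (E y')" if "y \<in> dom D" "y' \<in> dom D" for y y'
        using that
        by (simp add: E_def linear_op_app(1,2)[OF D_lin] b_simps grading_simps rep_dom_D[OF b] grading_dom inner_add_right)
      show "inner x (E (c *\<^sub>R y)) = c * inner x (E y)" if "y \<in> dom D" for c y
      proof -
        have "E (c *\<^sub>R y) = c *\<^sub>R E y"
          using that linear_op_app_unary(1,2)[OF D_lin]
          by (simp add: E_def scaleR_scaleC b_simps grading_simps rep_dom_D[OF b] grading_dom scaleC_add_right)
        then show ?thesis by simp
      qed
      show "\<bar>inner x (E y)\<bar> \<le> norm x * K * norm y" if "y \<in> dom D" for y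
        using Cauchy_Schwarz_ineq2[of x "E y"] mult_left_mono[OF E_bound[OF that], of "norm x"]
        by (simp add: mult.assoc)
    qed (use sub in blast)+
    have "Ds (\<pi> a x) = Some (z + \<gamma> (\<pi> a (\<gamma> u)))"
      unfolding Ds_iff
    proof
      fix y assume y: "y \<in> dom D"
      have gby: "\<gamma> (\<pi> ?b (\<gamma> y)) \<in> dom D" by (intro grading_dom rep_dom_D[OF b] y)
      have "inner (\<pi> a x) (D \<cdot> y) = inner x (\<pi> ?b (D \<cdot> y))" by (rule rep_inner[OF \<A>_in_A[OF a]])
      also have "\<pi> ?b (D \<cdot> y) = E y + D \<cdot> (\<gamma> (\<pi> ?b (\<gamma> y)))"
        using D_grading[OF rep_dom_D[OF b grading_dom[OF y]]] by (simp add: E_def)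
      also have "inner x \<dots> = inner z y + inner u (\<gamma> (\<pi> ?b (\<gamma> y)))"
        using x gby by (simp add: inner_add_right z(1)[OF y] Ds_iff)
      also have "inner u (\<gamma> (\<pi> ?b (\<gamma> y))) = inner (\<gamma> (\<pi> a (\<gamma> u))) y"
        by (simp add: grading_inner rep_inner[OF \<A>_in_A[OF a]])
      finally show "inner (\<pi> a x) (D \<cdot> y) = inner (z + \<gamma> (\<pi> a (\<gamma> u))) y" by (simp add: inner_add_left)
    qed
    then show ?thesis using z(2) by (simp add: abs_mult mult.commute)
  qed
  then show thesis using that by blast
qed

lemma rep_preserves_dom_Ds:
  assumes a: "a \<in> \<A>" and x: "x \<in> dom Ds"
  shows "\<pi> a x \<in> dom Ds"
proof -
  obtain K where "\<And>x u. Ds x = Some u \<Longrightarrow>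
      \<exists>v. Ds (\<pi> a x) = Some v \<and> norm (v - \<gamma> (\<pi> a (\<gamma> u))) \<le> K * norm x"
    using rep_adjoint_commutator_bound[OF a] by blast
  then show ?thesis using x by blast
qed

lemma rep_W:
  assumes a: "a \<in> \<A>" and \<xi>: "\<xi> \<in> W"
  shows "\<pi> a \<xi> \<in> W"
proof -
  have "\<gamma> (\<pi> a (\<gamma> (n \<xi>))) \<in> dom Ds"
    by (intro grading_dom_Ds rep_preserves_dom_Ds[OF a] W_dom[OF \<xi>])
  from linear_op_app(1)[OF Ds_lin dom_D_Ds[OF rep_normal_commutator[OF a \<xi>]] this]
  have "n (\<pi> a \<xi>) \<in> dom Ds" by simp
  then show ?thesis using rep_preserves_dom_Ds[OF a W_dom(1)[OF \<xi>]] by (simp add: W_iff)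
qed

text \<open>Modulo the domain of \<open>D\<close>, the normal carries the boundary value of \<open>\<pi> a \<xi>\<close> to that of
  \<open>\<pi> a (n (\<gamma> \<xi>))\<close>, that is of \<open>\<pi> a \<eta>\<close>; and \<open>\<pi> a \<eta>\<close> and \<open>\<pi> b \<eta>\<close> have the same boundary value because
  \<open>\<J>\<close> maps the domain of \<open>D\<^sup>*\<close> to that of \<open>D\<close>.\<close>
lemma double_rep_dom_Dt:
  assumes a: "a \<in> \<A>" and b: "b \<in> \<A>" and ab: "b - a \<in> \<J>"
    and p: "(\<xi>, \<eta>) \<in> dom Dt"
  shows "(\<pi> a \<xi>, \<pi> b \<eta>) \<in> dom Dt"
proof -
  have W: "\<xi> \<in> W" "\<eta> \<in> W" and d: "\<eta> - n (\<gamma> \<xi>) \<in> dom D" using p by (auto simp: Dt_dom_iff)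
  have ba: "\<pi> b \<eta> = \<pi> (b - a) \<eta> + \<pi> a \<eta>"
  proof -
    have "b - a \<in> A" using ab rel ideal
      by (auto simp: relative_spectral_triple_def dense_star_subalgebra_def graded_ideal_def two_sided_ideal_def)
    then have "\<pi> ((b - a) + a) \<eta> = \<pi> (b - a) \<eta> + \<pi> a \<eta>"
      using \<A>_in_A[OF a] by (rule rep_add)
    then show ?thesis by simp
  qed
  note cla = rep_clinear[OF \<A>_in_A[OF a]]
  have 1: "\<pi> (b - a) \<eta> \<in> dom D" by (rule rep_ideal[OF ab W_dom(1)[OF W(2)]])
  have 2: "\<pi> a (\<eta> - n (\<gamma> \<xi>)) \<in> dom D" by (rule rep_dom_D[OF a d])
  have 3: "n (\<pi> a \<xi>) - \<gamma> (\<pi> a (\<gamma> (n \<xi>))) \<in> dom D" by (rule rep_normal_commutator[OF a W(1)])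
  have "\<pi> (b - a) \<eta> + \<pi> a (\<eta> - n (\<gamma> \<xi>)) + \<gamma> (n (\<pi> a \<xi>) - \<gamma> (\<pi> a (\<gamma> (n \<xi>)))) \<in> dom D"
    by (intro linear_op_app(1)[OF D_lin] 1 2 grading_dom[OF 3])
  moreover have "\<pi> (b - a) \<eta> + \<pi> a (\<eta> - n (\<gamma> \<xi>)) + \<gamma> (n (\<pi> a \<xi>) - \<gamma> (\<pi> a (\<gamma> (n \<xi>))))
      = \<pi> b \<eta> - n (\<gamma> (\<pi> a \<xi>))"
    by (simp add: ba n_grading grading_simps bounded_clinear_add[OF cla]
        bounded_clinear_diff[OF cla] bounded_clinear_minus[OF cla])
  ultimately show ?thesis by (simp add: Dt_dom_iff rep_W[OF a W(1)] rep_W[OF b W(2)])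
qed

section \<open>Compactness of the resolvent of the double\<close>

abbreviation "Rt \<equiv> resolvent_root Dt"

definition "glue h = (h, - n (\<gamma> h))"
text \<open>The adjoint of \<open>glue\<close>.  It maps pairs whose boundary values satisfy \<open>\<eta> = n (\<gamma> \<xi>)\<close> to the domain
  of \<open>D\<close>, because \<open>n \<circ> n = - 1\<close> on boundary values.\<close>
definition "unglue p = fst p - n (\<gamma> (snd p))"

lemma glue_inner: "inner (glue h) p = inner h (unglue p)"
proof -
  have "inner (n (\<gamma> h)) y = inner h (n (\<gamma> y))" for y
    by (simp add: n_inner grading_inner n_grading)
  then show ?thesis by (cases p) (simp add: glue_def unglue_def inner_diff_right)
qed

lemma unglue_dom_D:
  assumes "p \<in> dom Dt"
  shows "unglue p \<in> dom D"
proof -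
  obtain \<xi> \<eta> where [simp]: "p = (\<xi>, \<eta>)" by (cases p)
  obtain u v where "Dt (\<xi>, \<eta>) = Some (u, v)" using assms by auto
  from Dt_swap[OF this] show ?thesis by (simp add: Dt_Some_iff unglue_def)
qed

lemma glue_bounded_linear: "bounded_linear glue"
  and unglue_bounded_linear: "bounded_linear unglue"
proof -
  have ng: "bounded_linear (\<lambda>x. n (\<gamma> x))"
    using bounded_linear_compose[OF bounded_clinear_bounded_linear[OF n_clinear]
        bounded_clinear_bounded_linear[OF grading_clinear]] .
  show "bounded_linear glue" unfolding glue_def[abs_def]
    by (intro bounded_linear_Pair bounded_linear_ident bounded_linear_minus ng)
  show "bounded_linear unglue" unfolding unglue_def[abs_def]
    by (intro bounded_linear_sub bounded_linear_fst bounded_linear_compose[OF ng] bounded_linear_snd)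
qed

lemma Rt_positive: "positive_op Rt"
  by (rule resolvent_root_positive[OF Dt_lin Dt_dense Dt_closed])

lemma Rt_clinear: "bounded_clinear Rt"
  using Rt_positive by (simp add: positive_op_def)

lemma Rt_bounded_linear: "bounded_linear Rt"
  by (rule bounded_clinear_bounded_linear[OF Rt_clinear])

lemma Rt_dom:
  obtains w where "Dt (Rt f) = Some w" "(norm (Rt f))\<^sup>2 + (norm w)\<^sup>2 = (norm f)\<^sup>2"
  by (rule resolvent_root_dom[OF Dt_lin Dt_dense Dt_closed])

lemma norm_Rt_le: "norm (Rt f) \<le> norm f"
proof (rule power2_le_imp_le)
  obtain w where "Dt (Rt f) = Some w" "(norm (Rt f))\<^sup>2 + (norm w)\<^sup>2 = (norm f)\<^sup>2" by (rule Rt_dom)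
  then show "(norm (Rt f))\<^sup>2 \<le> (norm f)\<^sup>2" using zero_le_power2[of "norm w"] by linarith
qed simp

text \<open>The closed graph theorem makes the inclusion given by the gluing condition quantitative.\<close>
lemma unglue_Rt_graph_bound:
  obtains C where "\<And>f. norm (unglue (Rt f), D \<cdot> (unglue (Rt f))) \<le> C * norm f"
proof -
  have dom: "unglue (Rt f) \<in> dom D" for f
  proof -
    obtain w where "Dt (Rt f) = Some w" by (rule Rt_dom)
    then show ?thesis by (intro unglue_dom_D) auto
  qed
  have adj_dense: "densely_defined Ds"
  proof -
    have "closure (dom D) \<subseteq> closure (dom Ds)" using dom_D_Ds by (intro closure_mono) blast
    then show ?thesis using D_dense by (auto simp: densely_defined_def)
  qed
  have adj: "inner (unglue (Rt f)) h = inner f (Rt (glue h))" for f h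
    using glue_inner[of h "Rt f"] positive_op_inner(1)[OF Rt_positive, of f "glue h"]
    by (simp add: inner_commute)
  have TB: "D (unglue (Rt f)) = Some (D \<cdot> (unglue (Rt f)))" for f using dom[of f] by auto
  obtain C where C: "\<And>f. norm (D \<cdot> (unglue (Rt f))) \<le> C * norm f"
    using unbounded_compose_bounded[OF D_lin D_dense adj_dense adj TB] by blast
  obtain K where K: "\<And>f. norm (unglue (Rt f)) \<le> norm f * K"
    using bounded_linear.bounded[OF bounded_linear_compose[OF unglue_bounded_linear Rt_bounded_linear]] by blast
  have "norm (unglue (Rt f), D \<cdot> (unglue (Rt f))) \<le> (K + C) * norm f" for f
    using norm_Pair_le[of "unglue (Rt f)" "D \<cdot> (unglue (Rt f))"] C[of f] K[of f]
    by (simp add: algebra_simps)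
  then show thesis using that by blast
qed

lemma unglue_Rt_compact:
  assumes a: "a \<in> \<A>"
  shows "compact (closure ((\<lambda>f. \<pi> a (unglue (Rt f))) ` cball 0 M))"
proof -
  obtain C where C: "\<And>f. norm (unglue (Rt f), D \<cdot> (unglue (Rt f))) \<le> C * norm f"
    using unglue_Rt_graph_bound by blast
  have cpt: "compact_op (\<pi> a \<circ> resolvent_root D)"
    using rel a by (simp add: relative_spectral_triple_def)
  show ?thesis
  proof (rule compact_closure_mono[OF _ compact_on_graph_bounded[OF D_lin D_dense D_closed cpt]])
    show "(\<lambda>f. \<pi> a (unglue (Rt f))) ` cball 0 M
        \<subseteq> {\<pi> a x |x w. D x = Some w \<and> norm (x, w) \<le> \<bar>C\<bar> * M}"
    proof clarify
      fix f :: "'h \<times> 'h" assume f: "f \<in> cball 0 M"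
      obtain w where "Dt (Rt f) = Some w" by (rule Rt_dom)
      then have "unglue (Rt f) \<in> dom D" by (intro unglue_dom_D) auto
      moreover have "norm (unglue (Rt f), D \<cdot> (unglue (Rt f))) \<le> \<bar>C\<bar> * M"
      proof -
        have "C * norm f \<le> \<bar>C\<bar> * M" using f by (intro mult_mono) auto
        then show ?thesis using C[of f] by linarith
      qed
      ultimately show "\<exists>x w. \<pi> a (unglue (Rt f)) = \<pi> a x \<and> D x = Some w \<and> norm (x, w) \<le> \<bar>C\<bar> * M"
        by (intro exI[of _ "unglue (Rt f)"] exI[of _ "D \<cdot> (unglue (Rt f))"]) auto
    qed
  qed
qed

text \<open>On the domain of the double the boundary energy of \<open>\<xi>\<close> equals \<open>- q (\<gamma> \<xi>) \<eta>\<close>, so it is controlled by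
  the graph norm, and it is small if \<open>\<xi>\<close> and \<open>\<eta>\<close> are small while their images stay bounded.\<close>
lemma boundary_energy_le:
  assumes "Dt (\<xi>, \<eta>) = Some (u, v)"
  shows "- q \<xi> (n \<xi>) \<le> norm u * norm \<eta> + norm \<xi> * norm v"
proof -
  have W: "\<xi> \<in> W" "\<eta> \<in> W" and d: "\<eta> - n (\<gamma> \<xi>) \<in> dom D" and uv: "u = Ds \<cdot> \<xi>" "v = Ds \<cdot> \<eta>"
    using assms by (auto simp: Dt_Some_iff)
  have g: "\<gamma> \<xi> \<in> W" by (rule W_grading[OF W(1)])
  have "q (\<gamma> \<xi>) \<eta> = q (\<gamma> \<xi>) (n (\<gamma> \<xi>))"
    by (rule q_cong_right[OF W_dom(1)[OF W(2)] W_dom(2)[OF g] W_dom(1)[OF g] d])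
  also have "\<dots> = - q (\<gamma> \<xi>) (\<gamma> (n \<xi>))"
    by (simp add: n_grading q_minus_right grading_dom_Ds W_dom(2)[OF W(1)])
  also have "\<dots> = q \<xi> (n \<xi>)" by (simp add: q_grading W_dom[OF W(1)])
  finally have "- q \<xi> (n \<xi>) \<le> \<bar>q (\<gamma> \<xi>) \<eta>\<bar>" by simp
  also have "\<dots> \<le> norm (Ds \<cdot> (\<gamma> \<xi>)) * norm \<eta> + norm (\<gamma> \<xi>) * norm (Ds \<cdot> \<eta>)" by (rule abs_q_le)
  finally show ?thesis by (simp add: uv Ds_grading W_dom[OF W(1)])
qed

text \<open>With \<open>g = glue h\<close>, the first component \<open>\<rho>\<close> of \<open>Dt (1 + Dt\<^sup>2)\<^sup>-\<^sup>1 g\<close> satisfies \<open>h = Ds \<rho> + s\<close>, where \<open>\<rho>\<close> and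
  \<open>s\<close> have norm at most \<open>norm (Rt g)\<close>.  Hence \<open>inner \<xi> h\<close> agrees, up to terms of this size, with the
  boundary term \<open>- q \<xi> \<rho>\<close>, which is bounded by the geometric mean of the boundary energies of \<open>\<xi>\<close>
  and \<open>\<rho>\<close>; the energy of \<open>\<rho>\<close> is small as well.\<close>
lemma first_component_estimate:
  assumes p: "Dt (\<xi>, \<eta>) = Some (u, v)"
    and m: "norm \<xi> \<le> m" "norm \<eta> \<le> m" "norm u \<le> m" "norm v \<le> m"
  shows "inner \<xi> h \<le> 2 * m * norm (Rt (glue h)) + sqrt (8 * m\<^sup>2 * norm (glue h) * norm (Rt (glue h)))"
proof -
  define g where "g = glue h"
  define \<epsilon> where "\<epsilon> = norm (Rt g)"
  have m0: "0 \<le> m" using m(1) norm_ge_zero order_trans by blast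
  have \<epsilon>0: "0 \<le> \<epsilon>" "\<epsilon> \<le> norm g" using norm_Rt_le[of g] by (auto simp: \<epsilon>_def)
  obtain w where w: "Dt (Rt (Rt g)) = Some w" "adj_op Dt w = Some (g - Rt (Rt g))"
    "(norm (Rt (Rt g)))\<^sup>2 + (norm w)\<^sup>2 = \<epsilon>\<^sup>2"
    unfolding \<epsilon>_def by (rule resolvent_root_square[OF Dt_lin Dt_dense Dt_closed])
  obtain s t where st: "Rt (Rt g) = (s, t)" by (cases "Rt (Rt g)")
  obtain \<rho> \<sigma> where \<rho>\<sigma>: "w = (\<rho>, \<sigma>)" by (cases w)
  have sw: "norm (s, t) \<le> \<epsilon>" "norm (\<rho>, \<sigma>) \<le> \<epsilon>"
  proof -
    have "(norm (s, t))\<^sup>2 + (norm (\<rho>, \<sigma>))\<^sup>2 = \<epsilon>\<^sup>2" using w(3) by (simp only: st \<rho>\<sigma>)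
    then have "(norm (s, t))\<^sup>2 \<le> \<epsilon>\<^sup>2" "(norm (\<rho>, \<sigma>))\<^sup>2 \<le> \<epsilon>\<^sup>2"
      using zero_le_power2[of "norm (s, t)"] zero_le_power2[of "norm (\<rho>, \<sigma>)"] by linarith+
    then show "norm (s, t) \<le> \<epsilon>" "norm (\<rho>, \<sigma>) \<le> \<epsilon>" using \<epsilon>0(1) by (auto intro: power2_le_imp_le)
  qed
  have small: "norm s \<le> \<epsilon>" "norm \<rho> \<le> \<epsilon>" "norm \<sigma> \<le> \<epsilon>"
    using sw norm_fst_le[of s t] norm_fst_le[of \<rho> \<sigma>] norm_snd_le[of \<sigma> \<rho>] by linarith+
  have D\<rho>: "Dt (\<rho>, \<sigma>) = Some (g - (s, t))" using w(2)[unfolded st \<rho>\<sigma>] by (simp add: Dt_adj)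
  have big: "norm (g - (s, t)) \<le> 2 * norm g"
    using norm_triangle_ineq4[of g "(s, t)"] sw(1) \<epsilon>0(2) by linarith
  define r1 r2 where "r1 = fst (g - (s, t))" and "r2 = snd (g - (s, t))"
  have r: "g - (s, t) = (r1, r2)" by (simp only: r1_def r2_def prod.collapse)
  have r_le: "norm r1 \<le> 2 * norm g" "norm r2 \<le> 2 * norm g"
    using big norm_fst_le[of r1 r2] norm_snd_le[of r2 r1] unfolding r by linarith+
  have W: "\<xi> \<in> W" "\<rho> \<in> W" and Ds: "u = Ds \<cdot> \<xi>" "r1 = Ds \<cdot> \<rho>"
    using p D\<rho> by (auto simp: Dt_Some_iff r)
  have h: "h = Ds \<cdot> \<rho> + s" using Ds(2) by (simp add: r1_def g_def glue_def algebra_simps)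
  have "(q \<xi> \<rho>)\<^sup>2 \<le> (- q \<xi> (n \<xi>)) * (- q \<rho> (n \<rho>))" by (rule q_Cauchy_Schwarz[OF W])
  also have "\<dots> \<le> (2 * m\<^sup>2) * (4 * norm g * \<epsilon>)"
  proof (rule mult_mono)
    have "norm u * norm \<eta> + norm \<xi> * norm v \<le> m * m + m * m"
      by (intro add_mono mult_mono m m0 norm_ge_zero)
    then show "- q \<xi> (n \<xi>) \<le> 2 * m\<^sup>2"
      using boundary_energy_le[OF p] by (simp add: power2_eq_square)
    have "norm r1 * norm \<sigma> + norm \<rho> * norm r2 \<le> (2 * norm g) * \<epsilon> + \<epsilon> * (2 * norm g)"
      by (intro add_mono mult_mono r_le small \<epsilon>0 norm_ge_zero mult_nonneg_nonneg) simp_all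
    then show "- q \<rho> (n \<rho>) \<le> 4 * norm g * \<epsilon>"
      using boundary_energy_le[OF D\<rho>[unfolded r]] by (simp add: mult_ac)
  qed (use q_n_nonneg[OF W(2)] in simp_all)
  finally have "(q \<xi> \<rho>)\<^sup>2 \<le> 8 * m\<^sup>2 * norm g * \<epsilon>" by (simp add: mult_ac)
  then have q_le: "\<bar>q \<xi> \<rho>\<bar> \<le> sqrt (8 * m\<^sup>2 * norm g * \<epsilon>)" by (rule real_le_rsqrt[of "\<bar>q \<xi> \<rho>\<bar>", simplified])
  have "inner \<xi> h = inner u \<rho> - q \<xi> \<rho> + inner \<xi> s"
    by (simp add: h Ds inner_add_right boundary_form_def)
  moreover have "inner u \<rho> \<le> m * \<epsilon>" "inner \<xi> s \<le> m * \<epsilon>"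
    by (rule order_trans[OF norm_cauchy_schwarz], intro mult_mono m small m0 norm_ge_zero)+
  ultimately show ?thesis using q_le unfolding g_def[symmetric] \<epsilon>_def[symmetric] by linarith
qed

text \<open>An instance of \<open>norm (K\<^sup>* h) ^ 2 \<le> norm h * norm (K (K\<^sup>* h))\<close> for the compact operator
  \<open>K = \<pi> a \<circ> unglue \<circ> Rt\<close>, whose adjoint is \<open>Rt \<circ> glue \<circ> \<pi> (star a)\<close>.\<close>
lemma Rt_glue_estimate:
  fixes h
  assumes a: "a \<in> \<A>"
  defines "g \<equiv> glue (\<pi> (star a) h)"
  shows "(norm (Rt g))\<^sup>2 \<le> norm h * norm (\<pi> a (unglue (Rt (Rt g))))"
proof -
  have "(norm (Rt g))\<^sup>2 = inner g (Rt (Rt g))"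
    by (simp add: power2_norm_eq_inner positive_op_inner(1)[OF Rt_positive])
  also have "\<dots> = inner h (\<pi> a (unglue (Rt (Rt g))))"
    by (simp add: g_def glue_inner)
      (simp add: inner_commute[of h] inner_commute[of "\<pi> (star a) h"] rep_inner[OF \<A>_in_A[OF a]])
  also have "\<dots> \<le> norm h * norm (\<pi> a (unglue (Rt (Rt g))))" by (rule norm_cauchy_schwarz)
  finally show ?thesis .
qed

text \<open>The estimate is applied with \<open>h = \<pi> (star a) (\<pi> a \<xi>)\<close>, for which \<open>inner \<xi> h\<close> is the square of
  \<open>norm (\<pi> a \<xi>)\<close>.  It bounds \<open>\<pi> a \<xi>\<close> in terms of a compact operator applied to the same vector.
  The map \<open>F\<close> is kept general so that the lemma also serves the second component, through the
  exchange of the two copies.\<close>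
lemma first_component_compact:
  fixes F :: "'h \<times> 'h \<Rightarrow> 'h \<times> 'h"
  assumes a: "a \<in> \<A>" and F: "bounded_linear F"
    and energy: "\<And>f. \<exists>w. Dt (F f) = Some w \<and> (norm (F f))\<^sup>2 + (norm w)\<^sup>2 \<le> (norm f)\<^sup>2"
  shows "compact (closure ((\<lambda>f. \<pi> a (fst (F f))) ` cball 0 M))"
proof -
  define T where "T f = \<pi> a (fst (F f))" for f
  define G where "G f = glue (\<pi> (star a) (T f))" for f
  define \<Phi> where "\<Phi> f = \<pi> a (unglue (Rt (Rt (G f))))" for f
  note bl_a = bounded_clinear_bounded_linear[OF rep_clinear[OF \<A>_in_A[OF a]]]
  note bl_sa = bounded_clinear_bounded_linear[OF rep_clinear[OF \<A>_in_A[OF \<A>_star[OF a]]]]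
  have T: "bounded_linear T" unfolding T_def
    by (intro bounded_linear_compose[OF bl_a] bounded_linear_compose[OF bounded_linear_fst] F)
  have G: "bounded_linear G" unfolding G_def
    by (intro bounded_linear_compose[OF glue_bounded_linear] bounded_linear_compose[OF bl_sa] T)
  have \<Phi>: "bounded_linear \<Phi>" unfolding \<Phi>_def
    by (intro bounded_linear_compose[OF bl_a] bounded_linear_compose[OF unglue_bounded_linear]
        bounded_linear_compose[OF Rt_bounded_linear] G)
  obtain k where k: "k > 0" "\<And>f. norm (T f) \<le> norm f * k" using bounded_linear.pos_bounded[OF T] by blast
  obtain c where c: "c > 0" "\<And>f. norm (G f) \<le> norm f * c" using bounded_linear.pos_bounded[OF G] by blast
  \<comment> \<open>The estimate is used for differences of two vectors of the ball, hence the factor 2.\<close>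
  define m where "m = 2 * \<bar>M\<bar>"
  have m0: "0 \<le> m" by (simp add: m_def)
  define \<psi> where "\<psi> d = 2 * m * sqrt (m * k * d) + sqrt (8 * m\<^sup>2 * (m * c) * sqrt (m * k * d))" for d
  have est: "(norm (T f))\<^sup>2 \<le> \<psi> (norm (\<Phi> f))" if f: "norm f \<le> m" for f
  proof -
    define \<epsilon> where "\<epsilon> = norm (Rt (G f))"
    obtain w where w: "Dt (F f) = Some w" "(norm (F f))\<^sup>2 + (norm w)\<^sup>2 \<le> (norm f)\<^sup>2" using energy by blast
    have "(norm f)\<^sup>2 \<le> m\<^sup>2" using f by (intro power_mono) auto
    then have "(norm (F f))\<^sup>2 \<le> m\<^sup>2" "(norm w)\<^sup>2 \<le> m\<^sup>2"
      using w(2) zero_le_power2[of "norm w"] zero_le_power2[of "norm (F f)"] by linarith+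
    then have Fw: "norm (F f) \<le> m" "norm w \<le> m" using m0 by (auto intro: power2_le_imp_le)
    obtain \<xi> \<eta> where F_eq: "F f = (\<xi>, \<eta>)" by (cases "F f")
    obtain u v where w_eq: "w = (u, v)" by (cases w)
    have le: "norm \<xi> \<le> m" "norm \<eta> \<le> m" "norm u \<le> m" "norm v \<le> m"
      using Fw norm_fst_le[of \<xi> \<eta>] norm_snd_le[of \<eta> \<xi>] norm_fst_le[of u v] norm_snd_le[of v u]
      unfolding F_eq w_eq by linarith+
    have T_eq: "T f = \<pi> a \<xi>" by (simp add: T_def F_eq)
    have "(norm (T f))\<^sup>2 = inner \<xi> (\<pi> (star a) (T f))"
      by (simp add: power2_norm_eq_inner T_eq rep_inner[OF \<A>_in_A[OF a], symmetric])
    also have "\<dots> \<le> 2 * m * \<epsilon> + sqrt (8 * m\<^sup>2 * norm (G f) * \<epsilon>)"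
      unfolding \<epsilon>_def G_def
      by (rule first_component_estimate[OF w(1)[unfolded F_eq w_eq] le])
    also have "\<dots> \<le> \<psi> (norm (\<Phi> f))"
    proof -
      have "\<epsilon>\<^sup>2 \<le> norm (T f) * norm (\<Phi> f)"
        unfolding \<epsilon>_def G_def \<Phi>_def by (rule Rt_glue_estimate[OF a])
      also have "\<dots> \<le> (m * k) * norm (\<Phi> f)"
      proof (rule mult_right_mono)
        show "norm (T f) \<le> m * k" using k(2)[of f] mult_right_mono[OF f, of k] k(1) by linarith
      qed simp
      finally have \<epsilon>: "\<epsilon> \<le> sqrt (m * k * norm (\<Phi> f))" by (rule real_le_rsqrt)
      have Gm: "norm (G f) \<le> m * c" using c(2)[of f] mult_right_mono[OF f, of c] c(1) by linarith
      show ?thesis unfolding \<psi>_def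
        using m0 c(1) \<epsilon> Gm by (intro add_mono mult_left_mono real_sqrt_le_mono mult_mono) (auto simp: \<epsilon>_def)
    qed
    finally show ?thesis .
  qed
  have \<psi>0: "(\<psi> \<longlongrightarrow> 0) (at_right 0)"
  proof -
    have "isCont \<psi> 0" unfolding \<psi>_def by (intro continuous_intros)
    then have "(\<psi> \<longlongrightarrow> \<psi> 0) (at 0)" by (simp add: isCont_def)
    then have "(\<psi> \<longlongrightarrow> \<psi> 0) (at_right 0)" by (rule filterlim_at_split[THEN iffD1, THEN conjunct2])
    then show ?thesis by (simp add: \<psi>_def)
  qed
  have "compact (closure (T ` cball 0 M))"
  proof (rule compact_closure_domination[where K = \<Phi>])
    show "compact (closure (\<Phi> ` cball 0 M))"
    proof (rule compact_closure_mono[OF _ unglue_Rt_compact[OF a]])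
      show "\<Phi> ` cball 0 M \<subseteq> (\<lambda>f. \<pi> a (unglue (Rt f))) ` cball 0 (\<bar>M\<bar> * c)"
      proof clarify
        fix f :: "'h \<times> 'h" assume f: "f \<in> cball 0 M"
        have "norm (Rt (G f)) \<le> norm f * c" using norm_Rt_le[of "G f"] c(2)[of f] by linarith
        also have "\<dots> \<le> \<bar>M\<bar> * c" using f c(1) by (intro mult_right_mono) auto
        finally show "\<Phi> f \<in> (\<lambda>f. \<pi> a (unglue (Rt f))) ` cball 0 (\<bar>M\<bar> * c)"
          by (auto simp: \<Phi>_def)
      qed
    qed
    fix e :: real assume e: "e > 0"
    have "\<forall>\<^sub>F d in at_right 0. \<psi> d < e\<^sup>2" using order_tendstoD(2)[OF \<psi>0, of "e\<^sup>2"] e by simp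
    then obtain d0 where d0: "d0 > 0" "\<And>d. 0 < d \<Longrightarrow> d < d0 \<Longrightarrow> \<psi> d < e\<^sup>2"
      unfolding eventually_at_right_field by auto
    have \<psi>_small: "\<psi> d < e\<^sup>2" if "0 \<le> d" "d < d0" for d
      using d0(2)[of d] that e by (cases "d = 0") (auto simp: \<psi>_def)
    have "dist (T x) (T y) < e" if xy: "x \<in> cball 0 M" "y \<in> cball 0 M" and d: "dist (\<Phi> x) (\<Phi> y) < d0" for x y
    proof -
      have "norm (x - y) \<le> m" using xy norm_triangle_ineq4[of x y] by (simp add: m_def)
      then have "(norm (T (x - y)))\<^sup>2 \<le> \<psi> (norm (\<Phi> (x - y)))" by (rule est)
      also have "\<dots> < e\<^sup>2"
        using d by (intro \<psi>_small) (simp_all add: dist_norm linear_diff[OF bounded_linear.linear[OF \<Phi>]])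
      finally have "norm (T (x - y)) < e" by (rule power_less_imp_less_base) (use e in simp)
      then show ?thesis by (simp add: dist_norm linear_diff[OF bounded_linear.linear[OF T]])
    qed
    then show "\<exists>d>0. \<forall>x\<in>cball 0 M. \<forall>y\<in>cball 0 M. dist (\<Phi> x) (\<Phi> y) < d \<longrightarrow> dist (T x) (T y) < e"
      using d0(1) by blast
  qed
  then show ?thesis by (simp add: T_def[abs_def])
qed

lemma double_compact:
  assumes a: "cfst x \<in> \<A>" and b: "csnd x \<in> \<A>"
  shows "compact_op (double_rep \<pi> x \<circ> resolvent_root Dt)"
proof -
  define T1 where "T1 f = \<pi> (cfst x) (fst (Rt f))" for f
  define T2 where "T2 f = \<pi> (csnd x) (snd (Rt f))" for f
  have T_eq: "double_rep \<pi> x \<circ> Rt = (\<lambda>f. (T1 f, T2 f))"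
    by (auto simp: double_rep_def T1_def T2_def split: prod.splits)
  have energy: "\<exists>w. Dt (Rt f) = Some w \<and> (norm (Rt f))\<^sup>2 + (norm w)\<^sup>2 \<le> (norm f)\<^sup>2" for f
  proof -
    obtain w where "Dt (Rt f) = Some w" "(norm (Rt f))\<^sup>2 + (norm w)\<^sup>2 = (norm f)\<^sup>2" by (rule Rt_dom)
    then show ?thesis by auto
  qed
  have swap_energy: "\<exists>w. Dt (prod.swap (Rt f)) = Some w \<and>
      (norm (prod.swap (Rt f)))\<^sup>2 + (norm w)\<^sup>2 \<le> (norm f)\<^sup>2" for f
  proof -
    obtain w where w: "Dt (Rt f) = Some w" "(norm (Rt f))\<^sup>2 + (norm w)\<^sup>2 = (norm f)\<^sup>2" by (rule Rt_dom)
    have "Dt (prod.swap (Rt f)) = Some (prod.swap w)"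
      using w(1) Dt_swap by (metis prod.collapse prod.swap_def fst_swap snd_swap)
    moreover have "norm (prod.swap p) = norm p" for p :: "'h \<times> 'h" by (simp add: norm_prod_def add.commute)
    ultimately show ?thesis using w(2) by auto
  qed
  have blswap: "bounded_linear (\<lambda>f. prod.swap (Rt f))"
    unfolding prod.swap_def
    by (intro bounded_linear_Pair bounded_linear_compose[OF bounded_linear_fst Rt_bounded_linear]
        bounded_linear_compose[OF bounded_linear_snd Rt_bounded_linear])
  have c1: "compact (closure (T1 ` cball 0 M))" for M
    unfolding T1_def by (rule first_component_compact[OF a Rt_bounded_linear energy])
  have c2: "compact (closure (T2 ` cball 0 M))" for M
    using first_component_compact[OF b blswap swap_energy] by (simp add: T2_def[abs_def])
  have clin: "bounded_clinear (\<lambda>f. (T1 f, T2 f))"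
  proof -
    have cl: "bounded_clinear (\<pi> (cfst x))" "bounded_clinear (\<pi> (csnd x))"
      using rep_clinear \<A>_in_A a b by blast+
    have proj: "fst (c *\<^sub>C p) = c *\<^sub>C fst p" "snd (c *\<^sub>C p) = c *\<^sub>C snd p" for c and p :: "'h \<times> 'h"
      by (simp_all add: scaleC_prod_def)
    have "T1 (c *\<^sub>C f) = c *\<^sub>C T1 f" "T2 (c *\<^sub>C f) = c *\<^sub>C T2 f" for c f
      by (simp_all add: T1_def T2_def bounded_clinear_scaleC[OF Rt_clinear] proj
          bounded_clinear_scaleC[OF cl(1)] bounded_clinear_scaleC[OF cl(2)])
    then have "(T1 (c *\<^sub>C f), T2 (c *\<^sub>C f)) = c *\<^sub>C (T1 f, T2 f)" for c f
      by (simp add: scaleC_prod_def[of c "(T1 f, T2 f)"])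
    moreover have "bounded_linear (\<lambda>f. (T1 f, T2 f))"
      unfolding T1_def T2_def
      by (intro bounded_linear_Pair bounded_linear_compose[OF bounded_clinear_bounded_linear[OF cl(1)]]
          bounded_linear_compose[OF bounded_clinear_bounded_linear[OF cl(2)]]
          bounded_linear_compose[OF bounded_linear_fst Rt_bounded_linear]
          bounded_linear_compose[OF bounded_linear_snd Rt_bounded_linear])
    ultimately show ?thesis unfolding bounded_clinear_def by blast
  qed
  show ?thesis
    unfolding T_eq compact_op_def
  proof (intro conjI clin allI impI)
    fix S :: "('h \<times> 'h) set" assume "bounded S"
    then obtain M where "\<forall>f\<in>S. norm f \<le> M" unfolding bounded_iff by blast
    then have M: "S \<subseteq> cball 0 M" by auto
    show "compact (closure ((\<lambda>f. (T1 f, T2 f)) ` S))"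
    proof (rule compact_closure_mono)
      show "(\<lambda>f. (T1 f, T2 f)) ` S \<subseteq> T1 ` cball 0 M \<times> T2 ` cball 0 M" using M by blast
      show "compact (closure (T1 ` cball 0 M \<times> T2 ` cball 0 M))"
        unfolding closure_Times by (intro compact_Times c1 c2)
    qed
  qed
qed

end

section \<open>The pullback algebra\<close>

lemma star_minus: "star (- x) = - star (x :: 'a::cstar_algebra)"
  using star_scaleC[of "- 1" x] by (simp add: scaleC_minus1)

lemma star_diff: "star (x - y) = star x - star (y :: 'a::cstar_algebra)"
  using star_add[of x "- y"] by (simp add: star_minus)

lemma norm_star: "norm (star x) = norm (x :: 'a::cstar_algebra)"
proof -
  have le: "norm y \<le> norm (star y)" for y :: 'a
  proof -
    have "norm y * norm y \<le> norm (star y) * norm y"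
      using cstar_identity[of y] norm_mult_ineq[of "star y" y] by (simp add: power2_eq_square)
    then show ?thesis by (cases "norm y = 0") auto
  qed
  show ?thesis using le[of x] le[of "star x"] by (simp add: star_star)
qed

text \<open>The involution is isometric, so it preserves the closure of \<open>\<J>\<close>.\<close>
lemma star_closed_ideal:
  fixes J :: "'a::cstar_algebra set"
  assumes "closed J" "dense_star_subalgebra \<J> J" "j \<in> J"
  shows "star j \<in> J"
proof -
  have J: "\<J> \<subseteq> J" "J \<subseteq> closure \<J>" and st: "\<And>x. x \<in> \<J> \<Longrightarrow> star x \<in> \<J>"
    using assms(2) by (auto simp: dense_star_subalgebra_def star_subalgebra_def)
  have "star j \<in> closure \<J>"
    unfolding closure_approachable
  proof (intro allI impI)
    fix e :: real assume "e > 0"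
    then obtain x where x: "x \<in> \<J>" "dist x j < e"
      using subsetD[OF J(2) assms(3)] unfolding closure_approachable by blast
    have "dist (star x) (star j) < e" using x(2) by (simp add: dist_norm star_diff[symmetric] norm_star)
    then show "\<exists>y\<in>\<J>. dist y (star j) < e" using st[OF x(1)] by blast
  qed
  then show ?thesis using closure_minimal[OF J(1) assms(1)] by blast
qed

lemma pullback_iff: "x \<in> pullback A J \<longleftrightarrow> cfst x \<in> A \<and> csnd x \<in> A \<and> cfst x - csnd x \<in> J"
  by (cases x) (auto simp: pullback_def)

lemmas cstar_sum_ops = zero_cstar_sum_def plus_cstar_sum_def scaleR_cstar_sum_def scaleC_cstar_sum_def
  times_cstar_sum_def star_cstar_sum_def

lemma closed_pullback:
  fixes A J :: "'a::cstar_algebra set"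
  assumes "closed A" "closed J"
  shows "closed (pullback A J)"
proof -
  have bl: "bounded_linear (cfst :: ('a, 'a) cstar_sum \<Rightarrow> 'a)" "bounded_linear (csnd :: ('a, 'a) cstar_sum \<Rightarrow> 'a)"
    by (auto intro!: bounded_linear_intro[where K = 1]
        simp: plus_cstar_sum_def scaleR_cstar_sum_def norm_cstar_sum_def)
  note cont = linear_continuous_on[OF bl(1)] linear_continuous_on[OF bl(2)]
  have "pullback A J = cfst -` A \<inter> csnd -` A \<inter> (\<lambda>x. cfst x - csnd x) -` J"
    by (auto simp: pullback_iff)
  then show ?thesis
    by (auto intro!: closed_Int closed_vimage assms cont continuous_on_diff)
qed

lemma star_subalgebra_pullback:
  fixes A J :: "'a::cstar_algebra set"
  assumes A: "star_subalgebra A" and J: "two_sided_ideal J A" and st: "\<And>j. j \<in> J \<Longrightarrow> star j \<in> J"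
  shows "star_subalgebra (pullback A J)"
proof -
  have cA: "csubspace A" and mulA: "\<And>x y. x \<in> A \<Longrightarrow> y \<in> A \<Longrightarrow> x * y \<in> A"
    and stA: "\<And>x. x \<in> A \<Longrightarrow> star x \<in> A" using A by (auto simp: star_subalgebra_def)
  have cJ: "csubspace J" and JA: "\<And>a j. a \<in> A \<Longrightarrow> j \<in> J \<Longrightarrow> a * j \<in> J" "\<And>a j. a \<in> A \<Longrightarrow> j \<in> J \<Longrightarrow> j * a \<in> J"
    using J by (auto simp: two_sided_ideal_def)
  have add: "x + y \<in> pullback A J" if "x \<in> pullback A J" "y \<in> pullback A J" for x y
    using that csubspaceD(3)[OF cA] csubspaceD(3)[OF cJ, of "cfst x - csnd x" "cfst y - csnd y"]
    by (simp add: pullback_iff cstar_sum_ops algebra_simps)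
  have scaleC: "c *\<^sub>C x \<in> pullback A J" if "x \<in> pullback A J" for c x
    using that csubspaceD(6)[OF cA] csubspaceD(6)[OF cJ, of "cfst x - csnd x" c]
    by (simp add: pullback_iff cstar_sum_ops scaleC_diff_right)
  have "x * y \<in> pullback A J" if x: "x \<in> pullback A J" and y: "y \<in> pullback A J" for x y
  proof -
    have "cfst x * (cfst y - csnd y) + (cfst x - csnd x) * csnd y \<in> J"
      using x y by (intro csubspaceD(3)[OF cJ] JA) (auto simp: pullback_iff)
    then show ?thesis using x y by (simp add: pullback_iff cstar_sum_ops mulA algebra_simps)
  qed
  moreover have "star x \<in> pullback A J" if "x \<in> pullback A J" for x
    using that st[of "cfst x - csnd x"] by (simp add: pullback_iff cstar_sum_ops stA star_diff)
  moreover have "csubspace (pullback A J)"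
    unfolding csubspace_def subspace_def
    using add scaleC csubspaceD(2)[OF cA] csubspaceD(2)[OF cJ]
    by (auto simp: scaleR_scaleC zero_cstar_sum_def pullback_iff[of "Cstar_Sum 0 0"])
  ultimately show ?thesis by (simp add: star_subalgebra_def)
qed

text \<open>Approximate the second entry by \<open>b\<close> and the difference of the entries by \<open>j\<close>; then
  \<open>Cstar_Sum (b + j) b\<close> is close to the given element.\<close>
lemma pullback_dense:
  fixes A J :: "'a::cstar_algebra set"
  assumes "A \<subseteq> closure \<A>" "J \<subseteq> closure \<J>" and add: "\<And>a j. a \<in> \<A> \<Longrightarrow> j \<in> \<J> \<Longrightarrow> a + j \<in> \<A>"
  shows "pullback A J \<subseteq> closure (pullback \<A> \<J>)"
proof
  fix x assume "x \<in> pullback A J"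
  then have x: "csnd x \<in> closure \<A>" "cfst x - csnd x \<in> closure \<J>" using assms(1,2) by (auto simp: pullback_iff)
  show "x \<in> closure (pullback \<A> \<J>)"
    unfolding closure_approachable
  proof (intro allI impI)
    fix e :: real assume "e > 0"
    then have e2: "e / 2 > 0" by simp
    obtain b where b: "b \<in> \<A>" "dist b (csnd x) < e / 2" using x(1) e2 unfolding closure_approachable by blast
    obtain j where j: "j \<in> \<J>" "dist j (cfst x - csnd x) < e / 2" using x(2) e2 unfolding closure_approachable by blast
    have "b + j - cfst x = (b - csnd x) + (j - (cfst x - csnd x))" by simp
    then have "norm (b + j - cfst x) \<le> norm (b - csnd x) + norm (j - (cfst x - csnd x))"
      by (metis norm_triangle_ineq)
    then have "norm (b + j - cfst x) < e" using b(2) j(2) unfolding dist_norm by linarith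
    then have "dist (Cstar_Sum (b + j) b) x < e"
      using b(2) e2 by (simp add: dist_cstar_sum_def norm_cstar_sum_def minus_cstar_sum_def dist_norm)
    moreover have "Cstar_Sum (b + j) b \<in> pullback \<A> \<J>" using b(1) j(1) add by (simp add: pullback_iff)
    ultimately show "\<exists>y\<in>pullback \<A> \<J>. dist y x < e" by blast
  qed
qed

lemma graded_cstar_algebra_pullback:
  fixes A J :: "'a::cstar_algebra set"
  assumes A: "graded_cstar_algebra A \<alpha>" and J: "graded_ideal J A \<alpha>" and st: "\<And>j. j \<in> J \<Longrightarrow> star j \<in> J"
  shows "graded_cstar_algebra (pullback A J) (double_automorphism \<alpha>)"
proof -
  have sub: "star_subalgebra A" "closed A"
    and al: "\<And>x. x \<in> A \<Longrightarrow> \<alpha> x \<in> A" "\<And>x. x \<in> A \<Longrightarrow> \<alpha> (\<alpha> x) = x" "\<And>x. x \<in> A \<Longrightarrow> \<alpha> (star x) = star (\<alpha> x)"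
    "\<And>x y. x \<in> A \<Longrightarrow> y \<in> A \<Longrightarrow> \<alpha> (x + y) = \<alpha> x + \<alpha> y" "\<And>x y. x \<in> A \<Longrightarrow> y \<in> A \<Longrightarrow> \<alpha> (x * y) = \<alpha> x * \<alpha> y"
    "\<And>c x. x \<in> A \<Longrightarrow> \<alpha> (c *\<^sub>C x) = c *\<^sub>C \<alpha> x"
    using A by (auto simp: graded_cstar_algebra_def)
  have idl: "two_sided_ideal J A" "closed J" "\<And>j. j \<in> J \<Longrightarrow> \<alpha> j \<in> J"
    using J by (auto simp: graded_ideal_def)
  have cA: "csubspace A" using sub(1) by (simp add: star_subalgebra_def)
  have al_diff: "\<alpha> (x - y) = \<alpha> x - \<alpha> y" if "x \<in> A" "y \<in> A" for x y
    using al(4)[of x "- y"] al(6)[of y "- 1"] csubspaceD(5)[OF cA] that by (simp add: scaleC_minus1)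
  have pull: "double_automorphism \<alpha> x \<in> pullback A J" if "x \<in> pullback A J" for x
    using that idl(3)[of "cfst x - csnd x"]
    by (simp add: pullback_iff double_automorphism_def al al_diff)
  show ?thesis
    unfolding graded_cstar_algebra_def
    using star_subalgebra_pullback[OF sub(1) idl(1) st] closed_pullback[OF sub(2) idl(2)] pull
    by (auto simp: double_automorphism_def al cstar_sum_ops pullback_iff cstar_sum.expand)
qed

section \<open>The spectral triple of the double\<close>

context relative_triple_with_normal
begin

lemma grading_op_double: "grading_op (double_grading \<gamma>)"
proof -
  note bl = bounded_clinear_bounded_linear[OF grading_clinear]
  have adj: "cinner (\<gamma> x) y = cinner x (\<gamma> y)" for x y
    using grading by (simp add: grading_op_def is_adjoint_def)
  have eq: "double_grading \<gamma> = (\<lambda>p. (\<gamma> (fst p), - \<gamma> (snd p)))" by (auto simp: double_grading_def)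
  have "bounded_linear (double_grading \<gamma>)" unfolding eq
    by (intro bounded_linear_Pair bounded_linear_minus bounded_linear_compose[OF bl]
        bounded_linear_fst bounded_linear_snd)
  then have "bounded_clinear (double_grading \<gamma>)"
    by (auto simp: bounded_clinear_def eq scaleC_prod_def grading_simps scaleC_minus_right)
  moreover have "is_adjoint (double_grading \<gamma>) (double_grading \<gamma>)"
    by (auto simp: is_adjoint_def eq cinner_prod_def adj cinner_minus_left cinner_minus_right)
  ultimately show ?thesis by (auto simp: grading_op_def eq grading_simps)
qed

lemma even_representation_double:
  "even_representation (pullback A J) (double_automorphism \<alpha>) (double_rep \<pi>) (double_grading \<gamma>)"
proof -
  have even: "\<pi> (\<alpha> a) = \<gamma> \<circ> \<pi> a \<circ> \<gamma>" and scale: "\<pi> (c *\<^sub>C a) x = c *\<^sub>C \<pi> a x"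
    and mult: "b \<in> A \<Longrightarrow> \<pi> (a * b) x = \<pi> a (\<pi> b x)"
    and adj: "cinner (\<pi> (star a) x) y = cinner x (\<pi> a y)"
    if "a \<in> A" for a b c x y
    using rel that by (auto simp: relative_spectral_triple_def even_representation_def is_adjoint_def)
  have eq: "double_rep \<pi> x = (\<lambda>p. (\<pi> (cfst x) (fst p), \<pi> (csnd x) (snd p)))" for x
    by (auto simp: double_rep_def)
  have "bounded_clinear (double_rep \<pi> x)" if "x \<in> pullback A J" for x
  proof -
    have cl: "bounded_clinear (\<pi> (cfst x))" "bounded_clinear (\<pi> (csnd x))"
      using that rep_clinear by (auto simp: pullback_iff)
    have "bounded_linear (double_rep \<pi> x)" unfolding eq
      by (intro bounded_linear_Pair bounded_linear_compose[OF bounded_clinear_bounded_linear[OF cl(1)]]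
          bounded_linear_compose[OF bounded_clinear_bounded_linear[OF cl(2)]]
          bounded_linear_fst bounded_linear_snd)
    then show ?thesis
      by (auto simp: bounded_clinear_def eq scaleC_prod_def bounded_clinear_scaleC[OF cl(1)]
          bounded_clinear_scaleC[OF cl(2)])
  qed
  moreover have "is_adjoint (double_rep \<pi> (star x)) (double_rep \<pi> x)" if "x \<in> pullback A J" for x
    using that by (auto simp: is_adjoint_def eq cinner_prod_def star_cstar_sum_def pullback_iff adj)
  moreover have "double_rep \<pi> (double_automorphism \<alpha> x) = double_grading \<gamma> \<circ> double_rep \<pi> x \<circ> double_grading \<gamma>"
    if "x \<in> pullback A J" for x
    using that rep_clinear[of "csnd x"]
    by (auto simp: eq double_automorphism_def double_grading_def even pullback_iff grading_simps
        bounded_clinear_minus)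
  ultimately show ?thesis
    unfolding even_representation_def
    by (auto simp: eq pullback_iff cstar_sum_ops rep_add mult scale scaleC_prod_def)
qed

lemma double_commutator_bounded:
  assumes a: "cfst x \<in> \<A>" and b: "csnd x \<in> \<A>"
    and dom: "\<And>p. p \<in> dom Dt \<Longrightarrow> double_rep \<pi> x p \<in> dom Dt"
  shows "bounded_op (graded_commutator (double_grading \<gamma>) Dt (double_rep \<pi> x))"
proof -
  let ?a = "cfst x" and ?b = "csnd x"
  obtain K where K: "\<And>y u. Ds y = Some u \<Longrightarrow>
      \<exists>v. Ds (\<pi> ?a y) = Some v \<and> norm (v - \<gamma> (\<pi> ?a (\<gamma> u))) \<le> K * norm y" using rep_adjoint_commutator_bound[OF a] by blast
  obtain L where L: "\<And>y u. Ds y = Some u \<Longrightarrow>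
      \<exists>v. Ds (\<pi> ?b y) = Some v \<and> norm (v - \<gamma> (\<pi> ?b (\<gamma> u))) \<le> L * norm y" using rep_adjoint_commutator_bound[OF b] by blast
  have bound: "norm (graded_commutator (double_grading \<gamma>) Dt (double_rep \<pi> x) \<cdot> p) \<le> (\<bar>K\<bar> + \<bar>L\<bar>) * norm p"
    if p: "p \<in> dom (graded_commutator (double_grading \<gamma>) Dt (double_rep \<pi> x))" for p
  proof -
    obtain \<xi> \<eta> where p_eq: "p = (\<xi>, \<eta>)" by (cases p)
    have pD: "(\<xi>, \<eta>) \<in> dom Dt"
      using p by (auto simp: p_eq graded_commutator_def op_diff_def map_comp_def dom_def split: if_splits option.splits)
    have W: "\<xi> \<in> dom Ds" "\<eta> \<in> dom Ds" using pD W_dom by (auto simp: Dt_dom_iff)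
    have Sp: "(\<pi> ?a \<xi>, \<pi> ?b \<eta>) \<in> dom Dt" using dom[OF pD] by (simp add: double_rep_def)
    have val: "graded_commutator (double_grading \<gamma>) Dt (double_rep \<pi> x) p =
        Some (Ds \<cdot> (\<pi> ?a \<xi>) - \<gamma> (\<pi> ?a (\<gamma> (Ds \<cdot> \<xi>))), Ds \<cdot> (\<pi> ?b \<eta>) - \<gamma> (\<pi> ?b (\<gamma> (Ds \<cdot> \<eta>))))"
      using Dt_app[OF pD] Dt_app[OF Sp] bounded_clinear_minus[OF rep_clinear[OF \<A>_in_A[OF b]]]
      by (simp add: graded_commutator_def op_diff_def map_comp_def dom_def p_eq double_rep_def
          double_grading_def grading_simps)
    have "norm (Ds \<cdot> (\<pi> ?a \<xi>) - \<gamma> (\<pi> ?a (\<gamma> (Ds \<cdot> \<xi>)))) \<le> K * norm \<xi>"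
      using K[of \<xi> "Ds \<cdot> \<xi>"] W(1) by auto
    also have "\<dots> \<le> \<bar>K\<bar> * norm p" using norm_fst_le[of \<xi> \<eta>] by (intro mult_mono) (auto simp: p_eq)
    finally have 1: "norm (Ds \<cdot> (\<pi> ?a \<xi>) - \<gamma> (\<pi> ?a (\<gamma> (Ds \<cdot> \<xi>)))) \<le> \<bar>K\<bar> * norm p" .
    have "norm (Ds \<cdot> (\<pi> ?b \<eta>) - \<gamma> (\<pi> ?b (\<gamma> (Ds \<cdot> \<eta>)))) \<le> L * norm \<eta>"
      using L[of \<eta> "Ds \<cdot> \<eta>"] W(2) by auto
    also have "\<dots> \<le> \<bar>L\<bar> * norm p" using norm_snd_le[of \<eta> \<xi>] by (intro mult_mono) (auto simp: p_eq)
    finally have 2: "norm (Ds \<cdot> (\<pi> ?b \<eta>) - \<gamma> (\<pi> ?b (\<gamma> (Ds \<cdot> \<eta>)))) \<le> \<bar>L\<bar> * norm p" .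
    show ?thesis
      unfolding val option.sel
      using order_trans[OF norm_Pair_le add_mono[OF 1 2]] by (simp add: distrib_right)
  qed
  then show ?thesis unfolding bounded_op_def by blast
qed

lemma double_spectral_triple:
  "spectral_triple (pullback A J) (double_automorphism \<alpha>) (pullback \<A> \<J>)
    (double_rep \<pi>) (double_grading \<gamma>) Dt"
proof -
  have dA: "star_subalgebra \<A>" "\<A> \<subseteq> A" "A \<subseteq> closure \<A>"
    and dJ: "dense_star_subalgebra \<J> J" "star_subalgebra \<J>" "\<J> \<subseteq> J" "J \<subseteq> closure \<J>"
    and idl: "two_sided_ideal \<J> \<A>"
    using rel by (auto simp: relative_spectral_triple_def dense_star_subalgebra_def)
  have stJ: "star j \<in> J" if "j \<in> J" for j
    using star_closed_ideal[OF _ dJ(1) that] ideal by (simp add: graded_ideal_def)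
  have "star_subalgebra (pullback \<A> \<J>)"
    by (rule star_subalgebra_pullback[OF dA(1) idl]) (use dJ(2) in \<open>auto simp: star_subalgebra_def\<close>)
  moreover have "pullback \<A> \<J> \<subseteq> pullback A J" using dA(2) dJ(3) by (auto simp: pullback_iff)
  moreover have "pullback A J \<subseteq> closure (pullback \<A> \<J>)"
    using dA(1) idl
    by (intro pullback_dense dA(3) dJ(4)) (auto simp: two_sided_ideal_def star_subalgebra_def intro: csubspaceD(3))
  ultimately have dense: "dense_star_subalgebra (pullback \<A> \<J>) (pullback A J)"
    by (simp add: dense_star_subalgebra_def)
  have cJ: "csubspace \<J>" using idl by (simp add: two_sided_ideal_def)
  have pres: "double_rep \<pi> x p \<in> dom Dt" if x: "x \<in> pullback \<A> \<J>" and p: "p \<in> dom Dt" for x p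
  proof -
    have "csnd x - cfst x \<in> \<J>" using csubspaceD(5)[OF cJ, of "cfst x - csnd x"] x by (simp add: pullback_iff)
    then have "(\<pi> (cfst x) (fst p), \<pi> (csnd x) (snd p)) \<in> dom Dt"
      using x p by (intro double_rep_dom_Dt) (auto simp: pullback_iff)
    then show ?thesis by (simp add: double_rep_def case_prod_unfold)
  qed
  have "bounded_op (graded_commutator (double_grading \<gamma>) Dt (double_rep \<pi> x))" if "x \<in> pullback \<A> \<J>" for x
    using that pres[OF that] by (intro double_commutator_bounded) (auto simp: pullback_iff)
  moreover have "compact_op (double_rep \<pi> x \<circ> inv_sqrt_one_plus (Dt \<circ>\<^sub>m Dt))" if "x \<in> pullback \<A> \<J>" for x
    using double_compact[of x] that by (simp add: Dt_adj pullback_iff)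
  moreover have "double_rep \<pi> x ` dom Dt \<subseteq> dom Dt" if "x \<in> pullback \<A> \<J>" for x
    using pres[OF that] by blast
  ultimately show ?thesis
    unfolding spectral_triple_def
    by (intro conjI ballI graded_cstar_algebra_pullback[OF graded ideal stJ] dense grading_op_double
        even_representation_double Dt_self_adjoint Dt_odd) auto
qed

end

theorem theorem3p21:
  fixes A J \<A> \<J> :: "'a::cstar_algebra set" and \<alpha> :: "'a \<Rightarrow> 'a"
    and \<pi> :: "'a \<Rightarrow> 'h::chilbert \<Rightarrow> 'h" and \<gamma> n :: "'h \<Rightarrow> 'h" and D :: "'h \<rightharpoonup> 'h"
  assumes "graded_cstar_algebra A \<alpha>" and "separable_space (top_of_set A)"
    and "graded_ideal J A \<alpha>"
    and "relative_spectral_triple J A \<alpha> \<J> \<A> \<pi> \<gamma> D"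
    and "clifford_normal \<A> \<pi> \<gamma> D n"
  shows "spectral_triple (pullback A J) (double_automorphism \<alpha>) (pullback \<A> \<J>)
    (double_rep \<pi>) (double_grading \<gamma>) (double_op \<gamma> D n)"
  using assms(1,3-5)
  by (intro relative_triple_with_normal.double_spectral_triple relative_triple_with_normal.intro)

end
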